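(* Let $\Bbbk$ be a field, let $\mathcal{F}\subset\mathsf{X}^\omega$ be a one-sided topological Markov chain with set of allowed transitions $T\subset\mathsf{X}^2$, and let $\mathfrak{G}$ be a contracting completely shift-invariant groupoid with unit space $\mathcal{F}$ and nucleus $\mathcal{N}$. Let $\mathfrak{O}_{\mathfrak{G}}$ be the groupoid of germs generated by $\mathfrak{G}$ and the shift $\sigma\colon\mathcal{F}\to\mathcal{F}$. Fix $n_0\ge 1$ such that $S_u^{-1}F_1F_2S_v\in\mathcal{N}$ for all $F_1,F_2\in\mathcal{N}$ and all $u,v\in\mathsf{X}^{n_0}$. Then the Steinberg algebra $\Bbbk\mathfrak{O}_{\mathfrak{G}}$ is isomorphic to the $\Bbbk$-algebra defined by the presentation with generators $S_x, S_x^{-1}$, for $x\in\mathsf{X}$, and $F\in\mathcal{N}$, with the following defining relations (all of which hold in $\Bbbk\mathfrak{O}_{\mathfrak{G}}$): (a) (Cuntz–Krieger relations) $S_x^{-1}S_x=\sum_{y:\,xy\in T}S_yS_y^{-1}$, $\ \sum_{y\in\mathsf{X}}S_yS_y^{-1}=1$, $\ S_a^{-1}S_b=0$, for all $x,a,b\in\mathsf{X}$ with $a\ne b$; (b) (description of the nucleus) for every $F\in\mathcal{N}$: $F=\sum_{x,y\in\mathsf{X}}S_yF_{x,y}S_x^{-1}$, where $F_{x,y}=S_y^{-1}FS_x\in\mathcal{N}$; (c) (decompositions of pairwise products of elements of the nucleus) for all $F_1,F_2\in\mathcal{N}$: $F_1F_2=\sum_{v,u\in\mathsf{X}^{n_0}}S_uF_{v,u}S_v^{-1}$,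 where $F_{v,u}=S_u^{-1}F_1F_2S_v\in\mathcal{N}$. Here $S_{x_1\ldots x_n}=S_{x_1}\cdots S_{x_n}$ and $S_{x_1\ldots x_n}^{-1}=S_{x_n}^{-1}\cdots S_{x_1}^{-1}$.
   Context: Groupoid conventions. For an element $g$ of a groupoid, $\mathsf{s}(g)=g^{-1}g$, $\mathsf{r}(g)=gg^{-1}$; the product $g_1g_2$ is defined iff $\mathsf{s}(g_1)=\mathsf{r}(g_2)$. Topological groupoids are locally compact with Hausdorff unit space (the groupoid itself need not be Hausdorff); étale means $\mathsf{s},\mathsf{r}$ are local homeomorphisms; a bisection is a subset $U$ on which $\mathsf{s}\colon U\to\mathsf{s}(U)$ and $\mathsf{r}\colon U\to\mathsf{r}(U)$ are homeomorphisms. Ample (second countable) groupoids are those with a basis of compact open bisections. An étale groupoid is effective if every neighborhood of every non-unit $g$ contains $h$ with $\mathsf{s}(h)\ne\mathsf{r}(h)$; equivalently it is the groupoid of germs of the local homeomorphisms $\mathsf{s}(g)\mapsto\mathsf{r}(g)$, $g\in F$, for open bisections $F$; open bisections are identified with these local homeomorphisms. Shifts and contraction. $\mathsf{X}$ is a finite alphabet, $\mathcal{F}$ is the set of all sequences $x_1x_2\ldots\in\mathsf{X}^\omega$ with $x_nx_{n+1}\in T$ for all $n$, and $\sigma(x_1x_2\ldots)=x_2x_3\ldots$. For $x\in\mathsf{X}$, $S_x$ is the local homeomorphism $w\mapsto xw$ defined on $\{w\in\mathcal{F}:xw\in\mathcal{F}\}$, and $S_{x_1\ldots x_n}=S_{x_1}\cdots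 S_{x_n}$ (possibly the empty map). Let $\mathfrak{G}$ be an effective étale groupoid with unit space $\mathcal{F}$. For $g\in\mathfrak{G}$ with $\mathsf{s}(g)=x_1x_2\ldots$, $\mathsf{r}(g)=y_1y_2\ldots$, put $\varsigma(g)=S_{y_1}^{-1}gS_{x_1}$. $\mathfrak{G}$ is shift-invariant if $\varsigma(\mathfrak{G})\subset\mathfrak{G}$, and completely shift-invariant if moreover $S_ygS_x^{-1}\in\mathfrak{G}$ whenever $g\in\mathfrak{G}$, $x,y\in\mathsf{X}$ and $x\,\mathsf{s}(g),y\,\mathsf{r}(g)\in\mathcal{F}$. It is contracting if there is a compact $C\subset\mathfrak{G}$ such that for every $g\in\mathfrak{G}$ there is $n$ with $\varsigma^n(g)\in C$. Its nucleus $\mathcal{N}$ is then the smallest finite set of compact open $\mathfrak{G}$-bisections (the empty bisection is included) such that for every compact open $\mathfrak{G}$-bisection $F$ there is $n$ such that $S_{v_1}^{-1}FS_{v_2}\in\mathcal{N}$ for all $v_1,v_2\in\mathsf{X}^m$, $m\ge n$ (such a smallest set exists). It satisfies $S_y^{-1}FS_x\in\mathcal{N}$ for $F\in\mathcal{N}$, $x,y\in\mathsf{X}$. Steinberg algebra. For an ample groupoid $\mathfrak{H}$, $\Bbbk\mathfrak{H}$ is the linear span of the indicator functions $1_F\colon\mathfrak{H}\to\Bbbk$ of compact open bisections $F$, with the convolution product $(f_1f_2)(g)=\sum_{g=g_1g_2}f_1(g_1)f_2(g_2)$, so that $1_{F_1}1_{F_2}=1_{F_1F_2}$. In $\Bbbk\mathfrak{O}_{\mathfrak{G}}$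 one writes $S_x$, $S_x^{-1}$, $F$ for the indicators $1_{S_x}$, $1_{S_x^{-1}}$, $1_F$.
   Formalization: The Markov chain is assumed to have no isolated points (the claim fails for the one-point chain), and two relations are added: the empty bisection is 0, and an F in the nucleus equal to the bisection S_x^{-1}S_x is that product (else all F could be sent to 0). *)

theory Defs
  imports "HOL-Analysis.Analysis" "HOL-Algebra.QuotRing" "HOL-Algebra.Module"
    "HOL-Library.Poly_Mapping"
begin

section \<open>Topological groupoids\<close>

text \<open>
  A groupoid is given by its space of arrows and its unit space. The unit space is kept as
  a space of its own, embedded into the arrows by \<open>unt\<close>; thus the elements
  $g^{-1}g$ and $gg^{-1}$ are \<open>unt (src g)\<close> and \<open>unt (tgt g)\<close>.
\<close>

record ('o, 'g) groupoid =
  Arr :: "'g topology"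
  Obj :: "'o topology"
  src :: "'g \<Rightarrow> 'o"
  tgt :: "'g \<Rightarrow> 'o"
  unt :: "'o \<Rightarrow> 'g"
  gmult :: "'g \<Rightarrow> 'g \<Rightarrow> 'g"
  ginv :: "'g \<Rightarrow> 'g"

abbreviation arrows :: "('o, 'g, 'm) groupoid_scheme \<Rightarrow> 'g set" where
  "arrows G \<equiv> topspace (Arr G)"

abbreviation objects :: "('o, 'g, 'm) groupoid_scheme \<Rightarrow> 'o set" where
  "objects G \<equiv> topspace (Obj G)"

locale groupoid =
  fixes G :: "('o, 'g, 'm) groupoid_scheme"
  assumes src_closed: "g \<in> arrows G \<Longrightarrow> src G g \<in> objects G"
    and tgt_closed: "g \<in> arrows G \<Longrightarrow> tgt G g \<in> objects G"
    and unt_closed: "x \<in> objects G \<Longrightarrow> unt G x \<in> arrows G"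
    and src_unt: "x \<in> objects G \<Longrightarrow> src G (unt G x) = x"
    and tgt_unt: "x \<in> objects G \<Longrightarrow> tgt G (unt G x) = x"
    and gmult_closed:
      "\<lbrakk>g \<in> arrows G; h \<in> arrows G; src G g = tgt G h\<rbrakk> \<Longrightarrow> gmult G g h \<in> arrows G"
    and src_gmult:
      "\<lbrakk>g \<in> arrows G; h \<in> arrows G; src G g = tgt G h\<rbrakk> \<Longrightarrow> src G (gmult G g h) = src G h"
    and tgt_gmult:
      "\<lbrakk>g \<in> arrows G; h \<in> arrows G; src G g = tgt G h\<rbrakk> \<Longrightarrow> tgt G (gmult G g h) = tgt G g"
    and gmult_assoc:
      "\<lbrakk>f \<in> arrows G; g \<in> arrows G; h \<in> arrows G; src G f = tgt G g; src G g = tgt G h\<rbrakk>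
        \<Longrightarrow> gmult G (gmult G f g) h = gmult G f (gmult G g h)"
    and gmult_unt: "g \<in> arrows G \<Longrightarrow> gmult G g (unt G (src G g)) = g"
    and unt_gmult: "g \<in> arrows G \<Longrightarrow> gmult G (unt G (tgt G g)) g = g"
    and ginv_closed: "g \<in> arrows G \<Longrightarrow> ginv G g \<in> arrows G"
    and src_ginv: "g \<in> arrows G \<Longrightarrow> src G (ginv G g) = tgt G g"
    and tgt_ginv: "g \<in> arrows G \<Longrightarrow> tgt G (ginv G g) = src G g"
    and ginv_gmult: "g \<in> arrows G \<Longrightarrow> gmult G (ginv G g) g = unt G (src G g)"
    and gmult_ginv: "g \<in> arrows G \<Longrightarrow> gmult G g (ginv G g) = unt G (tgt G g)"

locale topological_groupoid = groupoid +
  assumes continuous_src: "continuous_map (Arr G) (Obj G) (src G)"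
    and continuous_tgt: "continuous_map (Arr G) (Obj G) (tgt G)"
    and homeomorphic_unt:
      "homeomorphic_map (Obj G) (subtopology (Arr G) (unt G ` objects G)) (unt G)"
    and continuous_gmult:
      "continuous_map (subtopology (prod_topology (Arr G) (Arr G)) {(g, h). src G g = tgt G h})
        (Arr G) (\<lambda>(g, h). gmult G g h)"
    and continuous_ginv: "continuous_map (Arr G) (Arr G) (ginv G)"
    and locally_compact: "locally_compact_space (Arr G)"
    and Hausdorff_units: "Hausdorff_space (Obj G)"

definition local_homeo :: "'a topology \<Rightarrow> 'b topology \<Rightarrow> ('a \<Rightarrow> 'b) \<Rightarrow> bool" where
  "local_homeo X Y f \<longleftrightarrow>
    (\<forall>x\<in>topspace X. \<exists>U. openin X U \<and> x \<in> U \<and> openin Y (f ` U) \<and>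
       homeomorphic_map (subtopology X U) (subtopology Y (f ` U)) f)"

locale etale_groupoid = topological_groupoid +
  assumes local_homeo_src: "local_homeo (Arr G) (Obj G) (src G)"
    and local_homeo_tgt: "local_homeo (Arr G) (Obj G) (tgt G)"

locale effective_etale_groupoid = etale_groupoid +
  assumes effective:
    "\<lbrakk>g \<in> arrows G; g \<notin> unt G ` objects G; openin (Arr G) U; g \<in> U\<rbrakk>
      \<Longrightarrow> \<exists>h\<in>U. src G h \<noteq> tgt G h"

definition bisection :: "('o, 'g, 'm) groupoid_scheme \<Rightarrow> 'g set \<Rightarrow> bool" where
  "bisection G U \<longleftrightarrow> U \<subseteq> arrows G \<and>
    homeomorphic_map (subtopology (Arr G) U) (subtopology (Obj G) (src G ` U)) (src G) \<and>
    homeomorphic_map (subtopology (Arr G) U) (subtopology (Obj G) (tgt G ` U)) (tgt G)"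

definition open_bisection :: "('o, 'g, 'm) groupoid_scheme \<Rightarrow> 'g set \<Rightarrow> bool" where
  "open_bisection G U \<longleftrightarrow> bisection G U \<and> openin (Arr G) U"

definition compact_open_bisection :: "('o, 'g, 'm) groupoid_scheme \<Rightarrow> 'g set \<Rightarrow> bool" where
  "compact_open_bisection G U \<longleftrightarrow> open_bisection G U \<and> compactin (Arr G) U"

section \<open>Germs of local homeomorphisms\<close>

text \<open>
  A homeomorphism $f$ between open subsets of $Y$ is represented by its graph, written as the
  set of pairs $(f(x), x)$, i.e. with the \<^emph>\<open>value first\<close>. With this order
  \<^term>\<open>R O R'\<close> is the (partially defined) composition $R \circ R'$, in which $R'$ is
  applied first, \<^term>\<open>Range R\<close> is the domain of $f$ and \<^term>\<open>Domain R\<close> is its image.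
\<close>

definition partial_homeo :: "'o topology \<Rightarrow> 'o rel \<Rightarrow> bool" where
  "partial_homeo Y R \<longleftrightarrow>
    (\<exists>U V f. openin Y U \<and> openin Y V \<and>
       homeomorphic_map (subtopology Y U) (subtopology Y V) f \<and> R = (\<lambda>x. (f x, x)) ` U)"

text \<open>
  The germ of $R$ at $x$ is the point $x$ together with the class of all partial
  homeomorphisms coinciding with $R$ on a neighbourhood of $x$.
\<close>

type_synonym 'o germ = "'o \<times> 'o rel set"

definition germ :: "'o topology \<Rightarrow> 'o rel \<Rightarrow> 'o \<Rightarrow> 'o germ" where
  "germ Y R x = (x, {R'. partial_homeo Y R' \<and> x \<in> Range R' \<and>
      (\<exists>U. openin Y U \<and> x \<in> U \<and> R' O Id_on U = R O Id_on U)})"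

definition germs_of :: "'o topology \<Rightarrow> 'o rel \<Rightarrow> 'o germ set" where
  "germs_of Y R = germ Y R ` Range R"

definition germ_rep :: "'o germ \<Rightarrow> 'o rel" where
  "germ_rep \<gamma> = (SOME R. R \<in> snd \<gamma>)"

text \<open>The groupoid of germs of all homeomorphisms between open subsets of $Y$.\<close>

definition germ_groupoid :: "'o topology \<Rightarrow> ('o, 'o germ) groupoid" where
  "germ_groupoid Y = \<lparr>
     Arr = topology_generated_by {germs_of Y R | R. partial_homeo Y R},
     Obj = Y,
     src = fst,
     tgt = (\<lambda>\<gamma>. THE y. (y, fst \<gamma>) \<in> germ_rep \<gamma>),
     unt = germ Y (Id_on (topspace Y)),
     gmult = (\<lambda>\<gamma> \<delta>. germ Y (germ_rep \<gamma> O germ_rep \<delta>) (fst \<delta>)),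
     ginv = (\<lambda>\<gamma>. germ Y ((germ_rep \<gamma>)\<inverse>) (THE y. (y, fst \<gamma>) \<in> germ_rep \<gamma>))\<rparr>"

text \<open>
  The partial homeomorphism $\mathsf{s}(g) \mapsto \mathsf{r}(g)$, $g \in U$, defined by an open
  bisection $U$, and the germ defined by an element $g$ of an etale groupoid.
\<close>

definition bis_homeo :: "('o, 'g, 'm) groupoid_scheme \<Rightarrow> 'g set \<Rightarrow> 'o rel" where
  "bis_homeo G U = (\<lambda>g. (tgt G g, src G g)) ` U"

definition arrow_germ :: "('o, 'g, 'm) groupoid_scheme \<Rightarrow> 'g \<Rightarrow> 'o germ" where
  "arrow_germ G g =
    germ (Obj G) (bis_homeo G (SOME U. open_bisection G U \<and> g \<in> U)) (src G g)"

text \<open>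
  For an effective groupoid, compact open bisections are identified with these partial
  homeomorphisms.
\<close>

definition cob_homeos :: "('o, 'g, 'm) groupoid_scheme \<Rightarrow> 'o rel set" where
  "cob_homeos G = bis_homeo G ` {U. compact_open_bisection G U}"

inductive_set generated_subgroupoid ::
    "('o, 'g, 'm) groupoid_scheme \<Rightarrow> 'g set \<Rightarrow> 'g set"
  for H :: "('o, 'g, 'm) groupoid_scheme" and A :: "'g set" where
  base: "g \<in> A \<Longrightarrow> g \<in> generated_subgroupoid H A"
| unit: "x \<in> objects H \<Longrightarrow> unt H x \<in> generated_subgroupoid H A"
| inv: "g \<in> generated_subgroupoid H A \<Longrightarrow> ginv H g \<in> generated_subgroupoid H A"
| mult: "\<lbrakk>g \<in> generated_subgroupoid H A; h \<in> generated_subgroupoid H A; src H g = tgt H h\<rbrakk>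
    \<Longrightarrow> gmult H g h \<in> generated_subgroupoid H A"

section \<open>Markov chains, shift-invariance, contraction, nucleus\<close>

text \<open>The sequence $x_1x_2\ldots$ is the function \<open>w\<close> with $w\,n = x_{n+1}$.\<close>

definition markov_seqs :: "'x rel \<Rightarrow> (nat \<Rightarrow> 'x) set" where
  "markov_seqs T = {w. \<forall>n. (w n, w (Suc n)) \<in> T}"

definition markov_space :: "'x rel \<Rightarrow> (nat \<Rightarrow> 'x) topology" where
  "markov_space T =
    subtopology (product_topology (\<lambda>_. discrete_topology UNIV) UNIV) (markov_seqs T)"

definition shift :: "(nat \<Rightarrow> 'x) \<Rightarrow> nat \<Rightarrow> 'x" where
  "shift w = (\<lambda>n. w (Suc n))"

definition S_homeo :: "'x rel \<Rightarrow> 'x \<Rightarrow> (nat \<Rightarrow> 'x) rel" where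
  "S_homeo T x = {(case_nat x w, w) | w. w \<in> markov_seqs T \<and> case_nat x w \<in> markov_seqs T}"

definition S_word_homeo :: "'x rel \<Rightarrow> 'x list \<Rightarrow> (nat \<Rightarrow> 'x) rel" where
  "S_word_homeo T u = foldr (\<lambda>x R. S_homeo T x O R) u (Id_on (markov_seqs T))"

text \<open>$\varsigma(\gamma) = S_{y_1}^{-1} \gamma S_{x_1}$, computed with germs.\<close>

definition germ_shift :: "'x rel \<Rightarrow> (nat \<Rightarrow> 'x) germ \<Rightarrow> (nat \<Rightarrow> 'x) germ" where
  "germ_shift T \<gamma> =
    (let Y = markov_space T; H = germ_groupoid Y; w = src H \<gamma>; z = tgt H \<gamma> in
       gmult H (germ Y ((S_homeo T (z 0))\<inverse>) z) (gmult H \<gamma> (germ Y (S_homeo T (w 0)) (shift w))))"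

definition shift_invariant :: "'x rel \<Rightarrow> (nat \<Rightarrow> 'x, 'g, 'm) groupoid_scheme \<Rightarrow> bool" where
  "shift_invariant T G \<longleftrightarrow>
    germ_shift T ` (arrow_germ G ` arrows G) \<subseteq> arrow_germ G ` arrows G"

definition completely_shift_invariant ::
    "'x rel \<Rightarrow> (nat \<Rightarrow> 'x, 'g, 'm) groupoid_scheme \<Rightarrow> bool" where
  "completely_shift_invariant T G \<longleftrightarrow> shift_invariant T G \<and>
    (\<forall>g\<in>arrows G. \<forall>x y.
       case_nat x (src G g) \<in> markov_seqs T \<and> case_nat y (tgt G g) \<in> markov_seqs T \<longrightarrow>
       (let Y = markov_space T; H = germ_groupoid Y in
         gmult H (germ Y (S_homeo T y) (tgt G g))
           (gmult H (arrow_germ G g) (germ Y ((S_homeo T x)\<inverse>) (case_nat x (src G g)))))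
       \<in> arrow_germ G ` arrows G)"

definition contracting :: "'x rel \<Rightarrow> (nat \<Rightarrow> 'x, 'g, 'm) groupoid_scheme \<Rightarrow> bool" where
  "contracting T G \<longleftrightarrow>
    (\<exists>C. compactin (Arr G) C \<and>
       (\<forall>g\<in>arrows G. \<exists>n. (germ_shift T ^^ n) (arrow_germ G g) \<in> arrow_germ G ` C))"

definition attracting ::
    "'x rel \<Rightarrow> (nat \<Rightarrow> 'x, 'g, 'm) groupoid_scheme \<Rightarrow> (nat \<Rightarrow> 'x) rel set \<Rightarrow> bool" where
  "attracting T G M \<longleftrightarrow> finite M \<and> M \<subseteq> cob_homeos G \<and>
    (\<forall>F\<in>cob_homeos G. \<exists>n. \<forall>m\<ge>n. \<forall>v1 v2. length v1 = m \<and> length v2 = m \<longrightarrow>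
       (S_word_homeo T v1)\<inverse> O F O S_word_homeo T v2 \<in> M)"

text \<open>Taking $F$ empty in \<open>attracting\<close> shows that the empty bisection lies in the nucleus.\<close>

definition is_nucleus ::
    "'x rel \<Rightarrow> (nat \<Rightarrow> 'x, 'g, 'm) groupoid_scheme \<Rightarrow> (nat \<Rightarrow> 'x) rel set \<Rightarrow> bool" where
  "is_nucleus T G N \<longleftrightarrow> attracting T G N \<and> (\<forall>M. attracting T G M \<longrightarrow> N \<subseteq> M)"

text \<open>
  The shift need not be injective, so its germs are the germs of those of its restrictions
  that are homeomorphisms between open sets.
\<close>

definition shift_germs :: "'x rel \<Rightarrow> (nat \<Rightarrow> 'x) germ set" where
  "shift_germs T = \<Union>{germs_of (markov_space T) R | R.
      partial_homeo (markov_space T) R \<and> R \<subseteq> {(shift w, w) | w. w \<in> markov_seqs T}}"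

definition O_groupoid ::
    "'x rel \<Rightarrow> (nat \<Rightarrow> 'x, 'g, 'm) groupoid_scheme \<Rightarrow> (nat \<Rightarrow> 'x, (nat \<Rightarrow> 'x) germ) groupoid" where
  "O_groupoid T G =
    (let H = germ_groupoid (markov_space T) in
      H\<lparr>Arr := subtopology (Arr H)
          (generated_subgroupoid H (arrow_germ G ` arrows G \<union> shift_germs T))\<rparr>)"

section \<open>Steinberg algebras\<close>

text \<open>
  Algebras over a field \<open>'k\<close> are represented by the \<open>module\<close> record of HOL-Algebra (a ring
  together with a scalar multiplication). The locale \<open>algebra\<close> of HOL-Algebra is not used, since
  it is restricted to commutative algebras.
\<close>

text \<open>
  For fixed $g$, functions in the linear span take nonzero values on both factors of only
  finitely many decompositions $g = g_1g_2$; the summation is over these.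
\<close>

definition steinberg_mult ::
    "('o, 'g, 'm) groupoid_scheme \<Rightarrow> ('g \<Rightarrow> 'k::field) \<Rightarrow> ('g \<Rightarrow> 'k) \<Rightarrow> 'g \<Rightarrow> 'k" where
  "steinberg_mult H f1 f2 g =
    (\<Sum>(g1, g2) | g1 \<in> arrows H \<and> g2 \<in> arrows H \<and> src H g1 = tgt H g2 \<and> gmult H g1 g2 = g \<and>
        f1 g1 \<noteq> 0 \<and> f2 g2 \<noteq> 0. f1 g1 * f2 g2)"

text \<open>The algebra is unital when the unit space is compact, as it is for Markov chains.\<close>

definition steinberg_algebra ::
    "('o, 'g, 'm) groupoid_scheme \<Rightarrow> ('k::field, 'g \<Rightarrow> 'k) module" where
  "steinberg_algebra H = \<lparr>
     carrier = {f. \<exists>\<F> c. finite \<F> \<and> \<F> \<subseteq> {U. compact_open_bisection H U} \<and>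
                  f = (\<lambda>g. \<Sum>U\<in>\<F>. c U * indicator U g)},
     mult = steinberg_mult H,
     one = indicator (unt H ` objects H),
     zero = (\<lambda>_. 0),
     add = (\<lambda>f1 f2 g. f1 g + f2 g),
     smult = (\<lambda>c f g. c * f g)\<rparr>"

section \<open>Algebras given by presentations\<close>

datatype 'a free_monoid = Word (letters: "'a list")

instantiation free_monoid :: (type) monoid_add
begin

definition zero_free_monoid :: "'a free_monoid" where
  "0 = Word []"

definition plus_free_monoid :: "'a free_monoid \<Rightarrow> 'a free_monoid \<Rightarrow> 'a free_monoid" where
  "u + v = Word (letters u @ letters v)"

instance
  by standard (simp_all add: zero_free_monoid_def plus_free_monoid_def)

end

text \<open>
  With concatenation as the addition of \<open>'a free_monoid\<close>, the multiplication of
  \<open>'a free_monoid \<Rightarrow>\<^sub>0 'k\<close> is that of noncommutative polynomials.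
\<close>

type_synonym ('a, 'k) ncpoly = "'a free_monoid \<Rightarrow>\<^sub>0 'k"

definition gen :: "'a \<Rightarrow> ('a, 'k::field) ncpoly" where
  "gen a = Poly_Mapping.single (Word [a]) 1"

definition free_algebra :: "'a set \<Rightarrow> ('k::field, ('a, 'k) ncpoly) module" where
  "free_algebra A = \<lparr>
     carrier = {p. \<forall>w\<in>Poly_Mapping.keys p. set (letters w) \<subseteq> A},
     mult = (*), one = 1, zero = 0, add = (+),
     smult = (\<lambda>c p. Poly_Mapping.single 0 c * p)\<rparr>"

text \<open>The two-sided ideal generated by the relators, and the class of a polynomial modulo it.\<close>

definition relation_ideal ::
    "'a set \<Rightarrow> ('a, 'k::field) ncpoly set \<Rightarrow> ('a, 'k) ncpoly set" where
  "relation_ideal A Rel = genideal (free_algebra A) Rel"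

definition presented_class ::
    "'a set \<Rightarrow> ('a, 'k::field) ncpoly set \<Rightarrow> ('a, 'k) ncpoly \<Rightarrow> ('a, 'k) ncpoly set" where
  "presented_class A Rel p = relation_ideal A Rel +>\<^bsub>free_algebra A\<^esub> p"

definition presented_algebra ::
    "'a set \<Rightarrow> ('a, 'k::field) ncpoly set \<Rightarrow> ('k, ('a, 'k) ncpoly set) module" where
  "presented_algebra A Rel =
    ring.extend (free_algebra A Quot relation_ideal A Rel)
      (module.fields (\<lambda>c P. \<Union>p\<in>P. presented_class A Rel (c \<odot>\<^bsub>free_algebra A\<^esub> p)))"

definition algebra_iso ::
    "('k, 'a, 'm) module_scheme \<Rightarrow> ('k, 'b, 'n) module_scheme \<Rightarrow> ('a \<Rightarrow> 'b) set" where
  "algebra_iso A B = {\<Phi>. \<Phi> \<in> ring_iso A B \<and>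
     (\<forall>c. \<forall>a\<in>carrier A. \<Phi> (c \<odot>\<^bsub>A\<^esub> a) = c \<odot>\<^bsub>B\<^esub> \<Phi> a)}"

section \<open>The presentation\<close>

datatype 'x generator = GenS 'x | GenSinv 'x | GenN "(nat \<Rightarrow> 'x) rel"

definition generators :: "(nat \<Rightarrow> 'x) rel set \<Rightarrow> 'x generator set" where
  "generators N = range GenS \<union> range GenSinv \<union> GenN ` N"

abbreviation genS :: "'x \<Rightarrow> ('x generator, 'k::field) ncpoly" where
  "genS x \<equiv> gen (GenS x)"

abbreviation genS' :: "'x \<Rightarrow> ('x generator, 'k::field) ncpoly" where
  "genS' x \<equiv> gen (GenSinv x)"

abbreviation nuc :: "(nat \<Rightarrow> 'x) rel \<Rightarrow> ('x generator, 'k::field) ncpoly" where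
  "nuc F \<equiv> gen (GenN F)"

definition Sw :: "'x list \<Rightarrow> ('x generator, 'k::field) ncpoly" where
  "Sw u = prod_list (map genS u)"

definition Sw' :: "'x list \<Rightarrow> ('x generator, 'k::field) ncpoly" where
  "Sw' u = prod_list (map genS' (rev u))"

text \<open>A relation $l = r$ is represented by the relator $l - r$.\<close>

definition cuntz_krieger_rels :: "'x::finite rel \<Rightarrow> ('x generator, 'k::field) ncpoly set" where
  "cuntz_krieger_rels T =
     {genS' x * genS x - (\<Sum>y | (x, y) \<in> T. genS y * genS' y) | x. True}
   \<union> {(\<Sum>y\<in>UNIV. genS y * genS' y) - 1}
   \<union> {genS' a * genS b | a b. a \<noteq> b}"

definition nucleus_rels ::
    "'x::finite rel \<Rightarrow> (nat \<Rightarrow> 'x) rel set \<Rightarrow> ('x generator, 'k::field) ncpoly set" where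
  "nucleus_rels T N =
    {nuc F - (\<Sum>x\<in>UNIV. \<Sum>y\<in>UNIV. genS y * nuc ((S_homeo T y)\<inverse> O F O S_homeo T x) * genS' x)
     | F. F \<in> N}"

definition product_rels ::
    "'x::finite rel \<Rightarrow> (nat \<Rightarrow> 'x) rel set \<Rightarrow> nat \<Rightarrow> ('x generator, 'k::field) ncpoly set" where
  "product_rels T N n0 =
    {nuc F1 * nuc F2 -
       (\<Sum>v | length v = n0. \<Sum>u | length u = n0.
          Sw u * nuc ((S_word_homeo T u)\<inverse> O F1 O F2 O S_word_homeo T v) * Sw' v)
     | F1 F2. F1 \<in> N \<and> F2 \<in> N}"

text \<open>
  Two conventions are implicit in writing elements of the nucleus as elements of the algebra:
  the empty bisection is $0$, and if the bisection $S_x^{-1}S_x$ (the identity map on the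
  domain of $S_x$) belongs to the nucleus, then it is the same thing as the product
  $S_x^{-1}S_x$; for the full shift the latter says that the unit space is $1$. They do not follow
  from the other relations: these are all satisfied if every element of the nucleus
  is sent to $0$.
\<close>

definition identification_rels ::
    "'x::finite rel \<Rightarrow> (nat \<Rightarrow> 'x) rel set \<Rightarrow> ('x generator, 'k::field) ncpoly set" where
  "identification_rels T N =
     {nuc F | F. F \<in> N \<and> F = {}}
   \<union> {nuc F - genS' x * genS x | F x. F \<in> N \<and> F = (S_homeo T x)\<inverse> O S_homeo T x}"

definition defining_rels ::
    "'x::finite rel \<Rightarrow> (nat \<Rightarrow> 'x) rel set \<Rightarrow> nat \<Rightarrow> ('x generator, 'k::field) ncpoly set" where
  "defining_rels T N n0 =
    cuntz_krieger_rels T \<union> nucleus_rels T N \<union> product_rels T N n0 \<union> identification_rels T N"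

end

(*
  Sending a word in the generators to the indicator function of the germs of the corresponding
  composition of partial homeomorphisms gives a linear map ev on noncommutative polynomials. It is
  multiplicative, as germs of a composition factor uniquely, and kills the relators.

  Surjectivity: each germ of the groupoid O_G is a germ of some composition S_u F S_v^{-1} with F in
  the nucleus. By compactness a compact open bisection is a finite union of restrictions of such
  germ sets to cylinders, and these restrictions are obtained by multiplying with S_v S_v^{-1}.

  Injectivity: modulo the relations each polynomial p is a combination of monomials S_u F S_v^{-1}.
  If q is a long prefix of a sequence w, then the class of S_u F S_v^{-1} S_q depends only on the germ
  of S_u F S_v^{-1} at w: a germ determines the degree |u| - |v|, since otherwise the groupoid G would
  contain germs of words of unboundedly many lengths, all of them absorbed by the finite nucleus,
  which forces an isolated point. The coefficients of the monomials with a common germ add up to the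
  value of ev p at this germ. So if ev p = 0, then p S_q = 0 for a prefix q of each w, and p = 0
  follows by Koenig's lemma and the relation sum_x S_x S_x^{-1} = 1.
*)

theory Submission
  imports Defs "HOL-Library.Omega_Words_Fun"
begin

section \<open>Partial homeomorphisms and their germs\<close>

text \<open>The obstacle is that two monomials with a common germ at \<open>w\<close> need not be
  congruent, while the relations only split or join words. Right multiplication by
  \<open>Sw q\<close>, with \<open>q\<close> longer than all right words, turns a monomial into a
  sum of terms \<open>Sw t * nuc Q'\<close> over all words \<open>t\<close> of one length
  \<open>L\<close>. Such a sum is a function of a partial homeomorphism and of \<open>L\<close>
  alone. The first is shared by monomials with a common germ; the second records the degree, so it
  must be recoverable from the germ. This is where isolated points would do harm. Over a one-letter
  alphabet the space is a single point and \<open>S_x\<close> is the identity map, so the algebra of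
  germs is the field, whereas the relations present the Laurent polynomials in \<open>S_x\<close>. A
  second constraint is that \<open>S_x^-1 S_x\<close> is only a projection.\<close>

lemma homeomorphic_map_open_subsets:
  assumes hom: "homeomorphic_map (subtopology X U) (subtopology Z V) f"
    and U: "openin X U" and V: "openin Z V"
  shows "f ` U = V" "inj_on f U" "openin X W \<Longrightarrow> openin Z (f ` (W \<inter> U))"
    "openin Z W' \<Longrightarrow> openin X {x \<in> U. f x \<in> W'}"
proof -
  have "topspace (subtopology X U) = U" "topspace (subtopology Z V) = V"
    using U V by (auto dest: openin_subset)
  note [simp] = this
  show im: "f ` U = V" and "inj_on f U"
    using homeomorphic_imp_surjective_map[OF hom] homeomorphic_imp_injective_map[OF hom]
    by (simp_all only: \<open>topspace (subtopology X U) = U\<close> \<open>topspace (subtopology Z V) = V\<close>)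
  show "openin Z (f ` (W \<inter> U))" if "openin X W"
  proof -
    have "openin (subtopology X U) (W \<inter> U)"
      using that by (auto simp: openin_subtopology)
    then have "openin (subtopology Z V) (f ` (W \<inter> U))"
      using homeomorphic_imp_open_map[OF hom] by (auto simp: open_map_def)
    then show ?thesis using V openin_trans_full by blast
  qed
  show "openin X {x \<in> U. f x \<in> W'}" if "openin Z W'"
  proof -
    have "openin (subtopology Z V) (W' \<inter> V)"
      using that by (auto simp: openin_subtopology)
    from openin_continuous_map_preimage[OF homeomorphic_imp_continuous_map[OF hom] this]
    have "openin (subtopology X U) {x \<in> U. f x \<in> W' \<inter> V}"
      by (simp only: \<open>topspace (subtopology X U) = U\<close>)
    moreover have "{x \<in> U. f x \<in> W' \<inter> V} = {x \<in> U. f x \<in> W'}" using im by auto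
    ultimately show ?thesis using U openin_trans_full by metis
  qed
qed

text \<open>Source and target maps are open and continuous on all arrows, so injectivity on an open
  set is the only condition left for a bisection. Both for etale groupoids and for germs the
  criterion is needed in this form.\<close>

lemma homeomorphic_map_if_open_inj:
  assumes U: "openin X U" and inj: "inj_on f U"
    and op: "\<And>W. openin X W \<Longrightarrow> openin Z (f ` (W \<inter> U))"
    and cont: "\<And>W. openin Z W \<Longrightarrow> openin X {x \<in> U. f x \<in> W}"
  shows "homeomorphic_map (subtopology X U) (subtopology Z (f ` U)) f"
proof (rule bijective_open_imp_homeomorphic_map)
  have sub: "U \<subseteq> topspace X" using U openin_subset by blast
  have "openin Z (f ` (U \<inter> U))" using op U by blast
  then have fU: "openin Z (f ` U)" by simp
  then have sub': "f ` U \<subseteq> topspace Z" using openin_subset by blast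
  show "continuous_map (subtopology X U) (subtopology Z (f ` U)) f"
    unfolding continuous_map_def
  proof (intro conjI allI impI)
    fix W assume "openin (subtopology Z (f ` U)) W"
    then have "openin Z W" using fU openin_trans_full by blast
    then have "openin X {x \<in> U. f x \<in> W}" by (rule cont)
    moreover have "topspace (subtopology X U) = U" using sub by auto
    ultimately show "openin (subtopology X U) {x \<in> topspace (subtopology X U). f x \<in> W}"
      by (simp add: openin_open_subtopology[OF U] Collect_conj_eq)
  qed (use sub sub' in auto)
  show "open_map (subtopology X U) (subtopology Z (f ` U)) f"
    unfolding open_map_def
  proof (intro allI impI)
    fix W assume "openin (subtopology X U) W"
    then have "openin X W" "W \<subseteq> U" using U openin_trans_full openin_subset[of _ W] by force+
    then show "openin (subtopology Z (f ` U)) (f ` W)"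
      using op[of W] by (auto simp: openin_open_subtopology[OF fU] Int_absorb2)
  qed
  show "f ` topspace (subtopology X U) = topspace (subtopology Z (f ` U))"
    using sub sub' by auto
  show "inj_on f (topspace (subtopology X U))"
    using inj sub by (auto simp: inj_on_def)
qed

text \<open>With values first, the relational image of \<open>V\<close> under \<open>R\<close> is
  its preimage under the map, and the one under \<open>R\<inverse>\<close> is its image. This
  eliminates the function and the subtopologies, and closure under inversion, composition and
  restriction becomes relation calculus.\<close>

lemma partial_homeo_iff:
  "partial_homeo Y R \<longleftrightarrow> R \<subseteq> topspace Y \<times> topspace Y \<and> single_valued R \<and> single_valued (R\<inverse>) \<and>
     (\<forall>V. openin Y V \<longrightarrow> openin Y (R `` V) \<and> openin Y (R\<inverse> `` V))" (is "?L \<longleftrightarrow> ?R")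
proof
  assume ?L
  then obtain U V f where U: "openin Y U" and V: "openin Y V"
    and hom: "homeomorphic_map (subtopology Y U) (subtopology Y V) f" and R: "R = (\<lambda>x. (f x, x)) ` U"
    unfolding partial_homeo_def by blast
  note h = homeomorphic_map_open_subsets[OF hom U V]
  have "R `` W = {x \<in> U. f x \<in> W}" "R\<inverse> `` W = f ` (W \<inter> U)" for W
    unfolding R by auto
  moreover have "U \<subseteq> topspace Y" "V \<subseteq> topspace Y" using U V openin_subset by blast+
  ultimately show ?R using h unfolding R by (auto simp: single_valued_def inj_on_def)
next
  assume R: ?R
  define f where "f x = (THE y. (y, x) \<in> R)" for x
  have f: "f x = y" if "(y, x) \<in> R" for x y
    unfolding f_def using that R by (intro the_equality) (auto simp: single_valued_def)
  have U: "openin Y (Range R)" and V: "openin Y (Domain R)"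
  proof -
    have "Range R = R `` topspace Y" "Domain R = R\<inverse> `` topspace Y" using R by auto
    then show "openin Y (Range R)" "openin Y (Domain R)" using R by auto
  qed
  have Rf: "R = (\<lambda>x. (f x, x)) ` Range R" using f by force
  have im: "f ` Range R = Domain R" using f by force
  have "homeomorphic_map (subtopology Y (Range R)) (subtopology Y (f ` Range R)) f"
  proof (rule homeomorphic_map_if_open_inj[OF U])
    show "inj_on f (Range R)"
      using R f unfolding inj_on_def single_valued_def by (metis Range_iff)
    fix W assume W: "openin Y W"
    have "f ` (W \<inter> Range R) = R\<inverse> `` W" "{x \<in> Range R. f x \<in> W} = R `` W"
      using f by force+
    then show "openin Y (f ` (W \<inter> Range R))" "openin Y {x \<in> Range R. f x \<in> W}"
      using R W by auto
  qed
  with U V Rf im show ?L unfolding partial_homeo_def by metis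
qed

lemma partial_homeo_subset: "partial_homeo Y R \<Longrightarrow> R \<subseteq> topspace Y \<times> topspace Y"
  by (simp add: partial_homeo_iff)

lemma partial_homeo_value_unique:
  "\<lbrakk>partial_homeo Y R; (y, x) \<in> R; (y', x) \<in> R\<rbrakk> \<Longrightarrow> y = y'"
  by (auto simp: partial_homeo_iff single_valued_def)

lemma partial_homeo_inj:
  "\<lbrakk>partial_homeo Y R; (y, x) \<in> R; (y, x') \<in> R\<rbrakk> \<Longrightarrow> x = x'"
  by (auto simp: partial_homeo_iff single_valued_def)

lemma partial_homeo_open_Image:
  "\<lbrakk>partial_homeo Y R; openin Y V\<rbrakk> \<Longrightarrow> openin Y (R `` V)"
  "\<lbrakk>partial_homeo Y R; openin Y V\<rbrakk> \<Longrightarrow> openin Y (R\<inverse> `` V)"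
  by (auto simp: partial_homeo_iff)

lemma partial_homeo_open_Range: 
  assumes "partial_homeo Y R" shows "openin Y (Range R)" "openin Y (Domain R)"
proof -
  have "Range R = R `` topspace Y" "Domain R = R\<inverse> `` topspace Y"
    using partial_homeo_subset[OF assms] by auto
  then show "openin Y (Range R)" "openin Y (Domain R)"
    using partial_homeo_open_Image[OF assms] by auto
qed

lemma partial_homeo_converse: "partial_homeo Y R \<Longrightarrow> partial_homeo Y (R\<inverse>)"
  by (auto simp: partial_homeo_iff)

lemma partial_homeo_relcomp:
  assumes "partial_homeo Y R" "partial_homeo Y R'"
  shows "partial_homeo Y (R O R')"
proof -
  have "(R O R') `` V = R' `` (R `` V)" "(R O R')\<inverse> `` V = R\<inverse> `` (R'\<inverse> `` V)" for V
    by auto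
  then have "openin Y ((R O R') `` V) \<and> openin Y ((R O R')\<inverse> `` V)" if "openin Y V" for V
    using that assms partial_homeo_open_Image by metis
  moreover have "R O R' \<subseteq> topspace Y \<times> topspace Y"
    using partial_homeo_subset[OF assms(1)] partial_homeo_subset[OF assms(2)] by blast
  moreover have "single_valued (R O R')" "single_valued ((R O R')\<inverse>)"
    using assms single_valued_relcomp[of R R'] single_valued_relcomp[of "R'\<inverse>" "R\<inverse>"]
    by (auto simp: partial_homeo_iff converse_relcomp)
  ultimately show ?thesis unfolding partial_homeo_iff by blast
qed

lemma partial_homeo_Id_on:
  assumes "openin Y U" shows "partial_homeo Y (Id_on U)"
proof -
  have "Id_on U `` V = U \<inter> V" "(Id_on U)\<inverse> `` V = U \<inter> V" for V by auto
  then show ?thesis using assms openin_subset[OF assms]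
    by (auto simp: partial_homeo_iff single_valued_def)
qed

lemma partial_homeo_empty: "partial_homeo Y {}"
  using partial_homeo_Id_on[of Y "{}"] by simp

section \<open>Agreement of relations near a point, and germs as agreement classes\<close>

definition agree :: "'o topology \<Rightarrow> 'o \<Rightarrow> 'o rel \<Rightarrow> 'o rel \<Rightarrow> bool" where
  "agree Y x R R' \<longleftrightarrow> (\<exists>U. openin Y U \<and> x \<in> U \<and> (\<forall>z\<in>U. \<forall>y. (y, z) \<in> R \<longleftrightarrow> (y, z) \<in> R'))"

text \<open>Connects the relational equation in the definition of \<open>germ\<close> with the
  pointwise form used by \<open>agree\<close>.\<close>

lemma restrict_eq_iff:
  fixes R R' :: "('b \<times> 'a) set"
  shows "R O Id_on U = R' O Id_on U \<longleftrightarrow> (\<forall>z\<in>U. \<forall>y. (y, z) \<in> R \<longleftrightarrow> (y, z) \<in> R')"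
proof -
  have *: "(y, z) \<in> S O Id_on U \<longleftrightarrow> (y, z) \<in> S \<and> z \<in> U" for y z and S :: "('b \<times> 'a) set" by auto
  show ?thesis unfolding set_eq_iff split_paired_All * by blast
qed

lemma agree_refl: "x \<in> topspace Y \<Longrightarrow> agree Y x R R"
  unfolding agree_def by blast

lemma agree_sym: "agree Y x R R' \<Longrightarrow> agree Y x R' R"
  unfolding agree_def by metis

lemma agree_trans:
  assumes "agree Y x R R'" "agree Y x R' R''" shows "agree Y x R R''"
proof -
  obtain U U' where U: "openin Y U" "x \<in> U" "\<And>z y. z \<in> U \<Longrightarrow> (y, z) \<in> R \<longleftrightarrow> (y, z) \<in> R'"
    and U': "openin Y U'" "x \<in> U'" "\<And>z y. z \<in> U' \<Longrightarrow> (y, z) \<in> R' \<longleftrightarrow> (y, z) \<in> R''"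
    using assms unfolding agree_def by metis
  show ?thesis unfolding agree_def
    by (rule exI[of _ "U \<inter> U'"]) (use U U' in auto)
qed

lemma agreeD: "agree Y x R R' \<Longrightarrow> (y, x) \<in> R \<longleftrightarrow> (y, x) \<in> R'"
  unfolding agree_def by metis

lemma agree_restrict:
  "\<lbrakk>openin Y U; x \<in> U\<rbrakk> \<Longrightarrow> agree Y x (R O Id_on U) R"
  unfolding agree_def by (intro exI[of _ U]) auto

text \<open>On the open set \<open>Range R\<close> the larger relation is single valued and so has
  no further values. Most equalities of germs below are obtained this way, by exhibiting a common
  restriction.\<close>

lemma agree_if_subset:
  assumes R: "partial_homeo Y R" and R': "partial_homeo Y R'" and "R \<subseteq> R'" and x: "x \<in> Range R"
  shows "agree Y x R R'"
  unfolding agree_def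
proof (intro exI[of _ "Range R"] conjI ballI allI)
  fix z y assume "z \<in> Range R"
  then show "(y, z) \<in> R \<longleftrightarrow> (y, z) \<in> R'"
    using \<open>R \<subseteq> R'\<close> partial_homeo_value_unique[OF R'] by (metis Range_iff subsetD)
qed (use partial_homeo_open_Range[OF R] x in auto)

text \<open>The neighbourhood on which \<open>R\<close> and \<open>R'\<close> coincide is pulled
  back along \<open>Q\<close>, which is possible because \<open>Q\<close> is continuous and single
  valued. Nothing is required of the other three relations.\<close>

lemma agree_relcomp:
  assumes Q: "agree Y x Q Q'" and R: "agree Y y R R'" and yx: "(y, x) \<in> Q"
    and pQ: "partial_homeo Y Q"
  shows "agree Y x (R O Q) (R' O Q')"
proof -
  obtain U V where U: "openin Y U" "x \<in> U" "\<And>z y. z \<in> U \<Longrightarrow> (y, z) \<in> Q \<longleftrightarrow> (y, z) \<in> Q'"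
    and V: "openin Y V" "y \<in> V" "\<And>z y. z \<in> V \<Longrightarrow> (y, z) \<in> R \<longleftrightarrow> (y, z) \<in> R'"
    using assms unfolding agree_def by metis
  show ?thesis unfolding agree_def
  proof (intro exI[of _ "U \<inter> Q `` V"] conjI ballI allI)
    show "openin Y (U \<inter> Q `` V)" using U(1) partial_homeo_open_Image(1)[OF pQ V(1)] by blast
    show "x \<in> U \<inter> Q `` V" using U V yx by blast
    fix z b assume z: "z \<in> U \<inter> Q `` V"
    then obtain a where a: "a \<in> V" "(a, z) \<in> Q" by auto
    have "a' = a" if "(a', z) \<in> Q" for a' using partial_homeo_value_unique[OF pQ] a that by blast
    then have "(b, z) \<in> R O Q \<longleftrightarrow> (b, a) \<in> R" "(b, z) \<in> R' O Q' \<longleftrightarrow> (b, a) \<in> R'"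
      using a z U(3) by blast+
    then show "(b, z) \<in> R O Q \<longleftrightarrow> (b, z) \<in> R' O Q'" using V(3)[OF a(1)] by simp
  qed
qed

text \<open>Points near \<open>y\<close> are values of \<open>R\<close> at points near
  \<open>x\<close>, where \<open>R'\<close> takes the same values; injectivity of each relation then
  determines both inverses there.\<close>

lemma agree_converse:
  assumes "agree Y x R R'" "(y, x) \<in> R" and R: "partial_homeo Y R" and R': "partial_homeo Y R'"
  shows "agree Y y (R\<inverse>) (R'\<inverse>)"
proof -
  obtain U where U: "openin Y U" "x \<in> U" "\<And>z y. z \<in> U \<Longrightarrow> (y, z) \<in> R \<longleftrightarrow> (y, z) \<in> R'"
    using assms unfolding agree_def by metis
  show ?thesis unfolding agree_def
  proof (intro exI[of _ "R\<inverse> `` U"] conjI ballI allI)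
    show "openin Y (R\<inverse> `` U)" by (rule partial_homeo_open_Image(2)[OF R U(1)])
    show "y \<in> R\<inverse> `` U" using U assms by blast
    fix z b assume "z \<in> R\<inverse> `` U"
    then obtain a where a: "a \<in> U" "(z, a) \<in> R" by auto
    then have a': "(z, a) \<in> R'" using U(3) by blast
    have "(b, z) \<in> R\<inverse> \<longleftrightarrow> b = a" using partial_homeo_inj[OF R] a by blast
    moreover have "(b, z) \<in> R'\<inverse> \<longleftrightarrow> b = a" using partial_homeo_inj[OF R'] a' by blast
    ultimately show "(b, z) \<in> R\<inverse> \<longleftrightarrow> (b, z) \<in> R'\<inverse>" by simp
  qed
qed

lemma fst_germ [simp]: "fst (germ Y R x) = x"
  by (simp add: germ_def)

text \<open>The conditions on domains ensure that each relation belongs to its own class, so that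
  equal classes yield agreement. The converse only uses that agreement is an equivalence.\<close>

lemma germ_eq_iff:
  assumes R: "partial_homeo Y R" "x \<in> Range R" and R': "partial_homeo Y R'" "x' \<in> Range R'"
  shows "germ Y R x = germ Y R' x' \<longleftrightarrow> x = x' \<and> agree Y x R R'"
proof
  assume *: "germ Y R x = germ Y R' x'"
  then have "x = x'" by (metis fst_germ)
  moreover have "x \<in> topspace Y" using partial_homeo_subset[OF R(1)] R(2) by auto
  then have "R \<in> snd (germ Y R x)"
    using R agree_refl[of x Y R] by (simp add: germ_def agree_def restrict_eq_iff)
  then have "R \<in> snd (germ Y R' x')" using * by simp
  then have "agree Y x' R R'" unfolding germ_def agree_def by (simp add: restrict_eq_iff)
  ultimately show "x = x' \<and> agree Y x R R'" by simp
next
  assume *: "x = x' \<and> agree Y x R R'"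
  then have "(\<exists>U. openin Y U \<and> x \<in> U \<and> S O Id_on U = R O Id_on U) \<longleftrightarrow>
        (\<exists>U. openin Y U \<and> x \<in> U \<and> S O Id_on U = R' O Id_on U)" for S
    using agree_trans agree_sym unfolding restrict_eq_iff agree_def[symmetric] by metis
  then show "germ Y R x = germ Y R' x'" using * unfolding germ_def by auto
qed

text \<open>The operations of \<open>germ_groupoid\<close> are defined through chosen
  representatives. This fact replaces the choice by any relation with the same germ and so makes
  target, product and inverse computable.\<close>

lemma germ_rep_germ:
  assumes R: "partial_homeo Y R" "x \<in> Range R"
  shows "partial_homeo Y (germ_rep (germ Y R x))" "x \<in> Range (germ_rep (germ Y R x))"
    "agree Y x (germ_rep (germ Y R x)) R"
proof -
  have "x \<in> topspace Y" using partial_homeo_subset[OF R(1)] R(2) by auto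
  then have "R \<in> snd (germ Y R x)"
    using R agree_refl[of x Y R] by (simp add: germ_def agree_def restrict_eq_iff)
  then have "germ_rep (germ Y R x) \<in> snd (germ Y R x)"
    unfolding germ_rep_def by (rule someI)
  then show "partial_homeo Y (germ_rep (germ Y R x))" "x \<in> Range (germ_rep (germ Y R x))"
    "agree Y x (germ_rep (germ Y R x)) R"
    by (simp_all add: germ_def agree_def restrict_eq_iff)
qed

lemma germ_groupoid_simps [simp]:
  "Obj (germ_groupoid Y) = Y" "src (germ_groupoid Y) = fst"
  "unt (germ_groupoid Y) = germ Y (Id_on (topspace Y))"
  by (simp_all add: germ_groupoid_def)

lemma tgt_germ:
  assumes R: "partial_homeo Y R" "(y, x) \<in> R"
  shows "tgt (germ_groupoid Y) (germ Y R x) = y"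
proof -
  have "x \<in> Range R" using R by blast
  note r = germ_rep_germ[OF R(1) this]
  have "(y, x) \<in> germ_rep (germ Y R x)" using agreeD[OF r(3)] R by blast
  then show ?thesis using partial_homeo_value_unique[OF r(1)]
    by (auto simp: germ_groupoid_def intro!: the_equality)
qed

lemma gmult_germ:
  assumes R: "partial_homeo Y R" "(z, y) \<in> R" and Q: "partial_homeo Y Q" "(y, x) \<in> Q"
  shows "gmult (germ_groupoid Y) (germ Y R y) (germ Y Q x) = germ Y (R O Q) x"
proof -
  have y: "y \<in> Range R" and x: "x \<in> Range Q" using R Q by blast+
  note r = germ_rep_germ[OF R(1) y] and q = germ_rep_germ[OF Q(1) x]
  have yx: "(y, x) \<in> germ_rep (germ Y Q x)" using agreeD[OF q(3)] Q by blast
  have zy: "(z, y) \<in> germ_rep (germ Y R y)" using agreeD[OF r(3)] R by blast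
  have "agree Y x (germ_rep (germ Y R y) O germ_rep (germ Y Q x)) (R O Q)"
    by (rule agree_relcomp[OF q(3) r(3) yx q(1)])
  then have "germ Y (germ_rep (germ Y R y) O germ_rep (germ Y Q x)) x = germ Y (R O Q) x"
    using yx zy R Q by (subst germ_eq_iff) (auto intro!: partial_homeo_relcomp q r)
  then show ?thesis by (simp add: germ_groupoid_def)
qed

lemma ginv_germ:
  assumes R: "partial_homeo Y R" "(y, x) \<in> R"
  shows "ginv (germ_groupoid Y) (germ Y R x) = germ Y (R\<inverse>) y"
proof -
  have "x \<in> Range R" using R by blast
  note r = germ_rep_germ[OF R(1) this]
  have yx: "(y, x) \<in> germ_rep (germ Y R x)" using agreeD[OF r(3)] R by blast
  have *: "agree Y y ((germ_rep (germ Y R x))\<inverse>) (R\<inverse>)"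
    by (rule agree_converse[OF r(3) yx r(1) R(1)])
  have "(THE z. (z, x) \<in> germ_rep (germ Y R x)) = y"
    using yx partial_homeo_value_unique[OF r(1)] by blast
  moreover have "germ Y ((germ_rep (germ Y R x))\<inverse>) y = germ Y (R\<inverse>) y"
    using yx * R by (subst germ_eq_iff) (auto intro!: partial_homeo_converse r)
  ultimately show ?thesis by (simp add: germ_groupoid_def)
qed

section \<open>Germ groupoids and convolution\<close>

lemma mem_germs_of_iff:
  assumes "partial_homeo Y R" "partial_homeo Y R'" "x \<in> Range R'"
  shows "germ Y R' x \<in> germs_of Y R \<longleftrightarrow> x \<in> Range R \<and> agree Y x R R'"
proof -
  have "germ Y R' x = germ Y R x' \<longleftrightarrow> x = x' \<and> agree Y x R' R" if "x' \<in> Range R" for x'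
    using assms that by (simp add: germ_eq_iff)
  then show ?thesis unfolding germs_of_def image_iff using agree_sym by metis
qed

lemma germs_ofI: "(y, x) \<in> R \<Longrightarrow> germ Y R x \<in> germs_of Y R"
  unfolding germs_of_def by blast

lemma germs_ofE:
  assumes "\<gamma> \<in> germs_of Y R" obtains x y where "\<gamma> = germ Y R x" "(y, x) \<in> R"
  using assms unfolding germs_of_def by blast

lemma fst_germs_of: "fst ` germs_of Y R = Range R"
  unfolding germs_of_def by force

lemma germs_of_empty [simp]: "germs_of Y {} = {}"
  by (simp add: germs_of_def)

lemma germs_of_mono:
  assumes "partial_homeo Y R" "partial_homeo Y R'" "R \<subseteq> R'"
  shows "germs_of Y R \<subseteq> germs_of Y R'"
proof
  fix \<gamma> assume "\<gamma> \<in> germs_of Y R"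
  then obtain x where x: "\<gamma> = germ Y R x" "x \<in> Range R" unfolding germs_of_def by blast
  have "agree Y x R' R" using agree_if_subset[OF assms x(2)] by (rule agree_sym)
  then show "\<gamma> \<in> germs_of Y R'" using x assms by (auto simp: mem_germs_of_iff)
qed

lemma germs_of_restrict:
  assumes R: "partial_homeo Y R" and W: "openin Y W"
  shows "germs_of Y (R O Id_on W) = {\<gamma> \<in> germs_of Y R. fst \<gamma> \<in> W}"
proof -
  have R': "partial_homeo Y (R O Id_on W)"
    using R W by (intro partial_homeo_relcomp partial_homeo_Id_on)
  have "germ Y (R O Id_on W) x = germ Y R x" if "x \<in> Range R" "x \<in> W" for x
    using that agree_restrict[OF W, of x R] R R' by (subst germ_eq_iff) auto
  moreover have "Range (R O Id_on W) = Range R \<inter> W" by auto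
  ultimately show ?thesis unfolding germs_of_def by auto
qed

text \<open>A common germ forces the two relations to coincide near its source. Shrinking that
  neighbourhood into \<open>Range R\<close> keeps the restricted relation defined at every point of
  \<open>W\<close>, which matters when \<open>W\<close> is later replaced by a cylinder.\<close>

lemma germs_of_Int:
  assumes R: "partial_homeo Y R" and R': "partial_homeo Y R'"
    and "\<gamma> \<in> germs_of Y R" "\<gamma> \<in> germs_of Y R'"
  obtains W where "openin Y W" "fst \<gamma> \<in> W" "W \<subseteq> Range R"
    "germs_of Y (R O Id_on W) \<subseteq> germs_of Y R \<inter> germs_of Y R'"
    "R O Id_on W \<subseteq> R'"
proof -
  obtain x where x: "\<gamma> = germ Y R x" "x \<in> Range R"
    using assms(3) unfolding germs_of_def by blast
  then have "agree Y x R' R" using assms mem_germs_of_iff[OF R' R x(2)] by simp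
  then obtain U where U: "openin Y U" "x \<in> U" "\<And>z y. z \<in> U \<Longrightarrow> (y, z) \<in> R' \<longleftrightarrow> (y, z) \<in> R"
    unfolding agree_def by metis
  define W where "W = U \<inter> Range R"
  have W: "openin Y W" using U partial_homeo_open_Range[OF R] unfolding W_def by blast
  have sub: "R O Id_on W \<subseteq> R'" using U(3) unfolding W_def by auto
  have RW: "partial_homeo Y (R O Id_on W)"
    using R W by (intro partial_homeo_relcomp partial_homeo_Id_on)
  have "R O Id_on W \<subseteq> R" by auto
  then have "germs_of Y (R O Id_on W) \<subseteq> germs_of Y R \<inter> germs_of Y R'"
    using germs_of_mono[OF RW R'] germs_of_mono[OF RW R] sub by blast
  then show ?thesis using W x U sub by (intro that[of W]) (auto simp: W_def)
qed

section \<open>The topology of the groupoid of all germs\<close>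

definition all_germs :: "'o topology \<Rightarrow> 'o germ set" where
  "all_germs Y = \<Union>{germs_of Y R | R. partial_homeo Y R}"

lemma arrows_germ_groupoid: "arrows (germ_groupoid Y) = all_germs Y"
  by (simp add: germ_groupoid_def topology_generated_by_topspace all_germs_def)

lemma all_germsE:
  assumes "\<gamma> \<in> all_germs Y"
  obtains R x y where "partial_homeo Y R" "(y, x) \<in> R" "\<gamma> = germ Y R x"
  using assms unfolding all_germs_def germs_of_def by blast

lemma all_germsI: "\<lbrakk>partial_homeo Y R; (y, x) \<in> R\<rbrakk> \<Longrightarrow> germ Y R x \<in> all_germs Y"
  unfolding all_germs_def germs_of_def by blast

lemma openin_germs_of: "partial_homeo Y R \<Longrightarrow> openin (Arr (germ_groupoid Y)) (germs_of Y R)"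
  by (auto simp: germ_groupoid_def intro: topology_generated_by_Basis)

text \<open>The generating sets are a priori only a subbasis. They form a basis because an
  intersection of two of them contains, around each of its germs, the germs of a
  restriction.\<close>

lemma openin_Arr_germ_groupoid:
  "openin (Arr (germ_groupoid Y)) U \<longleftrightarrow>
     (\<forall>\<gamma>\<in>U. \<exists>R. partial_homeo Y R \<and> \<gamma> \<in> germs_of Y R \<and> germs_of Y R \<subseteq> U)" (is "?L \<longleftrightarrow> ?R U")
proof
  assume ?L
  then have "generate_topology_on {germs_of Y R | R. partial_homeo Y R} U"
    by (simp add: germ_groupoid_def openin_topology_generated_by_iff)
  then show "?R U"
  proof induction
    case (Int a b)
    show ?case
    proof
      fix \<gamma> assume "\<gamma> \<in> a \<inter> b"
      then obtain R R' where R: "partial_homeo Y R" "\<gamma> \<in> germs_of Y R" "germs_of Y R \<subseteq> a"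
        and R': "partial_homeo Y R'" "\<gamma> \<in> germs_of Y R'" "germs_of Y R' \<subseteq> b"
        using Int by (meson IntE)
      obtain W where W: "openin Y W" "fst \<gamma> \<in> W" "W \<subseteq> Range R"
        "germs_of Y (R O Id_on W) \<subseteq> germs_of Y R \<inter> germs_of Y R'" "R O Id_on W \<subseteq> R'"
        by (rule germs_of_Int[OF R(1) R'(1) R(2) R'(2)])
      have "\<gamma> \<in> germs_of Y (R O Id_on W)" using R W by (simp add: germs_of_restrict)
      moreover have "partial_homeo Y (R O Id_on W)"
        using R W by (intro partial_homeo_relcomp partial_homeo_Id_on)
      ultimately show "\<exists>R. partial_homeo Y R \<and> \<gamma> \<in> germs_of Y R \<and> germs_of Y R \<subseteq> a \<inter> b"
        using W R R' by blast
    qed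
  next
    case (UN K)
    show ?case
    proof
      fix \<gamma> assume "\<gamma> \<in> \<Union>K"
      then obtain k where k: "k \<in> K" "\<gamma> \<in> k" by blast
      then obtain R where "partial_homeo Y R" "\<gamma> \<in> germs_of Y R" "germs_of Y R \<subseteq> k" using UN(2) by blast
      then show "\<exists>R. partial_homeo Y R \<and> \<gamma> \<in> germs_of Y R \<and> germs_of Y R \<subseteq> \<Union>K" using k by blast
    qed
  qed auto
next
  assume R: "?R U"
  show ?L
  proof (subst openin_subopen, intro ballI)
    fix \<gamma> assume "\<gamma> \<in> U"
    then obtain R where "partial_homeo Y R" "\<gamma> \<in> germs_of Y R" "germs_of Y R \<subseteq> U" using R by blast
    then show "\<exists>T. openin (Arr (germ_groupoid Y)) T \<and> \<gamma> \<in> T \<and> T \<subseteq> U"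
      using openin_germs_of by blast
  qed
qed

lemma tgt_germs_of:
  assumes "partial_homeo Y R" shows "tgt (germ_groupoid Y) ` germs_of Y R = Domain R"
  using tgt_germ[OF assms] unfolding germs_of_def by (auto simp: image_iff)

lemma openin_src_germ_groupoid:
  assumes W: "openin (Arr (germ_groupoid Y)) W"
  shows "openin Y (fst ` W)" "openin Y (tgt (germ_groupoid Y) ` W)"
proof -
  obtain \<R> where \<R>: "\<forall>R\<in>\<R>. partial_homeo Y R" "W = (\<Union>R\<in>\<R>. germs_of Y R)"
  proof
    let ?\<R> = "{R. partial_homeo Y R \<and> germs_of Y R \<subseteq> W}"
    show "W = (\<Union>R\<in>?\<R>. germs_of Y R)" using W unfolding openin_Arr_germ_groupoid by blast
  qed simp
  have "fst ` W = (\<Union>R\<in>\<R>. Range R)" "tgt (germ_groupoid Y) ` W = (\<Union>R\<in>\<R>. Domain R)"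
    using \<R> by (simp_all add: image_UN fst_germs_of tgt_germs_of)
  moreover have "openin Y (\<Union>R\<in>\<R>. Range R)" "openin Y (\<Union>R\<in>\<R>. Domain R)"
    using \<R>(1) partial_homeo_open_Range[of Y] by auto
  ultimately show "openin Y (fst ` W)" "openin Y (tgt (germ_groupoid Y) ` W)" by simp_all
qed

lemma inj_on_germs_of:
  assumes R: "partial_homeo Y R"
  shows "inj_on fst (germs_of Y R)" "inj_on (tgt (germ_groupoid Y)) (germs_of Y R)"
proof -
  show "inj_on fst (germs_of Y R)" unfolding germs_of_def by (rule inj_onI) (metis fst_germ imageE)
  show "inj_on (tgt (germ_groupoid Y)) (germs_of Y R)"
  proof (rule inj_onI)
    fix \<gamma> \<delta> assume *: "\<gamma> \<in> germs_of Y R" "\<delta> \<in> germs_of Y R"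
      "tgt (germ_groupoid Y) \<gamma> = tgt (germ_groupoid Y) \<delta>"
    obtain x y where x: "\<gamma> = germ Y R x" "(y, x) \<in> R" using *(1) by (rule germs_ofE)
    obtain x' y' where x': "\<delta> = germ Y R x'" "(y', x') \<in> R" using *(2) by (rule germs_ofE)
    have "y = y'" using *(3) x x' tgt_germ[OF R x(2)] tgt_germ[OF R x'(2)] by simp
    then have "x = x'" using partial_homeo_inj[OF R x(2)] x' by blast
    then show "\<gamma> = \<delta>" using x x' by simp
  qed
qed

lemma germs_of_open_bisection:
  assumes R: "partial_homeo Y R"
  shows "homeomorphic_map (subtopology (Arr (germ_groupoid Y)) (germs_of Y R))
      (subtopology Y (Range R)) fst"
    "homeomorphic_map (subtopology (Arr (germ_groupoid Y)) (germs_of Y R))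
      (subtopology Y (Domain R)) (tgt (germ_groupoid Y))"
proof -
  have RU: "{\<gamma> \<in> germs_of Y R. fst \<gamma> \<in> W} = germs_of Y (R O Id_on W)" if "openin Y W" for W
    using R that by (simp add: germs_of_restrict)
  \<comment> \<open>A condition on targets is a condition on sources, pulled back through
    \<open>R\<close>; thus the target map is handled by the openness already known for the
    source.\<close>
  have UR: "{\<gamma> \<in> germs_of Y R. tgt (germ_groupoid Y) \<gamma> \<in> W} = {\<gamma> \<in> germs_of Y R. fst \<gamma> \<in> R `` W}" for W
  proof -
    have "tgt (germ_groupoid Y) \<gamma> \<in> W \<longleftrightarrow> fst \<gamma> \<in> R `` W" if \<gamma>: "\<gamma> \<in> germs_of Y R" for \<gamma>
    proof -
      obtain x y where x: "\<gamma> = germ Y R x" "(y, x) \<in> R" using \<gamma> by (rule germs_ofE)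
      have "x \<in> R `` W \<longleftrightarrow> y \<in> W" using x(2) partial_homeo_value_unique[OF R x(2)] by blast
      then show ?thesis using tgt_germ[OF R x(2)] x(1) by simp
    qed
    then show ?thesis by blast
  qed
  have op: "openin (Arr (germ_groupoid Y)) {\<gamma> \<in> germs_of Y R. fst \<gamma> \<in> W}" if "openin Y W" for W
    unfolding RU[OF that] by (intro openin_germs_of partial_homeo_relcomp R partial_homeo_Id_on that)
  show "homeomorphic_map (subtopology (Arr (germ_groupoid Y)) (germs_of Y R))
      (subtopology Y (Range R)) fst"
    unfolding fst_germs_of[of Y R, symmetric]
    by (rule homeomorphic_map_if_open_inj)
      (auto intro: openin_germs_of R inj_on_germs_of openin_src_germ_groupoid op)
  have "openin (Arr (germ_groupoid Y)) {\<gamma> \<in> germs_of Y R. tgt (germ_groupoid Y) \<gamma> \<in> W}"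
    if "openin Y W" for W
    unfolding UR by (rule op) (rule partial_homeo_open_Image(1)[OF R that])
  then show "homeomorphic_map (subtopology (Arr (germ_groupoid Y)) (germs_of Y R))
      (subtopology Y (Domain R)) (tgt (germ_groupoid Y))"
    unfolding tgt_germs_of[OF R, symmetric]
    by (intro homeomorphic_map_if_open_inj)
      (auto intro: openin_germs_of R inj_on_germs_of openin_src_germ_groupoid)
qed

lemma compactin_germs_of:
  assumes R: "partial_homeo Y R" and c: "compactin Y (Range R)"
  shows "compactin (Arr (germ_groupoid Y)) (germs_of Y R)"
proof -
  have "germs_of Y R \<subseteq> arrows (germ_groupoid Y)" using openin_germs_of[OF R] openin_subset by blast
  then have *: "compactin (Arr (germ_groupoid Y)) (germs_of Y R) \<longleftrightarrow>
     compact_space (subtopology (Arr (germ_groupoid Y)) (germs_of Y R))"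
    by (simp add: compactin_subspace)
  have "compact_space (subtopology Y (Range R))" using c by (simp add: compactin_subspace)
  then show ?thesis unfolding *
    using germs_of_open_bisection(1)[OF R] homeomorphic_compact_space homeomorphic_map_imp_homeomorphic_space
    by blast
qed

section \<open>Subgroupoids of germs and convolution of indicator functions\<close>

definition germ_subgroupoid :: "'o topology \<Rightarrow> 'o germ set \<Rightarrow> ('o, 'o germ) groupoid" where
  "germ_subgroupoid Y K =
    (germ_groupoid Y)\<lparr>Arr := subtopology (Arr (germ_groupoid Y)) K\<rparr>"

lemma germ_subgroupoid_simps [simp]:
  "Arr (germ_subgroupoid Y K) = subtopology (Arr (germ_groupoid Y)) K"
  "Obj (germ_subgroupoid Y K) = Y" "src (germ_subgroupoid Y K) = fst"
  "tgt (germ_subgroupoid Y K) = tgt (germ_groupoid Y)"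
  "unt (germ_subgroupoid Y K) = germ Y (Id_on (topspace Y))"
  "gmult (germ_subgroupoid Y K) = gmult (germ_groupoid Y)"
  by (simp_all add: germ_subgroupoid_def)

lemma compact_open_bisection_germs_of:
  assumes R: "partial_homeo Y R" and c: "compactin Y (Range R)" and K: "germs_of Y R \<subseteq> K"
  shows "compact_open_bisection (germ_subgroupoid Y K) (germs_of Y R)"
proof -
  have "germs_of Y R \<subseteq> arrows (germ_groupoid Y)" using openin_germs_of[OF R] openin_subset by blast
  moreover have "subtopology (subtopology (Arr (germ_groupoid Y)) K) (germs_of Y R) =
      subtopology (Arr (germ_groupoid Y)) (germs_of Y R)"
    using K by (simp add: subtopology_subtopology Int_absorb1)
  moreover have "openin (subtopology (Arr (germ_groupoid Y)) K) (germs_of Y R)"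
    using openin_germs_of[OF R] K by (auto simp: openin_subtopology)
  ultimately show ?thesis
    using germs_of_open_bisection[OF R] compactin_germs_of[OF R c] K
    by (simp add: compact_open_bisection_def open_bisection_def bisection_def
        fst_germs_of tgt_germs_of[OF R] compactin_subtopology)
qed

text \<open>A piece \<open>Q j\<close> having a germ in common with \<open>R\<close> at
  \<open>x\<close> is defined at \<open>x\<close>, and being contained in \<open>R\<close> it takes
  the same value there. Hence a partition of the graph is a partition of the germs. The sums in the
  defining relations come from such partitions.\<close>

lemma indicator_germs_of_partition:
  assumes R: "partial_homeo Y R" and Q: "\<And>j. j \<in> J \<Longrightarrow> partial_homeo Y (Q j)" and "finite J"
    and sub: "\<And>j. j \<in> J \<Longrightarrow> Q j \<subseteq> R"
    and ex: "\<And>y x. (y, x) \<in> R \<Longrightarrow> \<exists>!j. j \<in> J \<and> (y, x) \<in> Q j"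
  shows "(indicator (germs_of Y R) \<gamma> :: 'k::field) = (\<Sum>j\<in>J. indicator (germs_of Y (Q j)) \<gamma>)"
proof (cases "\<gamma> \<in> germs_of Y R")
  case False
  then have "\<gamma> \<notin> germs_of Y (Q j)" if "j \<in> J" for j
    using germs_of_mono[OF Q[OF that] R sub[OF that]] by blast
  then have "(\<Sum>j\<in>J. indicator (germs_of Y (Q j)) \<gamma>) = (0 :: 'k)" by (intro sum.neutral) simp
  then show ?thesis using False by simp
next
  case True
  then obtain x y where x: "\<gamma> = germ Y R x" "(y, x) \<in> R" by (rule germs_ofE)
  obtain i where i: "i \<in> J" "(y, x) \<in> Q i" "\<And>j. j \<in> J \<Longrightarrow> (y, x) \<in> Q j \<Longrightarrow> j = i"
    using ex[OF x(2)] by metis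
  have "germ Y R x \<in> germs_of Y (Q j) \<longleftrightarrow> j = i" if j: "j \<in> J" for j
  proof
    assume "germ Y R x \<in> germs_of Y (Q j)"
    then have "x \<in> Range (Q j)" by (metis fst_germ fst_germs_of imageI)
    then obtain y' where "(y', x) \<in> Q j" by blast
    moreover have "y' = y" using calculation sub[OF j] partial_homeo_value_unique[OF R x(2)] by blast
    ultimately show "j = i" using i j by blast
  next
    assume "j = i"
    moreover have "germ Y R x \<in> germs_of Y (Q i)"
      using i x mem_germs_of_iff[OF Q[OF i(1)] R, of x] agree_if_subset[OF Q[OF i(1)] R sub[OF i(1)], of x]
      by blast
    ultimately show "germ Y R x \<in> germs_of Y (Q j)" by simp
  qed
  then have "(\<Sum>j\<in>J. indicator (germs_of Y (Q j)) \<gamma> :: 'k) = (\<Sum>j\<in>J. if j = i then 1 else 0)"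
    using x by (intro sum.cong) (auto simp: indicator_def)
  then show ?thesis using True i(1) \<open>finite J\<close> by simp
qed

text \<open>The inclusion in \<open>all_germs Y\<close> makes \<open>K\<close> itself the set of
  arrows of \<open>germ_subgroupoid Y K\<close>.\<close>

definition closed_under_gmult :: "'o topology \<Rightarrow> 'o germ set \<Rightarrow> bool" where
  "closed_under_gmult Y K \<longleftrightarrow> K \<subseteq> all_germs Y \<and> (\<forall>\<gamma>\<in>K. \<forall>\<delta>\<in>K. fst \<gamma> = tgt (germ_groupoid Y) \<delta>
      \<longrightarrow> gmult (germ_groupoid Y) \<gamma> \<delta> \<in> K)"

lemma germs_of_relcomp_subset:
  assumes K: "closed_under_gmult Y K"
    and R: "partial_homeo Y R" "germs_of Y R \<subseteq> K" and Q: "partial_homeo Y Q" "germs_of Y Q \<subseteq> K"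
  shows "germs_of Y (R O Q) \<subseteq> K"
proof
  fix \<gamma> assume "\<gamma> \<in> germs_of Y (R O Q)"
  then obtain x z where "\<gamma> = germ Y (R O Q) x" "(z, x) \<in> R O Q" by (rule germs_ofE)
  then obtain y where y: "(z, y) \<in> R" "(y, x) \<in> Q" "\<gamma> = germ Y (R O Q) x" by blast
  then have "\<gamma> = gmult (germ_groupoid Y) (germ Y R y) (germ Y Q x)"
    using gmult_germ[OF R(1) y(1) Q(1) y(2)] by simp
  moreover have "germ Y R y \<in> K" "germ Y Q x \<in> K"
    using subsetD[OF R(2) germs_ofI[OF y(1)]] subsetD[OF Q(2) germs_ofI[OF y(2)]] by auto
  moreover have "tgt (germ_groupoid Y) (germ Y Q x) = y" using tgt_germ[OF Q(1) y(2)] .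
  ultimately show "\<gamma> \<in> K" using K unfolding closed_under_gmult_def by simp
qed

text \<open>The right factor has the source of \<gamma>, so it is the germ of \<open>Q\<close>
  there, and the left factor is the germ of \<open>R\<close> at the value of \<open>Q\<close>. Thus
  there is at most one factorization, and convolution of indicators carries no
  multiplicities.\<close>

lemma factorizations_germs_of:
  assumes K: "closed_under_gmult Y K"
    and R: "partial_homeo Y R" "germs_of Y R \<subseteq> K" and Q: "partial_homeo Y Q" "germs_of Y Q \<subseteq> K"
  shows "\<exists>p. {(\<alpha>, \<beta>). \<alpha> \<in> germs_of Y R \<and> \<beta> \<in> germs_of Y Q \<and> fst \<alpha> = tgt (germ_groupoid Y) \<beta> \<and>
      gmult (germ_groupoid Y) \<alpha> \<beta> = \<gamma>} = (if \<gamma> \<in> germs_of Y (R O Q) then {p} else {})"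
    (is "\<exists>p. ?D = _")
proof -
  have D: "\<exists>z y. (z, y) \<in> R \<and> (y, fst \<gamma>) \<in> Q \<and> \<alpha> = germ Y R y \<and> \<beta> = germ Y Q (fst \<gamma>) \<and>
      \<gamma> = germ Y (R O Q) (fst \<gamma>)" if "(\<alpha>, \<beta>) \<in> ?D" for \<alpha> \<beta>
  proof -
    have *: "\<alpha> \<in> germs_of Y R" "\<beta> \<in> germs_of Y Q" "fst \<alpha> = tgt (germ_groupoid Y) \<beta>"
      "gmult (germ_groupoid Y) \<alpha> \<beta> = \<gamma>" using that by auto
    obtain y z where y: "\<alpha> = germ Y R y" "(z, y) \<in> R" using *(1) by (rule germs_ofE)
    obtain x y' where x: "\<beta> = germ Y Q x" "(y', x) \<in> Q" using *(2) by (rule germs_ofE)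
    have "y' = y" using * x y tgt_germ[OF Q(1) x(2)] by simp
    then have "\<gamma> = germ Y (R O Q) x" using * x y gmult_germ[OF R(1) y(2) Q(1), of x] by simp
    moreover have "fst \<gamma> = x" using calculation by simp
    moreover have "(y, x) \<in> Q" using x \<open>y' = y\<close> by simp
    ultimately show ?thesis using x(1) y by (intro exI[of _ z] exI[of _ y]) simp
  qed
  show ?thesis
  proof (cases "\<gamma> \<in> germs_of Y (R O Q)")
    case False
    have "(\<alpha>, \<beta>) \<notin> ?D" for \<alpha> \<beta>
    proof
      assume "(\<alpha>, \<beta>) \<in> ?D"
      from D[OF this] obtain z y where *: "(z, y) \<in> R" "(y, fst \<gamma>) \<in> Q"
        "\<gamma> = germ Y (R O Q) (fst \<gamma>)" by (elim exE conjE) (rule that)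
      show False using False germs_ofI[OF relcompI[OF *(1,2)], of Y] *(3) by simp
    qed
    then have "?D = {}" by (simp add: set_eq_iff split_paired_All)
    then show ?thesis using False by simp
  next
    case True
    then obtain x z where x: "\<gamma> = germ Y (R O Q) x" "(z, x) \<in> R O Q" by (rule germs_ofE)
    then obtain y where y: "(z, y) \<in> R" "(y, x) \<in> Q" by blast
    have "?D = {(germ Y R y, germ Y Q x)}"
    proof (intro equalityI subsetI)
      fix p assume p: "p \<in> ?D"
      obtain \<alpha> \<beta> where [simp]: "p = (\<alpha>, \<beta>)" by (cases p)
      from D[OF p[unfolded \<open>p = (\<alpha>, \<beta>)\<close>]]
      obtain z' y' where *: "(z', y') \<in> R" "(y', fst \<gamma>) \<in> Q" "\<alpha> = germ Y R y'" "\<beta> = germ Y Q (fst \<gamma>)"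
        by (elim exE conjE) (rule that)
      then have "y' = y" using y(2) x(1) partial_homeo_value_unique[OF Q(1)] by (metis fst_germ)
      then show "p \<in> {(germ Y R y, germ Y Q x)}" using * x by simp
    next
      fix p assume "p \<in> {(germ Y R y, germ Y Q x)}"
      then show "p \<in> ?D"
        using y x gmult_germ[OF R(1) y(1) Q(1) y(2)] tgt_germ[OF Q(1) y(2)]
        by (auto intro: germs_ofI)
    qed
    then show ?thesis using True by auto
  qed
qed

lemma steinberg_mult_sum_indicators:
  fixes a b :: "'i \<Rightarrow> 'k::field"
  assumes K: "closed_under_gmult Y K" and fin: "finite I" "finite J"
    and R: "\<And>i. i \<in> I \<Longrightarrow> partial_homeo Y (R i) \<and> germs_of Y (R i) \<subseteq> K"
    and Q: "\<And>j. j \<in> J \<Longrightarrow> partial_homeo Y (Q j) \<and> germs_of Y (Q j) \<subseteq> K"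
  shows "steinberg_mult (germ_subgroupoid Y K)
      (\<lambda>\<gamma>. \<Sum>i\<in>I. a i * indicator (germs_of Y (R i)) \<gamma>) (\<lambda>\<gamma>. \<Sum>j\<in>J. b j * indicator (germs_of Y (Q j)) \<gamma>)
    = (\<lambda>\<gamma>. \<Sum>i\<in>I. \<Sum>j\<in>J. a i * b j * indicator (germs_of Y (R i O Q j)) \<gamma>)"
    (is "steinberg_mult _ ?f ?g = ?h")
proof
  fix \<gamma>
  define D' where "D' i j = {(\<alpha>, \<beta>). \<alpha> \<in> germs_of Y (R i) \<and> \<beta> \<in> germs_of Y (Q j) \<and>
      fst \<alpha> = tgt (germ_groupoid Y) \<beta> \<and> gmult (germ_groupoid Y) \<alpha> \<beta> = \<gamma>}" for i j
  have D': "\<exists>p. D' i j = (if \<gamma> \<in> germs_of Y (R i O Q j) then {p} else {})" if "i \<in> I" "j \<in> J" for i j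
    unfolding D'_def using R[OF that(1)] Q[OF that(2)] by (intro factorizations_germs_of[OF K]) auto
  \<comment> \<open>The summation range in \<open>steinberg_mult\<close> depends on where the two
    sums happen not to cancel. It is enlarged to the finite set \<open>S\<close>, which is
    independent of the coefficients and permits the sums to be exchanged.\<close>
  define S where "S = (\<Union>i\<in>I. \<Union>j\<in>J. D' i j)"
  have "finite (D' i j)" if "i \<in> I" "j \<in> J" for i j using D'[OF that] by (auto split: if_splits)
  then have finS: "finite S" unfolding S_def using fin by blast
  have arr: "arrows (germ_subgroupoid Y K) = K"
    using K by (simp add: closed_under_gmult_def arrows_germ_groupoid Int_absorb1)
  have f0: "\<exists>i\<in>I. \<alpha> \<in> germs_of Y (R i)" if "?f \<alpha> \<noteq> 0" for \<alpha>
  proof (rule ccontr)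
    assume "\<not> ?thesis"
    then have "?f \<alpha> = 0" by (intro sum.neutral) simp
    then show False using that by simp
  qed
  have g0: "\<exists>j\<in>J. \<beta> \<in> germs_of Y (Q j)" if "?g \<beta> \<noteq> 0" for \<beta>
  proof (rule ccontr)
    assume "\<not> ?thesis"
    then have "?g \<beta> = 0" by (intro sum.neutral) simp
    then show False using that by simp
  qed
  have "steinberg_mult (germ_subgroupoid Y K) ?f ?g \<gamma> = (\<Sum>(\<alpha>, \<beta>)\<in>S. ?f \<alpha> * ?g \<beta>)"
    unfolding steinberg_mult_def
  proof (rule sum.mono_neutral_left[OF finS])
    show "{(g1, g2). g1 \<in> arrows (germ_subgroupoid Y K) \<and> g2 \<in> arrows (germ_subgroupoid Y K) \<and>
       src (germ_subgroupoid Y K) g1 = tgt (germ_subgroupoid Y K) g2 \<and>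
       gmult (germ_subgroupoid Y K) g1 g2 = \<gamma> \<and> ?f g1 \<noteq> 0 \<and> ?g g2 \<noteq> 0} \<subseteq> S"
    proof (rule subsetI)
      fix p assume p: "p \<in> {(g1, g2). g1 \<in> arrows (germ_subgroupoid Y K) \<and> g2 \<in> arrows (germ_subgroupoid Y K) \<and>
       src (germ_subgroupoid Y K) g1 = tgt (germ_subgroupoid Y K) g2 \<and>
       gmult (germ_subgroupoid Y K) g1 g2 = \<gamma> \<and> ?f g1 \<noteq> 0 \<and> ?g g2 \<noteq> 0}"
      obtain \<alpha> \<beta> where ab: "p = (\<alpha>, \<beta>)" by (cases p)
      obtain i j where "i \<in> I" "\<alpha> \<in> germs_of Y (R i)" "j \<in> J" "\<beta> \<in> germs_of Y (Q j)"
        using f0[of \<alpha>] g0[of \<beta>] p unfolding ab by auto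
      then show "p \<in> S" using p unfolding S_def D'_def ab by auto
    qed
    show "\<forall>p\<in>S - {(g1, g2). g1 \<in> arrows (germ_subgroupoid Y K) \<and> g2 \<in> arrows (germ_subgroupoid Y K) \<and>
       src (germ_subgroupoid Y K) g1 = tgt (germ_subgroupoid Y K) g2 \<and>
       gmult (germ_subgroupoid Y K) g1 g2 = \<gamma> \<and> ?f g1 \<noteq> 0 \<and> ?g g2 \<noteq> 0}. (case p of (\<alpha>, \<beta>) \<Rightarrow> ?f \<alpha> * ?g \<beta>) = 0"
    proof (rule ballI, rule ccontr)
      fix p assume p: "p \<in> S - {(g1, g2). g1 \<in> arrows (germ_subgroupoid Y K) \<and> g2 \<in> arrows (germ_subgroupoid Y K) \<and>
       src (germ_subgroupoid Y K) g1 = tgt (germ_subgroupoid Y K) g2 \<and>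
       gmult (germ_subgroupoid Y K) g1 g2 = \<gamma> \<and> ?f g1 \<noteq> 0 \<and> ?g g2 \<noteq> 0}"
        and n: "(case p of (\<alpha>, \<beta>) \<Rightarrow> ?f \<alpha> * ?g \<beta>) \<noteq> 0"
      obtain \<alpha> \<beta> where ab: "p = (\<alpha>, \<beta>)" by (cases p)
      obtain i j where ij: "i \<in> I" "j \<in> J" "(\<alpha>, \<beta>) \<in> D' i j" using p unfolding S_def ab by auto
      then have "\<alpha> \<in> K" "\<beta> \<in> K" using R[OF ij(1)] Q[OF ij(2)] unfolding D'_def by auto
      then show False using p n ij(3) unfolding ab arr D'_def by simp
    qed
  qed
  also have "\<dots> = (\<Sum>p\<in>S. \<Sum>i\<in>I. \<Sum>j\<in>J. a i * b j * (indicator (D' i j) p))"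
  proof (rule sum.cong[OF refl])
    fix p assume "p \<in> S"
    then obtain \<alpha> \<beta> where p: "p = (\<alpha>, \<beta>)" "fst \<alpha> = tgt (germ_groupoid Y) \<beta>"
      "gmult (germ_groupoid Y) \<alpha> \<beta> = \<gamma>" unfolding S_def D'_def by auto
    have "?f \<alpha> * ?g \<beta> = (\<Sum>i\<in>I. \<Sum>j\<in>J. a i * indicator (germs_of Y (R i)) \<alpha> * (b j * indicator (germs_of Y (Q j)) \<beta>))"
      by (simp add: sum_product)
    also have "\<dots> = (\<Sum>i\<in>I. \<Sum>j\<in>J. a i * b j * (indicator (D' i j) p))"
      using p by (intro sum.cong refl) (auto simp: D'_def indicator_def)
    finally show "(case p of (\<alpha>, \<beta>) \<Rightarrow> ?f \<alpha> * ?g \<beta>) = (\<Sum>i\<in>I. \<Sum>j\<in>J. a i * b j * (indicator (D' i j) p))"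
      using p by simp
  qed
  also have "\<dots> = (\<Sum>i\<in>I. \<Sum>j\<in>J. a i * b j * (\<Sum>p\<in>S. indicator (D' i j) p))"
    by (simp add: sum.swap[of _ _ S] sum_distrib_left)
  also have "\<dots> = ?h \<gamma>"
  proof (intro sum.cong refl arg_cong2[of _ _ _ _ "(*)"])
    fix i j assume ij: "i \<in> I" "j \<in> J"
    then have sub: "D' i j \<subseteq> S" unfolding S_def by blast
    obtain p where p: "D' i j = (if \<gamma> \<in> germs_of Y (R i O Q j) then {p} else {})" using D'[OF ij] by blast
    have "(\<Sum>p\<in>S. indicator (D' i j) p :: 'k) = of_nat (card (D' i j))"
      using finS sub by (simp add: indicator_def sum.If_cases Int_absorb1)
    then show "(\<Sum>p\<in>S. indicator (D' i j) p :: 'k) = indicator (germs_of Y (R i O Q j)) \<gamma>"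
      using p by (simp add: indicator_def)
  qed
  finally show "steinberg_mult (germ_subgroupoid Y K) ?f ?g \<gamma> = ?h \<gamma>" .
qed

section \<open>Etale groupoids\<close>

lemma local_homeo_imp_open_map:
  assumes "local_homeo X Z f" and W: "openin X W" shows "openin Z (f ` W)"
proof (subst openin_subopen, intro ballI)
  fix y assume "y \<in> f ` W"
  then obtain x where x: "x \<in> W" "y = f x" by blast
  then have "x \<in> topspace X" using openin_subset[OF W] by blast
  then obtain U where U: "openin X U" "x \<in> U" "openin Z (f ` U)"
      "homeomorphic_map (subtopology X U) (subtopology Z (f ` U)) f"
    using assms(1) unfolding local_homeo_def by metis
  have "openin Z (f ` (W \<inter> U))" using homeomorphic_map_open_subsets(3)[OF U(4,1,3) W] .
  then show "\<exists>T. openin Z T \<and> y \<in> T \<and> T \<subseteq> f ` W" using x U(2) by blast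
qed

lemma local_homeo_locally_inj:
  assumes "local_homeo X Z f" and "x \<in> topspace X"
  obtains U where "openin X U" "x \<in> U" "inj_on f U"
proof -
  obtain U where U: "openin X U" "x \<in> U" "openin Z (f ` U)"
      "homeomorphic_map (subtopology X U) (subtopology Z (f ` U)) f"
    using assms unfolding local_homeo_def by metis
  show ?thesis using U(1,2) homeomorphic_map_open_subsets(2)[OF U(4,1,3)] by (rule that)
qed

context etale_groupoid
begin

lemma openin_src_image: "openin (Arr G) W \<Longrightarrow> openin (Obj G) (src G ` W)"
  and openin_tgt_image: "openin (Arr G) W \<Longrightarrow> openin (Obj G) (tgt G ` W)"
  using local_homeo_imp_open_map[OF local_homeo_src] local_homeo_imp_open_map[OF local_homeo_tgt] by auto

lemma openin_preimage:
  assumes "openin (Arr G) U" "openin (Obj G) V"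
  shows "openin (Arr G) {g \<in> U. src G g \<in> V}" "openin (Arr G) {g \<in> U. tgt G g \<in> V}"
proof -
  have "{g \<in> U. src G g \<in> V} = U \<inter> {g \<in> arrows G. src G g \<in> V}"
    "{g \<in> U. tgt G g \<in> V} = U \<inter> {g \<in> arrows G. tgt G g \<in> V}"
    using openin_subset[OF assms(1)] by auto
  then show "openin (Arr G) {g \<in> U. src G g \<in> V}" "openin (Arr G) {g \<in> U. tgt G g \<in> V}"
    using openin_continuous_map_preimage[OF continuous_src assms(2)]
      openin_continuous_map_preimage[OF continuous_tgt assms(2)] assms(1) by auto
qed

text \<open>In an etale groupoid source and target are open and continuous, so injectivity gives the
  homeomorphisms. Subsets and intersections of open bisections become immediate.\<close>

lemma open_bisection_iff:
  "open_bisection G U \<longleftrightarrow> openin (Arr G) U \<and> inj_on (src G) U \<and> inj_on (tgt G) U"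
proof
  assume U: "open_bisection G U"
  then have op: "openin (Arr G) U"
    and s: "homeomorphic_map (subtopology (Arr G) U) (subtopology (Obj G) (src G ` U)) (src G)"
    and t: "homeomorphic_map (subtopology (Arr G) U) (subtopology (Obj G) (tgt G ` U)) (tgt G)"
    unfolding open_bisection_def bisection_def by auto
  show "openin (Arr G) U \<and> inj_on (src G) U \<and> inj_on (tgt G) U"
    using op homeomorphic_map_open_subsets(2)[OF s op openin_src_image[OF op]]
      homeomorphic_map_open_subsets(2)[OF t op openin_tgt_image[OF op]] by simp
next
  assume U: "openin (Arr G) U \<and> inj_on (src G) U \<and> inj_on (tgt G) U"
  then have "homeomorphic_map (subtopology (Arr G) U) (subtopology (Obj G) (src G ` U)) (src G)"
    "homeomorphic_map (subtopology (Arr G) U) (subtopology (Obj G) (tgt G ` U)) (tgt G)"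
    by (auto intro!: homeomorphic_map_if_open_inj openin_src_image openin_tgt_image openin_preimage)
  then show "open_bisection G U"
    using U openin_subset unfolding open_bisection_def bisection_def by blast
qed

lemma open_bisection_subset:
  "\<lbrakk>open_bisection G U; openin (Arr G) V; V \<subseteq> U\<rbrakk> \<Longrightarrow> open_bisection G V"
  unfolding open_bisection_iff using inj_on_subset by blast

lemma open_bisection_ex:
  assumes g: "g \<in> arrows G" obtains U where "open_bisection G U" "g \<in> U"
proof -
  obtain U where U: "openin (Arr G) U" "g \<in> U" "inj_on (src G) U"
    using local_homeo_locally_inj[OF local_homeo_src g] .
  obtain V where V: "openin (Arr G) V" "g \<in> V" "inj_on (tgt G) V"
    using local_homeo_locally_inj[OF local_homeo_tgt g] .
  have "open_bisection G (U \<inter> V)"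
    unfolding open_bisection_iff using U V by (auto intro: inj_on_subset)
  then show ?thesis using U V that[of "U \<inter> V"] by blast
qed

section \<open>The homomorphism from arrows to germs\<close>

lemma partial_homeo_bis_homeo:
  assumes "open_bisection G U" shows "partial_homeo (Obj G) (bis_homeo G U)"
proof -
  have U: "openin (Arr G) U" "inj_on (src G) U" "inj_on (tgt G) U" "U \<subseteq> arrows G"
    using assms openin_subset unfolding open_bisection_iff by auto
  have "bis_homeo G U `` V = src G ` {g \<in> U. tgt G g \<in> V}"
    "(bis_homeo G U)\<inverse> `` V = tgt G ` {g \<in> U. src G g \<in> V}" for V
    unfolding bis_homeo_def by auto
  then show ?thesis unfolding partial_homeo_iff
    using U openin_preimage[OF U(1)] src_closed tgt_closed
    by (auto simp: single_valued_def bis_homeo_def inj_on_def openin_src_image openin_tgt_image)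
qed

lemma bis_homeo_mono: "U \<subseteq> V \<Longrightarrow> bis_homeo G U \<subseteq> bis_homeo G V"
  unfolding bis_homeo_def by blast

lemma bis_homeoI: "g \<in> U \<Longrightarrow> (tgt G g, src G g) \<in> bis_homeo G U"
  unfolding bis_homeo_def by blast

lemma bis_homeoE:
  assumes "(y, x) \<in> bis_homeo G U" obtains g where "g \<in> U" "y = tgt G g" "x = src G g"
  using assms unfolding bis_homeo_def by blast

lemma germ_eq_if_subset:
  assumes "partial_homeo (Obj G) R" "partial_homeo (Obj G) R'" "R \<subseteq> R'" "(y, x) \<in> R"
  shows "germ (Obj G) R x = germ (Obj G) R' x"
proof -
  have "x \<in> Range R" "x \<in> Range R'" using assms(3,4) by auto
  then show ?thesis
    using germ_eq_iff[OF assms(1) _ assms(2)] agree_if_subset[OF assms(1-3)] by blast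
qed

text \<open>Independence of the bisection chosen in \<open>arrow_germ\<close>: the intersection of
  two open bisections through \<open>g\<close> is an open bisection, and its map is a restriction of
  both maps.\<close>

lemma arrow_germ_eq:
  assumes U: "open_bisection G U" "g \<in> U"
  shows "arrow_germ G g = germ (Obj G) (bis_homeo G U) (src G g)"
proof -
  define V where "V = (SOME U. open_bisection G U \<and> g \<in> U)"
  have V: "open_bisection G V \<and> g \<in> V" unfolding V_def
    by (rule someI[of "\<lambda>U. open_bisection G U \<and> g \<in> U" U]) (simp add: U)
  have UV: "open_bisection G (U \<inter> V)"
    using U V open_bisection_subset[of U "U \<inter> V"] by (auto simp: open_bisection_iff)
  have "(tgt G g, src G g) \<in> bis_homeo G (U \<inter> V)" using U V by (simp add: bis_homeoI)
  then have "germ (Obj G) (bis_homeo G (U \<inter> V)) (src G g) = germ (Obj G) (bis_homeo G W) (src G g)"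
    if "W \<in> {U, V}" for W
    using that U V UV by (intro germ_eq_if_subset partial_homeo_bis_homeo bis_homeo_mono) auto
  from this[of U] this[of V] show ?thesis unfolding arrow_germ_def V_def[symmetric] by simp
qed

lemma germs_of_bis_homeo:
  assumes U: "open_bisection G U"
  shows "germs_of (Obj G) (bis_homeo G U) = arrow_germ G ` U"
proof -
  have "Range (bis_homeo G U) = src G ` U" unfolding bis_homeo_def by auto
  then have "germs_of (Obj G) (bis_homeo G U) = (\<lambda>g. germ (Obj G) (bis_homeo G U) (src G g)) ` U"
    unfolding germs_of_def by (simp add: image_image)
  then show ?thesis using arrow_germ_eq[OF U] by simp
qed

lemma arrow_germ_all_germs:
  assumes "g \<in> arrows G" shows "arrow_germ G g \<in> all_germs (Obj G)"
proof -
  obtain U where U: "open_bisection G U" "g \<in> U" using open_bisection_ex[OF assms] .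
  show ?thesis unfolding arrow_germ_eq[OF U]
    by (rule all_germsI[OF partial_homeo_bis_homeo[OF U(1)] bis_homeoI[OF U(2)]])
qed

text \<open>Continuity of the multiplication gives bisections \<open>U\<close> and \<open>V\<close>
  around the factors whose composable products stay in a prescribed bisection \<open>W\<close>
  around the product. The composition of the maps of \<open>U\<close> and \<open>V\<close> is then a
  restriction of the map of \<open>W\<close>.\<close>

lemma gmult_arrow_germ:
  assumes g: "g \<in> arrows G" and h: "h \<in> arrows G" and gh: "src G g = tgt G h"
  shows "gmult (germ_groupoid (Obj G)) (arrow_germ G g) (arrow_germ G h) = arrow_germ G (gmult G g h)"
proof -
  let ?P = "{(g, h). src G g = tgt G h}"
  obtain W where W: "open_bisection G W" "gmult G g h \<in> W"
    using open_bisection_ex[OF gmult_closed[OF assms]] .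
  obtain U0 where U0: "open_bisection G U0" "g \<in> U0" using open_bisection_ex[OF g] .
  obtain V0 where V0: "open_bisection G V0" "h \<in> V0" using open_bisection_ex[OF h] .
  have "openin (Arr G) W" using W open_bisection_iff by blast
  from openin_continuous_map_preimage[OF continuous_gmult this]
  obtain S where S: "openin (prod_topology (Arr G) (Arr G)) S"
    "{p \<in> topspace (subtopology (prod_topology (Arr G) (Arr G)) ?P). (\<lambda>(g, h). gmult G g h) p \<in> W}
      = S \<inter> ?P" unfolding openin_subtopology by blast
  have "(g, h) \<in> S" using S(2) W g h gh by (auto simp: set_eq_iff)
  then obtain U1 V1 where U1: "openin (Arr G) U1" "g \<in> U1" and V1: "openin (Arr G) V1" "h \<in> V1"
    and UV: "U1 \<times> V1 \<subseteq> S"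
    using S(1) unfolding openin_prod_topology_alt by metis
  define U V where "U = U0 \<inter> U1" and "V = V0 \<inter> V1"
  have U: "open_bisection G U" "g \<in> U"
    using U0 U1 open_bisection_subset[OF U0(1), of U] by (auto simp: U_def open_bisection_iff)
  have V: "open_bisection G V" "h \<in> V"
    using V0 V1 open_bisection_subset[OF V0(1), of V] by (auto simp: V_def open_bisection_iff)
  have UA: "U \<subseteq> arrows G" "V \<subseteq> arrows G" using U V openin_subset unfolding open_bisection_iff by blast+
  have sub: "bis_homeo G U O bis_homeo G V \<subseteq> bis_homeo G W"
  proof
    fix p assume "p \<in> bis_homeo G U O bis_homeo G V"
    then obtain z y x where p: "p = (z, x)" "(z, y) \<in> bis_homeo G U" "(y, x) \<in> bis_homeo G V" by blast
    obtain g' where g': "g' \<in> U" "z = tgt G g'" "y = src G g'" using p(2) by (rule bis_homeoE)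
    obtain h' where h': "h' \<in> V" "y = tgt G h'" "x = src G h'" using p(3) by (rule bis_homeoE)
    have "(g', h') \<in> S \<inter> ?P" using UV g' h' by (auto simp: U_def V_def)
    then have "gmult G g' h' \<in> W" unfolding S(2)[symmetric] by simp
    then have "(tgt G (gmult G g' h'), src G (gmult G g' h')) \<in> bis_homeo G W" by (rule bis_homeoI)
    moreover have "tgt G (gmult G g' h') = z" "src G (gmult G g' h') = x"
      using g' h' UA tgt_gmult[of g' h'] src_gmult[of g' h'] by auto
    ultimately show "p \<in> bis_homeo G W" using p by simp
  qed
  have m: "(tgt G g, tgt G h) \<in> bis_homeo G U" "(tgt G h, src G h) \<in> bis_homeo G V"
    using bis_homeoI[OF U(2)] bis_homeoI[OF V(2)] gh by auto
  have "gmult (germ_groupoid (Obj G)) (arrow_germ G g) (arrow_germ G h)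
      = germ (Obj G) (bis_homeo G U O bis_homeo G V) (src G h)"
    unfolding arrow_germ_eq[OF U] arrow_germ_eq[OF V] gh
    by (rule gmult_germ[OF partial_homeo_bis_homeo[OF U(1)] m(1) partial_homeo_bis_homeo[OF V(1)] m(2)])
  also have "\<dots> = germ (Obj G) (bis_homeo G W) (src G h)"
    by (rule germ_eq_if_subset[OF partial_homeo_relcomp partial_homeo_bis_homeo sub relcompI[OF m]])
      (intro partial_homeo_bis_homeo U V W)+
  also have "\<dots> = arrow_germ G (gmult G g h)"
    using arrow_germ_eq[OF W] src_gmult[OF assms] by simp
  finally show ?thesis .
qed

lemma ginv_arrow_germ:
  assumes g: "g \<in> arrows G"
  shows "ginv (germ_groupoid (Obj G)) (arrow_germ G g) = arrow_germ G (ginv G g)"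
proof -
  obtain W where W: "open_bisection G W" "ginv G g \<in> W" using open_bisection_ex[OF ginv_closed[OF g]] .
  obtain U0 where U0: "open_bisection G U0" "g \<in> U0" using open_bisection_ex[OF g] .
  define U where "U = U0 \<inter> {g \<in> arrows G. ginv G g \<in> W}"
  have "openin (Arr G) {g \<in> arrows G. ginv G g \<in> W}"
    using W openin_continuous_map_preimage[OF continuous_ginv] by (simp add: open_bisection_iff)
  then have U: "open_bisection G U" "g \<in> U"
    using U0 W g open_bisection_subset[OF U0(1), of U] by (auto simp: U_def open_bisection_iff)
  have m: "(tgt G g, src G g) \<in> bis_homeo G U" using bis_homeoI[OF U(2)] .
  have sub: "(bis_homeo G U)\<inverse> \<subseteq> bis_homeo G W"
  proof
    fix p assume "p \<in> (bis_homeo G U)\<inverse>"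
    then obtain g' where g': "g' \<in> U" "p = (src G g', tgt G g')" unfolding bis_homeo_def by blast
    then have "ginv G g' \<in> W" "g' \<in> arrows G" unfolding U_def by auto
    then show "p \<in> bis_homeo G W" using bis_homeoI[of "ginv G g'" W] src_ginv tgt_ginv g' by simp
  qed
  have "ginv (germ_groupoid (Obj G)) (arrow_germ G g) = germ (Obj G) ((bis_homeo G U)\<inverse>) (tgt G g)"
    unfolding arrow_germ_eq[OF U] by (rule ginv_germ[OF partial_homeo_bis_homeo[OF U(1)] m])
  also have "\<dots> = germ (Obj G) (bis_homeo G W) (tgt G g)"
    by (rule germ_eq_if_subset[OF partial_homeo_converse partial_homeo_bis_homeo sub])
      (use U W m partial_homeo_bis_homeo in auto)
  also have "\<dots> = arrow_germ G (ginv G g)"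
    using arrow_germ_eq[OF W] src_ginv[OF g] by simp
  finally show ?thesis .
qed

lemma continuous_unt: "continuous_map (Obj G) (Arr G) (unt G)"
  using homeomorphic_imp_continuous_map[OF homeomorphic_unt] by (simp add: continuous_map_in_subtopology)

lemma germ_Id_eq_arrow_germ:
  assumes x: "x \<in> objects G"
  shows "germ (Obj G) (Id_on (objects G)) x = arrow_germ G (unt G x)"
proof -
  obtain U where U: "open_bisection G U" "unt G x \<in> U" using open_bisection_ex[OF unt_closed[OF x]] .
  define V where "V = {y \<in> objects G. unt G y \<in> U}"
  have V: "openin (Obj G) V"
    using U openin_continuous_map_preimage[OF continuous_unt] by (simp add: V_def open_bisection_iff)
  have xV: "(x, x) \<in> Id_on V" using x U by (simp add: V_def Id_on_iff)
  have "Id_on V \<subseteq> bis_homeo G U"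
  proof
    fix p assume "p \<in> Id_on V"
    then obtain y where y: "p = (y, y)" "y \<in> objects G" "unt G y \<in> U" unfolding V_def by auto
    then show "p \<in> bis_homeo G U" using bis_homeoI[of "unt G y" U] src_unt[of y] tgt_unt[of y] by simp
  qed
  then have "germ (Obj G) (Id_on V) x = germ (Obj G) (bis_homeo G U) x"
    by (rule germ_eq_if_subset[OF partial_homeo_Id_on[OF V] partial_homeo_bis_homeo[OF U(1)] _ xV])
  moreover have "germ (Obj G) (Id_on V) x = germ (Obj G) (Id_on (objects G)) x"
    by (rule germ_eq_if_subset[OF partial_homeo_Id_on[OF V] partial_homeo_Id_on[OF openin_topspace] _ xV])
      (auto simp: V_def)
  ultimately show ?thesis using arrow_germ_eq[OF U] src_unt[OF x] by simp
qed

text \<open>Near a unit lying in an open bisection \<open>U\<close>, every arrow of \<open>U\<close>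
  has the same source as some unit of \<open>U\<close>, so injectivity of the source makes it equal
  to that unit. Openness makes the identity map a compact open bisection, which later brings the
  unit of the algebra into the span of the monomials.\<close>

lemma openin_units: "openin (Arr G) (unt G ` objects G)"
proof (subst openin_subopen, intro ballI)
  fix g assume "g \<in> unt G ` objects G"
  then obtain x where x: "x \<in> objects G" "g = unt G x" by blast
  obtain U where U: "open_bisection G U" "unt G x \<in> U" using open_bisection_ex[OF unt_closed[OF x(1)]] .
  define V where "V = {y \<in> objects G. unt G y \<in> U}"
  have V: "openin (Obj G) V"
    using U openin_continuous_map_preimage[OF continuous_unt] by (simp add: V_def open_bisection_iff)
  have "openin (Arr G) {h \<in> U. src G h \<in> V}"
    using U V openin_preimage(1) by (simp add: open_bisection_iff)
  moreover have "{h \<in> U. src G h \<in> V} \<subseteq> unt G ` objects G"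
  proof
    fix h assume h: "h \<in> {h \<in> U. src G h \<in> V}"
    then have *: "src G h \<in> objects G" "unt G (src G h) \<in> U" unfolding V_def by auto
    have "h = unt G (src G h)"
      using U(1) * h src_unt[OF *(1)] unfolding open_bisection_iff inj_on_def by auto
    then show "h \<in> unt G ` objects G" using *(1) by blast
  qed
  moreover have "g \<in> {h \<in> U. src G h \<in> V}" using x U src_unt[OF x(1)] by (simp add: V_def)
  ultimately show "\<exists>T. openin (Arr G) T \<and> g \<in> T \<and> T \<subseteq> unt G ` objects G" by blast
qed

section \<open>Compact open bisections as partial homeomorphisms\<close>

lemma Id_in_cob_homeos:
  assumes "compact_space (Obj G)" shows "Id_on (objects G) \<in> cob_homeos G"
proof -
  have "open_bisection G (unt G ` objects G)"
    unfolding open_bisection_iff using openin_units src_unt tgt_unt by (auto simp: inj_on_def)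
  moreover have "compactin (Arr G) (unt G ` objects G)"
    using assms image_compactin[OF _ continuous_unt] by (simp add: compact_space_def)
  moreover have "bis_homeo G (unt G ` objects G) = Id_on (objects G)"
    using src_unt tgt_unt by (auto simp: bis_homeo_def Id_on_def image_iff)
  ultimately show ?thesis unfolding cob_homeos_def compact_open_bisection_def
    by (intro image_eqI[of _ _ "unt G ` objects G"]) simp_all
qed

lemma empty_in_cob_homeos: "{} \<in> cob_homeos G"
proof -
  have "compact_open_bisection G {}" by (simp add: compact_open_bisection_def open_bisection_iff)
  moreover have "bis_homeo G {} = {}" by (simp add: bis_homeo_def)
  ultimately show ?thesis unfolding cob_homeos_def by (intro image_eqI[of _ _ "{}"]) simp_all
qed

lemma cob_homeos_properties:
  assumes "F \<in> cob_homeos G"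
  shows "partial_homeo (Obj G) F" "compactin (Obj G) (Range F)" "compactin (Obj G) (Domain F)"
    "germs_of (Obj G) F \<subseteq> arrow_germ G ` arrows G"
proof -
  obtain U where U: "compact_open_bisection G U" "F = bis_homeo G U"
    using assms unfolding cob_homeos_def by blast
  then have ob: "open_bisection G U" and c: "compactin (Arr G) U"
    unfolding compact_open_bisection_def by auto
  show "partial_homeo (Obj G) F" unfolding U by (rule partial_homeo_bis_homeo[OF ob])
  have "Range F = src G ` U" "Domain F = tgt G ` U" unfolding U bis_homeo_def by auto
  then show "compactin (Obj G) (Range F)" "compactin (Obj G) (Domain F)"
    using image_compactin[OF c continuous_src] image_compactin[OF c continuous_tgt] by auto
  show "germs_of (Obj G) F \<subseteq> arrow_germ G ` arrows G"
    unfolding U germs_of_bis_homeo[OF ob] using compactin_subset_topspace[OF c] by blast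
qed

text \<open>A compact open neighbourhood of the source is lifted through the homeomorphism from an
  open bisection onto its set of sources; the lifted set is again open, and it is compact.\<close>

lemma cob_homeo_of_arrow:
  assumes zero_dim: "\<And>V x. \<lbrakk>openin (Obj G) V; x \<in> V\<rbrakk> \<Longrightarrow> \<exists>C. openin (Obj G) C \<and> compactin (Obj G) C \<and> x \<in> C \<and> C \<subseteq> V"
    and g: "g \<in> arrows G"
  obtains F where "F \<in> cob_homeos G" "(tgt G g, src G g) \<in> F"
    "arrow_germ G g = germ (Obj G) F (src G g)"
proof -
  obtain U where U: "open_bisection G U" "g \<in> U" using open_bisection_ex[OF g] .
  then have op: "openin (Arr G) U" unfolding open_bisection_iff by blast
  have opS: "openin (Obj G) (src G ` U)" by (rule openin_src_image[OF op])
  obtain C where C: "openin (Obj G) C" "compactin (Obj G) C" "src G g \<in> C" "C \<subseteq> src G ` U"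
    using zero_dim[OF opS imageI[OF U(2)]] by blast
  define V where "V = {h \<in> U. src G h \<in> C}"
  have V: "openin (Arr G) V" "V \<subseteq> U" "g \<in> V"
    using openin_preimage(1)[OF op C(1)] U C by (auto simp: V_def)
  then have obV: "open_bisection G V" using open_bisection_subset[OF U(1)] by blast
  then have hom: "homeomorphic_map (subtopology (Arr G) V) (subtopology (Obj G) (src G ` V)) (src G)"
    unfolding open_bisection_def bisection_def by blast
  have "src G ` V = C" using C by (auto simp: V_def)
  then have "compact_space (subtopology (Obj G) (src G ` V))" using C by (simp add: compactin_subspace)
  then have "compact_space (subtopology (Arr G) V)"
    using homeomorphic_compact_space[OF homeomorphic_map_imp_homeomorphic_space[OF hom]] by blast
  then have "compactin (Arr G) V" using openin_subset[OF V(1)] by (simp add: compactin_subspace)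
  then have "bis_homeo G V \<in> cob_homeos G"
    using obV unfolding cob_homeos_def compact_open_bisection_def by blast
  then show ?thesis using arrow_germ_eq[OF obV V(3)] bis_homeoI[OF V(3)] by (intro that) auto
qed

end

section \<open>Markov chains\<close>

declare build_cons [simp del] build_append [simp del]

abbreviation admissible :: "'x rel \<Rightarrow> 'x list \<Rightarrow> bool" where
  "admissible T \<equiv> successively (\<lambda>a b. (a, b) \<in> T)"

lemma case_nat_eq_conc: "case_nat x w = [x] \<frown> w"
  by (auto simp: fun_eq_iff conc_def split: nat.splits)

lemma markov_seqs_Cons: "[x] \<frown> w \<in> markov_seqs T \<longleftrightarrow> (x, w 0) \<in> T \<and> w \<in> markov_seqs T"
proof -
  have "(\<forall>n. (([x] \<frown> w) n, ([x] \<frown> w) (Suc n)) \<in> T) \<longleftrightarrow>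
      (([x] \<frown> w) 0, ([x] \<frown> w) (Suc 0)) \<in> T \<and> (\<forall>n. (([x] \<frown> w) (Suc n), ([x] \<frown> w) (Suc (Suc n))) \<in> T)"
    using not0_implies_Suc by metis
  then show ?thesis by (simp add: markov_seqs_def conc_def)
qed

lemma markov_seqs_conc:
  "u \<frown> w \<in> markov_seqs T \<longleftrightarrow>
     admissible T u \<and> (u = [] \<or> (last u, w 0) \<in> T) \<and> w \<in> markov_seqs T"
proof (induction u)
  case (Cons x u)
  have "(x # u) \<frown> w = [x] \<frown> (u \<frown> w)" by simp
  then have "(x # u) \<frown> w \<in> markov_seqs T \<longleftrightarrow> (x, (u \<frown> w) 0) \<in> T \<and> u \<frown> w \<in> markov_seqs T"
    using markov_seqs_Cons by metis
  then show ?case using Cons by (cases u) (auto simp: conc_def)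
qed simp

lemma markov_seqs_suffix: "w \<in> markov_seqs T \<Longrightarrow> suffix n w \<in> markov_seqs T"
  by (simp add: markov_seqs_def)

lemma mem_S_homeo: "(z, w) \<in> S_homeo T x \<longleftrightarrow> z = [x] \<frown> w \<and> z \<in> markov_seqs T"
  unfolding S_homeo_def case_nat_eq_conc by (auto simp: markov_seqs_Cons)

lemma mem_S_word_homeo: "(z, w) \<in> S_word_homeo T u \<longleftrightarrow> z = u \<frown> w \<and> z \<in> markov_seqs T"
proof (induction u arbitrary: z)
  case (Cons x u)
  have "(z, w) \<in> S_word_homeo T (x # u) \<longleftrightarrow>
      (\<exists>z'. (z, z') \<in> S_homeo T x \<and> (z', w) \<in> S_word_homeo T u)"
    by (auto simp: S_word_homeo_def)
  also have "\<dots> \<longleftrightarrow> z = [x] \<frown> (u \<frown> w) \<and> z \<in> markov_seqs T"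
    unfolding Cons.IH mem_S_homeo by (auto simp: markov_seqs_Cons simp del: conc_conc)
  finally show ?case by simp
qed (auto simp: S_word_homeo_def)

lemma S_word_homeo_singleton: "S_word_homeo T [x] = S_homeo T x"
  by (auto simp: mem_S_word_homeo mem_S_homeo)

lemma S_word_homeo_append: "S_word_homeo T (u @ v) = S_word_homeo T u O S_word_homeo T v"
proof -
  have "(z, w) \<in> S_word_homeo T (u @ v) \<longleftrightarrow> (z, w) \<in> S_word_homeo T u O S_word_homeo T v" for z w
  proof -
    have "(z, w) \<in> S_word_homeo T u O S_word_homeo T v \<longleftrightarrow>
        (\<exists>z'. (z, z') \<in> S_word_homeo T u \<and> (z', w) \<in> S_word_homeo T v)" by blast
    also have "\<dots> \<longleftrightarrow> z = u \<frown> (v \<frown> w) \<and> z \<in> markov_seqs T"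
      unfolding mem_S_word_homeo using markov_seqs_conc by blast
    finally show ?thesis by (simp add: mem_S_word_homeo)
  qed
  then show ?thesis by auto
qed

lemma S_word_homeo_orthogonal:
  assumes "length u = length v" "u \<noteq> v"
  shows "(S_word_homeo T u)\<inverse> O S_word_homeo T v = {}"
  using assms by (auto simp: mem_S_word_homeo dest: arg_cong[where f = "prefix (length v)"])

lemma S_word_homeo_domain:
  "(S_word_homeo T u)\<inverse> O S_word_homeo T u = Id_on {w. u \<frown> w \<in> markov_seqs T}"
  by (auto simp: mem_S_word_homeo)

text \<open>All transitions up to the last letter of \<open>v\<close> are internal to an admissible
  word, so the sequence appended to \<open>u @ v\<close> meets the same condition as the one
  appended to \<open>v\<close>. For empty \<open>v\<close> the left side would be the identity on
  the domain of \<open>S_u\<close>, possibly a proper subset.\<close>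

lemma S_word_homeo_cancel:
  assumes "admissible T (u @ v)" "v \<noteq> []"
  shows "(S_word_homeo T u)\<inverse> O S_word_homeo T (u @ v) = S_word_homeo T v"
proof -
  have *: "(u @ v) \<frown> w \<in> markov_seqs T \<longleftrightarrow> v \<frown> w \<in> markov_seqs T" for w
    using assms by (simp add: markov_seqs_conc successively_append_iff)
  have "(y, w) \<in> (S_word_homeo T u)\<inverse> O S_word_homeo T (u @ v) \<longleftrightarrow> (y, w) \<in> S_word_homeo T v" for y w
  proof -
    have "(y, w) \<in> (S_word_homeo T u)\<inverse> O S_word_homeo T (u @ v) \<longleftrightarrow>
        (\<exists>z. z = u \<frown> y \<and> z \<in> markov_seqs T \<and> z = (u @ v) \<frown> w)"
      by (auto simp: mem_S_word_homeo)
    also have "\<dots> \<longleftrightarrow> u \<frown> y = u \<frown> (v \<frown> w) \<and> (u @ v) \<frown> w \<in> markov_seqs T" by auto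
    finally show ?thesis using * by (auto simp: mem_S_word_homeo simp del: conc_conc)
  qed
  then show ?thesis by auto
qed

definition cylinder :: "'x rel \<Rightarrow> 'x list \<Rightarrow> (nat \<Rightarrow> 'x) set" where
  "cylinder T v = {w \<in> markov_seqs T. prefix (length v) w = v}"

lemma S_word_homeo_range:
  "S_word_homeo T u O (S_word_homeo T u)\<inverse> = Id_on (cylinder T u)"
proof -
  have "(\<exists>y. z = u \<frown> y \<and> z \<in> markov_seqs T \<and> w = u \<frown> y) \<longleftrightarrow> z = w \<and> z \<in> cylinder T u" for z w
  proof
    assume "z = w \<and> z \<in> cylinder T u"
    then have z: "z = w" "z \<in> markov_seqs T" "prefix (length u) z = u" by (auto simp: cylinder_def)
    then have "z = u \<frown> suffix (length u) z" using prefix_suffix[of z "length u"] by simp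
    then show "\<exists>y. z = u \<frown> y \<and> z \<in> markov_seqs T \<and> w = u \<frown> y" using z(1,2) by metis
  qed (auto simp: cylinder_def)
  then show ?thesis by (auto simp: mem_S_word_homeo relcomp_unfold Id_on_iff)
qed

section \<open>The topology of the Markov chain\<close>

lemma topspace_markov [simp]: "topspace (markov_space T) = markov_seqs T"
  by (simp add: markov_space_def)

lemma openin_markov_iff:
  "openin (markov_space T) V \<longleftrightarrow> V \<subseteq> markov_seqs T \<and>
     (\<forall>w\<in>V. \<exists>m. \<forall>z\<in>markov_seqs T. (\<forall>i<m. z i = w i) \<longrightarrow> z \<in> V)"
proof -
  let ?P = "product_topology (\<lambda>_. discrete_topology UNIV) UNIV :: (nat \<Rightarrow> 'a) topology"
  have P: "openin ?P U \<longleftrightarrow> (\<forall>w\<in>U. \<exists>m. \<forall>z. (\<forall>i<m. z i = w i) \<longrightarrow> z \<in> U)" (is "_ \<longleftrightarrow> ?R") for U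
  proof
    assume U: "openin ?P U"
    show ?R
    proof
      fix w assume "w \<in> U"
      then obtain B where B: "finite {i. B i \<noteq> UNIV}" "w \<in> Pi\<^sub>E UNIV B" "Pi\<^sub>E UNIV B \<subseteq> U"
        using U unfolding openin_product_topology_alt by auto
      obtain m where m: "\<And>i. B i \<noteq> UNIV \<Longrightarrow> i < m"
        using finite_nat_set_iff_bounded B(1) by auto
      have "z \<in> U" if "\<forall>i<m. z i = w i" for z
      proof -
        have "z i \<in> B i" for i using B(2) m[of i] that by (cases "B i = UNIV") (auto simp: PiE_iff)
        then show ?thesis using B(3) by auto
      qed
      then show "\<exists>m. \<forall>z. (\<forall>i<m. z i = w i) \<longrightarrow> z \<in> U" by blast
    qed
  next
    assume R: ?R
    show "openin ?P U"
      unfolding openin_product_topology_alt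
    proof
      fix w assume "w \<in> U"
      then obtain m where m: "\<And>z. (\<forall>i<m. z i = w i) \<Longrightarrow> z \<in> U" using R by metis
      define B where "B i = (if i < m then {w i} else UNIV)" for i
      have "{i. B i \<noteq> UNIV} \<subseteq> {..<m}" by (auto simp: B_def split: if_splits)
      then have fin: "finite {i. B i \<noteq> UNIV}" using finite_subset by blast
      have "z i = w i" if "z \<in> Pi\<^sub>E UNIV B" "i < m" for z i
      proof -
        have "z i \<in> B i" using that(1) by (simp add: PiE_iff)
        then show ?thesis using that(2) by (simp add: B_def)
      qed
      then have "Pi\<^sub>E UNIV B \<subseteq> U" using m by blast
      moreover have "w \<in> Pi\<^sub>E UNIV B" by (simp add: B_def PiE_iff)
      ultimately show "\<exists>B. finite {i \<in> UNIV. B i \<noteq> topspace (discrete_topology UNIV)} \<and>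
          (\<forall>i\<in>UNIV. openin (discrete_topology UNIV) (B i)) \<and> w \<in> Pi\<^sub>E UNIV B \<and> Pi\<^sub>E UNIV B \<subseteq> U"
        using fin by (intro exI[of _ B]) auto
    qed
  qed
  show ?thesis
  proof
    assume "openin (markov_space T) V"
    then obtain U where U: "openin ?P U" "V = U \<inter> markov_seqs T"
      unfolding markov_space_def openin_subtopology by blast
    show "V \<subseteq> markov_seqs T \<and> (\<forall>w\<in>V. \<exists>m. \<forall>z\<in>markov_seqs T. (\<forall>i<m. z i = w i) \<longrightarrow> z \<in> V)"
    proof (intro conjI ballI)
      show "V \<subseteq> markov_seqs T" using U(2) by simp
      fix w assume "w \<in> V"
      then have "w \<in> U" using U(2) by simp
      then obtain m where "\<And>z. \<forall>i<m. z i = w i \<Longrightarrow> z \<in> U" using U(1)[unfolded P] by metis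
      then show "\<exists>m. \<forall>z\<in>markov_seqs T. (\<forall>i<m. z i = w i) \<longrightarrow> z \<in> V" using U(2) by (intro exI[of _ m]) simp
    qed
  next
    assume V: "V \<subseteq> markov_seqs T \<and> (\<forall>w\<in>V. \<exists>m. \<forall>z\<in>markov_seqs T. (\<forall>i<m. z i = w i) \<longrightarrow> z \<in> V)"
    \<comment> \<open>\<open>U\<close> is the union of those cylinders of the full sequence space
      whose allowed sequences lie in \<open>V\<close>; it is the open set of which \<open>V\<close>
      is the trace.\<close>
    define U where "U = {z. \<exists>w\<in>V. \<exists>m. (\<forall>i<m. z i = w i) \<and> (\<forall>z\<in>markov_seqs T. (\<forall>i<m. z i = w i) \<longrightarrow> z \<in> V)}"
    have "openin ?P U" unfolding P
    proof
      fix z assume "z \<in> U"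
      then obtain w m where w: "w \<in> V" "\<forall>i<m. z i = w i"
        "\<forall>z\<in>markov_seqs T. (\<forall>i<m. z i = w i) \<longrightarrow> z \<in> V" unfolding U_def by blast
      have "z' \<in> U" if "\<forall>i<m. z' i = z i" for z'
        unfolding U_def using w that by auto
      then show "\<exists>m. \<forall>z'. (\<forall>i<m. z' i = z i) \<longrightarrow> z' \<in> U" by blast
    qed
    moreover have "V = U \<inter> markov_seqs T"
    proof
      show "V \<subseteq> U \<inter> markov_seqs T" unfolding U_def using V by blast
      show "U \<inter> markov_seqs T \<subseteq> V" unfolding U_def by blast
    qed
    ultimately show "openin (markov_space T) V"
      unfolding markov_space_def openin_subtopology by blast
  qed
qed

text \<open>The inclusion is stated for all sufficiently long prefixes, so that finitely many
  conditions on the prefix length can be met at once.\<close>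

lemma openin_markovE:
  assumes "openin (markov_space T) V" "w \<in> V"
  obtains m where "\<And>n. n \<ge> m \<Longrightarrow> cylinder T (prefix n w) \<subseteq> V"
proof -
  obtain m where m: "\<And>z. z \<in> markov_seqs T \<Longrightarrow> \<forall>i<m. z i = w i \<Longrightarrow> z \<in> V"
    using assms unfolding openin_markov_iff by metis
  have "cylinder T (prefix n w) \<subseteq> V" if "n \<ge> m" for n
  proof
    fix z assume "z \<in> cylinder T (prefix n w)"
    then have z: "z \<in> markov_seqs T" "prefix n z = prefix n w" by (auto simp: cylinder_def)
    have "z i = w i" if "i < n" for i
      using z(2) that subsequence_nth[of i n 0 z] subsequence_nth[of i n 0 w] by simp
    then show "z \<in> V" using m z(1) that by auto
  qed
  then show ?thesis by (rule that)
qed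

lemma finite_determined_clopen:
  assumes "\<And>w z. \<lbrakk>w \<in> markov_seqs T; z \<in> markov_seqs T; \<forall>i<m. z i = w i\<rbrakk> \<Longrightarrow> P z \<longleftrightarrow> P w"
  shows "openin (markov_space T) {w \<in> markov_seqs T. P w}" "closedin (markov_space T) {w \<in> markov_seqs T. P w}"
proof -
  show "openin (markov_space T) {w \<in> markov_seqs T. P w}"
    unfolding openin_markov_iff using assms by blast
  have "markov_seqs T - {w \<in> markov_seqs T. P w} = {w \<in> markov_seqs T. \<not> P w}" by blast
  moreover have "openin (markov_space T) {w \<in> markov_seqs T. \<not> P w}"
    unfolding openin_markov_iff using assms by blast
  ultimately show "closedin (markov_space T) {w \<in> markov_seqs T. P w}"
    by (simp add: closedin_def)
qed

lemma cylinder_clopen: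
  "openin (markov_space T) (cylinder T v)" "closedin (markov_space T) (cylinder T v)"
proof -
  have "prefix (length v) z = prefix (length v) w" if "\<forall>i<length v. z i = w i" for z w :: "nat \<Rightarrow> 'a"
    using that by (simp add: subsequence_def)
  then have *: "prefix (length v) z = v \<longleftrightarrow> prefix (length v) w = v"
    if "\<forall>i<length v. z i = w i" for z w :: "nat \<Rightarrow> 'a"
    using that by metis
  show "openin (markov_space T) (cylinder T v)" "closedin (markov_space T) (cylinder T v)"
    unfolding cylinder_def by (rule finite_determined_clopen[of _ "length v"], rule *, assumption)+
qed

lemma mem_cylinder_prefix: "w \<in> markov_seqs T \<Longrightarrow> w \<in> cylinder T (prefix n w)"
  by (simp add: cylinder_def)

text \<open>Each condition on a transition is a finite union of closed conditions on two
  coordinates, so the chain is a closed subset of a product of finite discrete spaces.\<close>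

lemma compact_space_markov: "compact_space (markov_space (T :: 'x::finite rel))"
proof -
  let ?P = "product_topology (\<lambda>_. discrete_topology UNIV) UNIV :: (nat \<Rightarrow> 'x) topology"
  have c: "compact_space ?P"
    by (simp add: compact_space_product_topology compact_space_discrete_topology)
  have "closedin ?P {w. (w n, w (Suc n)) \<in> T}" for n
  proof -
    have "closedin ?P {w. w n = a \<and> w (Suc n) = b}" for a b
    proof -
      have "closedin ?P {w \<in> topspace ?P. w m \<in> {c}}" for m c
        by (rule closedin_continuous_map_preimage[OF continuous_map_product_projection]) auto
      then have "closedin ?P ({w. w n = a} \<inter> {w. w (Suc n) = b})"
        by (intro closedin_Int) auto
      then show ?thesis by (simp add: Collect_conj_eq)
    qed
    then have "closedin ?P (\<Union>(a, b)\<in>T. {w. w n = a \<and> w (Suc n) = b})"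
      by (intro closedin_Union) (auto intro: finite_imageI finite)
    moreover have "(\<Union>(a, b)\<in>T. {w. w n = a \<and> w (Suc n) = b}) = {w. (w n, w (Suc n)) \<in> T}" by auto
    ultimately show ?thesis by simp
  qed
  then have "closedin ?P (\<Inter>n. {w. (w n, w (Suc n)) \<in> T})" by (intro closedin_Inter) auto
  moreover have "(\<Inter>n. {w. (w n, w (Suc n)) \<in> T}) = markov_seqs T" by (auto simp: markov_seqs_def)
  ultimately have "compactin ?P (markov_seqs T)" using c closedin_compact_space by metis
  then show ?thesis unfolding markov_space_def by (simp add: compactin_subspace)
qed

lemma Hausdorff_space_markov: "Hausdorff_space (markov_space T)"
  unfolding markov_space_def
  by (intro Hausdorff_space_subtopology) (simp add: Hausdorff_space_product_topology Hausdorff_space_discrete_topology)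

lemma markov_zero_dim:
  assumes "openin (markov_space (T :: 'x::finite rel)) V" "w \<in> V"
  shows "\<exists>C. openin (markov_space T) C \<and> compactin (markov_space T) C \<and> w \<in> C \<and> C \<subseteq> V"
proof -
  obtain m where m: "cylinder T (prefix m w) \<subseteq> V" using openin_markovE[OF assms] by (metis order_refl)
  have "w \<in> markov_seqs T" using openin_subset[OF assms(1)] assms(2) by auto
  then show ?thesis
    using m cylinder_clopen mem_cylinder_prefix closedin_compact_space[OF compact_space_markov]
    by (intro exI[of _ "cylinder T (prefix m w)"]) blast
qed

section \<open>Partial homeomorphisms with clopen domain and image\<close>

definition clopen_homeo :: "'x rel \<Rightarrow> (nat \<Rightarrow> 'x) rel \<Rightarrow> bool" where
  "clopen_homeo T R \<longleftrightarrow> partial_homeo (markov_space T) R \<and>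
     closedin (markov_space T) (Range R) \<and> closedin (markov_space T) (Domain R)"

text \<open>Complementation inside the domain reduces the claim to open sets. Closed domains serve
  two purposes: they give compact bisections, and they let a map undefined at a sequence be
  undefined on a whole cylinder around it.\<close>

lemma clopen_homeo_closed_Image:
  assumes "clopen_homeo T R" "closedin (markov_space T) C"
  shows "closedin (markov_space T) (R `` C)"
proof -
  have R: "partial_homeo (markov_space T) R" using assms clopen_homeo_def by blast
  have "R `` C = Range R - R `` (markov_seqs T - C)"
  proof
    show "R `` C \<subseteq> Range R - R `` (markov_seqs T - C)"
      using partial_homeo_value_unique[OF R] by blast
    show "Range R - R `` (markov_seqs T - C) \<subseteq> R `` C"
      using partial_homeo_subset[OF R] by auto
  qed
  moreover have "openin (markov_space T) (R `` (markov_seqs T - C))"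
    using partial_homeo_open_Image(1)[OF R] assms(2) by (simp add: closedin_def)
  ultimately show ?thesis using assms(1) unfolding clopen_homeo_def by (simp add: closedin_diff)
qed

lemma clopen_homeo_converse: "clopen_homeo T R \<Longrightarrow> clopen_homeo T (R\<inverse>)"
  by (simp add: clopen_homeo_def partial_homeo_converse)

lemma clopen_homeo_relcomp:
  assumes "clopen_homeo T R" "clopen_homeo T R'" shows "clopen_homeo T (R O R')"
proof -
  have "Range (R O R') = R' `` Range R" "Domain (R O R') = R\<inverse> `` Domain R'" by blast+
  then show ?thesis
    using assms clopen_homeo_closed_Image[of T R' "Range R"]
      clopen_homeo_closed_Image[OF clopen_homeo_converse, of T R "Domain R'"]
    by (simp add: clopen_homeo_def partial_homeo_relcomp)
qed

lemma clopen_homeo_empty: "clopen_homeo T {}"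
  by (simp add: clopen_homeo_def partial_homeo_empty)

lemma clopen_homeo_Id: "clopen_homeo T (Id_on (markov_seqs T))"
proof -
  have "Range (Id_on (markov_seqs T)) = topspace (markov_space T)" "Domain (Id_on (markov_seqs T)) = topspace (markov_space T)"
    by auto
  then show ?thesis
    using partial_homeo_Id_on[OF openin_topspace, of "markov_space T"] closedin_topspace[of "markov_space T"]
    unfolding clopen_homeo_def by simp
qed

lemma clopen_homeo_S_word: "clopen_homeo T (S_word_homeo T u)"
proof -
  let ?S = "S_word_homeo T u"
  have ph: "partial_homeo (markov_space T) ?S"
    unfolding partial_homeo_iff
  proof (intro conjI allI impI)
    show "?S \<subseteq> topspace (markov_space T) \<times> topspace (markov_space T)"
      by (auto simp: mem_S_word_homeo markov_seqs_conc)
    show "single_valued ?S" "single_valued (?S\<inverse>)" by (auto simp: single_valued_def mem_S_word_homeo)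
    fix V assume V: "openin (markov_space T) V"
    show "openin (markov_space T) (?S `` V)"
      unfolding openin_markov_iff
    proof (intro conjI ballI)
      show "?S `` V \<subseteq> markov_seqs T" by (auto simp: mem_S_word_homeo markov_seqs_conc)
      fix w assume "w \<in> ?S `` V"
      then have w: "u \<frown> w \<in> V" "u \<frown> w \<in> markov_seqs T" by (auto simp: mem_S_word_homeo)
      obtain m where m: "\<And>z. z \<in> markov_seqs T \<Longrightarrow> \<forall>i<m. z i = (u \<frown> w) i \<Longrightarrow> z \<in> V"
        using V w(1) unfolding openin_markov_iff by metis
      \<comment> \<open>The bound \<open>Suc m\<close> instead of \<open>m\<close> forces the first
        letters of \<open>z\<close> and \<open>w\<close> to agree, so the transition from the last
        letter of \<open>u\<close> remains allowed even when \<open>m = 0\<close>.\<close>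
      have "z \<in> ?S `` V" if z: "z \<in> markov_seqs T" "\<forall>i<Suc m. z i = w i" for z
      proof -
        have uz: "u \<frown> z \<in> markov_seqs T" using w(2) z by (simp add: markov_seqs_conc)
        moreover have "\<forall>i<m. (u \<frown> z) i = (u \<frown> w) i" using z(2) by (simp add: conc_def)
        ultimately have "u \<frown> z \<in> V" using m by blast
        then show ?thesis using uz by (auto simp: mem_S_word_homeo)
      qed
      then show "\<exists>m. \<forall>z\<in>markov_seqs T. (\<forall>i<m. z i = w i) \<longrightarrow> z \<in> ?S `` V" by blast
    qed
    show "openin (markov_space T) (?S\<inverse> `` V)"
      unfolding openin_markov_iff
    proof (intro conjI ballI)
      show "?S\<inverse> `` V \<subseteq> markov_seqs T" by (auto simp: mem_S_word_homeo)
      fix w' assume "w' \<in> ?S\<inverse> `` V"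
      then obtain w where w: "w' = u \<frown> w" "w \<in> V" "u \<frown> w \<in> markov_seqs T" by (auto simp: mem_S_word_homeo)
      obtain m where m: "\<And>z. z \<in> markov_seqs T \<Longrightarrow> \<forall>i<m. z i = w i \<Longrightarrow> z \<in> V"
        using V w(2) unfolding openin_markov_iff by metis
      have "z \<in> ?S\<inverse> `` V" if z: "z \<in> markov_seqs T" "\<forall>i<length u + m. z i = w' i" for z
      proof -
        define z' where "z' = suffix (length u) z"
        have "prefix (length u) z = u"
          using z(2) w(1) by (intro nth_equalityI) auto
        then have zz': "z = u \<frown> z'" unfolding z'_def using prefix_suffix[of z "length u"] by simp
        have "z' i = w i" if "i < m" for i
          using z(2) that unfolding w(1) z'_def by simp
        moreover have "z' \<in> markov_seqs T" unfolding z'_def using z(1) by (rule markov_seqs_suffix)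
        ultimately have "z' \<in> V" using m by blast
        then show ?thesis using z(1) zz' by (auto simp: mem_S_word_homeo)
      qed
      then show "\<exists>m. \<forall>z\<in>markov_seqs T. (\<forall>i<m. z i = w' i) \<longrightarrow> z \<in> ?S\<inverse> `` V" by blast
    qed
  qed
  have R: "Range ?S = {w \<in> markov_seqs T. u \<frown> w \<in> markov_seqs T}"
    unfolding Range_iff set_eq_iff mem_S_word_homeo by (auto simp: markov_seqs_conc)
  have "Domain ?S = Domain (?S O ?S\<inverse>)" by blast
  then have D: "Domain ?S = cylinder T u" unfolding S_word_homeo_range by auto
  \<comment> \<open>Whether \<open>u \<frown> w\<close> is allowed depends on \<open>w\<close> only
    through its first letter, hence prefixes of length one suffice.\<close>
  have "closedin (markov_space T) {w \<in> markov_seqs T. u \<frown> w \<in> markov_seqs T}"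
    by (rule finite_determined_clopen(2)[of _ "Suc 0"]) (simp add: markov_seqs_conc)
  then show ?thesis using ph R D cylinder_clopen(2) unfolding clopen_homeo_def by simp
qed

lemma clopen_homeo_compact:
  assumes "clopen_homeo (T :: 'x::finite rel) R" shows "compactin (markov_space T) (Range R)"
  using assms closedin_compact_space[OF compact_space_markov] by (auto simp: clopen_homeo_def)

lemma clopen_homeo_cob:
  assumes "etale_groupoid G" "Obj G = markov_space T" "F \<in> cob_homeos G"
  shows "clopen_homeo T F"
  using etale_groupoid.cob_homeos_properties(1-3)[OF assms(1,3)] compactin_imp_closedin[OF Hausdorff_space_markov]
  unfolding clopen_homeo_def assms(2) by blast

section \<open>Congruences modulo relators\<close>

text \<open>Multipliers occur only in the generators; closure under multiplication and negation is
  derived. This keeps inductions over the ideal to three cases.\<close>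

inductive_set two_sided_ideal :: "'a::ring_1 set \<Rightarrow> 'a set" for R :: "'a set" where
  zero: "0 \<in> two_sided_ideal R"
| base: "r \<in> R \<Longrightarrow> a * r * b \<in> two_sided_ideal R"
| add: "\<lbrakk>p \<in> two_sided_ideal R; q \<in> two_sided_ideal R\<rbrakk> \<Longrightarrow> p + q \<in> two_sided_ideal R"

lemma two_sided_ideal_mult:
  "p \<in> two_sided_ideal R \<Longrightarrow> c * p * d \<in> two_sided_ideal R"
proof (induction rule: two_sided_ideal.induct)
  case (base r a b)
  have "c * (a * r * b) * d = (c * a) * r * (b * d)" by (simp add: mult.assoc)
  then show ?case using base two_sided_ideal.base by metis
next
  case (add p q)
  then show ?case using two_sided_ideal.add by (metis distrib_left distrib_right)
qed (simp add: two_sided_ideal.zero)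

lemma two_sided_ideal_mult_left: "p \<in> two_sided_ideal R \<Longrightarrow> c * p \<in> two_sided_ideal R"
  using two_sided_ideal_mult[of p R c 1] by simp

lemma two_sided_ideal_mult_right: "p \<in> two_sided_ideal R \<Longrightarrow> p * c \<in> two_sided_ideal R"
  using two_sided_ideal_mult[of p R 1 c] by simp

lemma two_sided_ideal_uminus: "p \<in> two_sided_ideal R \<Longrightarrow> - p \<in> two_sided_ideal R"
  using two_sided_ideal_mult_left[of p R "-1"] by simp

definition eq_mod :: "'a::ring_1 set \<Rightarrow> 'a \<Rightarrow> 'a \<Rightarrow> bool" where
  "eq_mod R p q \<longleftrightarrow> p - q \<in> two_sided_ideal R"

lemma eq_mod_refl [simp, intro]: "eq_mod R p p"
  by (simp add: eq_mod_def two_sided_ideal.zero)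

lemma eq_mod_sym: "eq_mod R p q \<Longrightarrow> eq_mod R q p"
  using two_sided_ideal_uminus[of "p - q" R] by (simp add: eq_mod_def)

lemma eq_mod_trans [trans]: "\<lbrakk>eq_mod R p q; eq_mod R q r\<rbrakk> \<Longrightarrow> eq_mod R p r"
  using two_sided_ideal.add[of "p - q" R "q - r"] by (simp add: eq_mod_def)

lemma eq_mod_add: "\<lbrakk>eq_mod R p q; eq_mod R p' q'\<rbrakk> \<Longrightarrow> eq_mod R (p + p') (q + q')"
  using two_sided_ideal.add[of "p - q" R "p' - q'"] by (simp add: eq_mod_def algebra_simps)

lemma eq_mod_mult:
  assumes "eq_mod R p q" "eq_mod R p' q'" shows "eq_mod R (p * p') (q * q')"
proof -
  have "p * p' - q * q' = (p - q) * p' + q * (p' - q')" by (simp add: algebra_simps)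
  then show ?thesis using assms two_sided_ideal.add two_sided_ideal_mult_left two_sided_ideal_mult_right
    unfolding eq_mod_def by metis
qed

lemma eq_mod_mult_left: "eq_mod R p q \<Longrightarrow> eq_mod R (c * p) (c * q)"
  by (simp add: eq_mod_mult)

lemma eq_mod_mult_right: "eq_mod R p q \<Longrightarrow> eq_mod R (p * c) (q * c)"
  by (simp add: eq_mod_mult)

lemma eq_mod_sum: "(\<And>i. i \<in> A \<Longrightarrow> eq_mod R (f i) (g i)) \<Longrightarrow> eq_mod R (\<Sum>i\<in>A. f i) (\<Sum>i\<in>A. g i)"
  by (induction A rule: infinite_finite_induct) (auto intro: eq_mod_add)

lemma eq_mod_sum_zero: "(\<And>i. i \<in> A \<Longrightarrow> eq_mod R (f i) 0) \<Longrightarrow> eq_mod R (\<Sum>i\<in>A. f i) 0"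
  using eq_mod_sum[of A R f "\<lambda>_. 0"] by simp

lemma eq_mod_zero_mult: "eq_mod R p 0 \<Longrightarrow> eq_mod R (c * p) 0" "eq_mod R p 0 \<Longrightarrow> eq_mod R (p * c) 0"
  using eq_mod_mult_left[of R p 0 c] eq_mod_mult_right[of R p 0 c] by auto

lemma eq_mod_sum_single:
  assumes "finite A" "a \<in> A" "\<And>i. \<lbrakk>i \<in> A; i \<noteq> a\<rbrakk> \<Longrightarrow> eq_mod R (f i) 0"
  shows "eq_mod R (\<Sum>i\<in>A. f i) (f a)"
proof -
  have "eq_mod R (\<Sum>i\<in>A. f i) (\<Sum>i\<in>A. if i = a then f i else 0)"
    by (rule eq_mod_sum) (use assms in auto)
  then show ?thesis using assms(1,2) by simp
qed

section \<open>Sums over words, and noncommutative polynomials\<close>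

lemma finite_words: "finite {u :: 'x::finite list. length u = n}"
  using finite_lists_length_eq[of "UNIV :: 'x set" n] by simp

lemma sum_words_append:
  fixes f :: "'x::finite list \<Rightarrow> 'b::comm_monoid_add"
  shows "(\<Sum>t | length t = m + n. f t) = (\<Sum>a | length a = m. \<Sum>b | length b = n. f (a @ b))"
proof -
  have "(\<Sum>a | length a = m. \<Sum>b | length b = n. f (a @ b)) =
      (\<Sum>(a, b)\<in>{a. length a = m} \<times> {b. length b = n}. f (a @ b))"
    by (rule sum.cartesian_product)
  also have "\<dots> = (\<Sum>t | length t = m + n. f t)"
    by (rule sum.reindex_bij_witness[of _ "\<lambda>t. (take m t, drop m t)" "\<lambda>(a, b). a @ b"]) auto
  finally show ?thesis by simp
qed

lemma sum_words_Suc: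
  fixes f :: "'x::finite list \<Rightarrow> 'b::comm_monoid_add"
  shows "(\<Sum>t | length t = Suc n. f t) = (\<Sum>x\<in>UNIV. \<Sum>t | length t = n. f (x # t))"
proof -
  have "(\<Sum>t | length t = Suc n. f t) = (\<Sum>a | length a = 1. \<Sum>t | length t = n. f (a @ t))"
    using sum_words_append[of f 1 n] by simp
  also have "\<dots> = (\<Sum>x\<in>UNIV. \<Sum>t | length t = n. f ([x] @ t))"
    by (rule sum.reindex_bij_witness[of _ "\<lambda>x. [x]" hd]) (auto simp: length_Suc_conv)
  finally show ?thesis by simp
qed

abbreviation const :: "'k::field \<Rightarrow> ('a, 'k) ncpoly" where
  "const c \<equiv> Poly_Mapping.single 0 c"

lemma sum_monomials: "p = (\<Sum>w\<in>Poly_Mapping.keys p. Poly_Mapping.single w (Poly_Mapping.lookup p w))"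
  by (rule poly_mapping_eqI) (simp add: lookup_sum lookup_single when_def in_keys_iff)

text \<open>Scalars act by left multiplication with constants; centrality makes this action
  compatible with products on either side.\<close>

lemma const_commute: "const c * p = p * const c"
proof -
  let ?s = "\<lambda>w. Poly_Mapping.single w (Poly_Mapping.lookup p w)"
  have "const c * (\<Sum>w\<in>Poly_Mapping.keys p. ?s w) = (\<Sum>w\<in>Poly_Mapping.keys p. ?s w) * const c"
    unfolding sum_distrib_left sum_distrib_right by (simp add: mult_single mult.commute)
  then show ?thesis using sum_monomials[of p] by simp
qed

lemma single_Word_Cons:
  "Poly_Mapping.single (Word (a # ls)) c = gen a * Poly_Mapping.single (Word ls) c"
  by (simp add: gen_def mult_single plus_free_monoid_def)

lemma single_Word_Nil: "Poly_Mapping.single (Word []) c = const c"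
  by (simp add: zero_free_monoid_def)

lemma Sw_Nil [simp]: "Sw [] = 1" and Sw_Cons: "Sw (x # u) = genS x * Sw u"
  and Sw_append: "Sw (u @ v) = Sw u * Sw v"
  by (simp_all add: Sw_def)

lemma Sw'_Nil [simp]: "Sw' [] = 1" and Sw'_Cons: "Sw' (x # u) = Sw' u * genS' x"
  and Sw'_append: "Sw' (u @ v) = Sw' v * Sw' u"
  by (simp_all add: Sw'_def)

section \<open>Consequences of the defining relations\<close>

text \<open>The parameter \<open>K\<close> only fixes the type of the coefficients.\<close>

locale nucleus_relations =
  fixes T :: "'x::finite rel" and N :: "(nat \<Rightarrow> 'x) rel set" and n0 :: nat
    and K :: "'k::field itself"
  assumes N_subset: "F \<in> N \<Longrightarrow> F \<subseteq> markov_seqs T \<times> markov_seqs T"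
    and N_empty: "{} \<in> N"
    and N_step: "F \<in> N \<Longrightarrow> (S_homeo T y)\<inverse> O F O S_homeo T x \<in> N"
    and N_prod: "\<lbrakk>F1 \<in> N; F2 \<in> N; length u = n0; length v = n0\<rbrakk>
           \<Longrightarrow> (S_word_homeo T u)\<inverse> O F1 O F2 O S_word_homeo T v \<in> N"
    and N_unit: "\<exists>n. \<forall>v. length v = Suc n \<longrightarrow> (S_word_homeo T v)\<inverse> O S_word_homeo T v \<in> N"
begin

abbreviation eqv :: "('x generator, 'k) ncpoly \<Rightarrow> ('x generator, 'k) ncpoly \<Rightarrow> bool" (infix "\<approx>\<^sub>N" 50) where
  "p \<approx>\<^sub>N q \<equiv> eq_mod (defining_rels T N n0) p q"

lemma eqvI: "p - q \<in> defining_rels T N n0 \<Longrightarrow> p \<approx>\<^sub>N q"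
  using two_sided_ideal.base[of "p - q" "defining_rels T N n0" 1 1] by (simp add: eq_mod_def)

lemma genS'_genS: "genS' x * genS x \<approx>\<^sub>N (\<Sum>y | (x, y) \<in> T. genS y * genS' y)"
  by (rule eqvI) (auto simp: defining_rels_def cuntz_krieger_rels_def)

lemma sum_genS_genS': "(\<Sum>y\<in>UNIV. genS y * genS' y) \<approx>\<^sub>N 1"
  by (rule eqvI) (auto simp: defining_rels_def cuntz_krieger_rels_def)

lemma genS'_genS_neq: "a \<noteq> b \<Longrightarrow> genS' a * genS b \<approx>\<^sub>N 0"
  by (rule eqvI) (auto simp: defining_rels_def cuntz_krieger_rels_def)

lemma nuc_expand:
  "F \<in> N \<Longrightarrow> nuc F \<approx>\<^sub>N
    (\<Sum>x\<in>UNIV. \<Sum>y\<in>UNIV. genS y * nuc ((S_homeo T y)\<inverse> O F O S_homeo T x) * genS' x)"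
  by (rule eqvI) (auto simp: defining_rels_def nucleus_rels_def)

lemma nuc_product:
  "\<lbrakk>F1 \<in> N; F2 \<in> N\<rbrakk> \<Longrightarrow> nuc F1 * nuc F2 \<approx>\<^sub>N
    (\<Sum>v | length v = n0. \<Sum>u | length u = n0.
       Sw u * nuc ((S_word_homeo T u)\<inverse> O F1 O F2 O S_word_homeo T v) * Sw' v)"
  by (rule eqvI) (auto simp: defining_rels_def product_rels_def)

lemma nuc_empty: "nuc {} \<approx>\<^sub>N 0"
  by (rule eqvI) (use N_empty in \<open>auto simp: defining_rels_def identification_rels_def\<close>)

lemma nuc_domain:
  "(S_homeo T x)\<inverse> O S_homeo T x \<in> N \<Longrightarrow> nuc ((S_homeo T x)\<inverse> O S_homeo T x) \<approx>\<^sub>N genS' x * genS x"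
  by (rule eqvI) (auto simp: defining_rels_def identification_rels_def)

text \<open>Multiply the decomposition of 1 by \<open>S_x\<close>: orthogonality of distinct letters
  leaves one summand. That the generators are partial isometries need not be imposed as a
  relation.\<close>

lemma genS_genS'_genS: "genS x * genS' x * genS x \<approx>\<^sub>N genS x"
proof (rule eq_mod_sym)
  have "1 * genS x \<approx>\<^sub>N (\<Sum>y\<in>UNIV. genS y * genS' y) * genS x"
    by (intro eq_mod_mult_right eq_mod_sym[OF sum_genS_genS'])
  also have "\<dots> = (\<Sum>y\<in>UNIV. genS y * genS' y * genS x)" by (rule sum_distrib_right)
  also have "\<dots> \<approx>\<^sub>N genS x * genS' x * genS x"
    by (rule eq_mod_sum_single) (auto simp: mult.assoc intro!: eq_mod_zero_mult(1) genS'_genS_neq)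
  finally show "genS x \<approx>\<^sub>N genS x * genS' x * genS x" by simp
qed

lemma genS'_genS_genS': "genS' x * genS x * genS' x \<approx>\<^sub>N genS' x"
proof (rule eq_mod_sym)
  have "genS' x * 1 \<approx>\<^sub>N genS' x * (\<Sum>y\<in>UNIV. genS y * genS' y)"
    by (intro eq_mod_mult_left eq_mod_sym[OF sum_genS_genS'])
  also have "\<dots> = (\<Sum>y\<in>UNIV. genS' x * (genS y * genS' y))" by (rule sum_distrib_left)
  also have "\<dots> \<approx>\<^sub>N genS' x * (genS x * genS' x)"
    by (rule eq_mod_sum_single) (auto simp flip: mult.assoc intro!: eq_mod_zero_mult(2) genS'_genS_neq)
  finally show "genS' x \<approx>\<^sub>N genS' x * genS x * genS' x" by (simp add: mult.assoc)
qed

text \<open>The projection \<open>S_x^-1 S_x\<close> is the sum of the projections to the letters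
  that may follow \<open>x\<close>, so it fixes or annihilates the next letter. Every cancellation
  below rests on this and on its mirror image.\<close>

lemma genS'_genS_genS: "genS' x * genS x * genS y \<approx>\<^sub>N (if (x, y) \<in> T then genS y else 0)"
proof -
  have "genS' x * genS x * genS y \<approx>\<^sub>N (\<Sum>z | (x, z) \<in> T. genS z * genS' z) * genS y"
    by (intro eq_mod_mult_right genS'_genS)
  also have "\<dots> = (\<Sum>z | (x, z) \<in> T. genS z * genS' z * genS y)" by (rule sum_distrib_right)
  also have "\<dots> \<approx>\<^sub>N (\<Sum>z | (x, z) \<in> T. if z = y then genS y else 0)"
  proof (rule eq_mod_sum)
    fix z
    show "genS z * genS' z * genS y \<approx>\<^sub>N (if z = y then genS y else 0)"
      using genS_genS'_genS eq_mod_zero_mult(1)[OF genS'_genS_neq, of z y "genS z"]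
      by (auto simp: mult.assoc)
  qed
  also have "\<dots> = (if (x, y) \<in> T then genS y else 0)" by simp
  finally show ?thesis .
qed

lemma genS'_genS'_genS: "genS' y * (genS' x * genS x) \<approx>\<^sub>N (if (x, y) \<in> T then genS' y else 0)"
proof -
  have "genS' y * (genS' x * genS x) \<approx>\<^sub>N genS' y * (\<Sum>z | (x, z) \<in> T. genS z * genS' z)"
    by (intro eq_mod_mult_left genS'_genS)
  also have "\<dots> = (\<Sum>z | (x, z) \<in> T. genS' y * (genS z * genS' z))" by (rule sum_distrib_left)
  also have "\<dots> \<approx>\<^sub>N (\<Sum>z | (x, z) \<in> T. if z = y then genS' y else 0)"
  proof (rule eq_mod_sum)
    fix z
    show "genS' y * (genS z * genS' z) \<approx>\<^sub>N (if z = y then genS' y else 0)"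
      using genS'_genS_genS'[of y] eq_mod_zero_mult(2)[OF genS'_genS_neq, of y z "genS' z"]
      by (auto simp: mult.assoc)
  qed
  also have "\<dots> = (if (x, y) \<in> T then genS' y else 0)" by simp
  finally show ?thesis .
qed

text \<open>Inserting \<open>S_x^-1 S_x\<close> between the two factors does not change the product,
  but annihilates the second factor.\<close>

lemma genS_genS_forbidden: "(x, y) \<notin> T \<Longrightarrow> genS x * genS y \<approx>\<^sub>N 0"
proof -
  assume "(x, y) \<notin> T"
  then have "genS x * (genS' x * genS x * genS y) \<approx>\<^sub>N 0"
    using eq_mod_zero_mult(1)[of _ "genS' x * genS x * genS y"] genS'_genS_genS[of x y] by simp
  moreover have "genS x * genS y \<approx>\<^sub>N genS x * genS' x * genS x * genS y"
    by (intro eq_mod_mult_right eq_mod_sym[OF genS_genS'_genS])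
  ultimately show ?thesis unfolding mult.assoc by (rule eq_mod_trans[rotated])
qed

lemma Sw_inadmissible: "\<not> admissible T u \<Longrightarrow> Sw u \<approx>\<^sub>N 0"
proof (induction u rule: induct_list012)
  case (3 x y u)
  show ?case
  proof (cases "(x, y) \<in> T")
    case True
    then show ?thesis using 3 by (simp add: Sw_Cons[of x] eq_mod_zero_mult(1))
  next
    case False
    have "genS x * genS y * Sw u \<approx>\<^sub>N 0" by (rule eq_mod_zero_mult(2)[OF genS_genS_forbidden[OF False]])
    then show ?thesis by (simp add: Sw_Cons mult.assoc)
  qed
qed auto

lemma genS_last: "v \<noteq> [] \<Longrightarrow> Sw v * (genS' (last v) * genS (last v)) \<approx>\<^sub>N Sw v"
proof -
  assume "v \<noteq> []"
  then have v: "(Sw v :: ('x generator, 'k) ncpoly) = Sw (butlast v) * genS (last v)"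
    using Sw_append[of "butlast v" "[last v]"] by (simp add: Sw_Cons)
  have "Sw (butlast v) * (genS (last v) * genS' (last v) * genS (last v)) \<approx>\<^sub>N Sw (butlast v) * genS (last v)"
    by (intro eq_mod_mult_left genS_genS'_genS)
  then show ?thesis by (simp add: v mult.assoc)
qed

text \<open>Counterpart in the algebra of \<open>S_word_homeo_cancel\<close>. Each cancelled letter
  leaves a projection that the following letter absorbs; as \<open>v\<close> is nonempty, such a
  letter always exists.\<close>

lemma Sw'_Sw_cancel:
  "\<lbrakk>admissible T (u @ v); v \<noteq> []\<rbrakk> \<Longrightarrow> Sw' u * Sw (u @ v) \<approx>\<^sub>N Sw v"
proof (induction u)
  case (Cons x u)
  obtain y w where yw: "u @ v = y # w" using Cons.prems(2) by (cases "u @ v") auto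
  then have "(x, y) \<in> T" "admissible T (u @ v)" using Cons.prems(1) by (auto simp: successively_Cons)
  then have "genS' x * genS x * genS y \<approx>\<^sub>N genS y" using genS'_genS_genS[of x y] by simp
  then have "Sw' u * (genS' x * genS x * genS y) * Sw w \<approx>\<^sub>N Sw' u * genS y * Sw w"
    by (intro eq_mod_mult_right eq_mod_mult_left)
  moreover have "(Sw' u * genS y * Sw w :: ('x generator, 'k) ncpoly) = Sw' u * Sw (u @ v)" by (simp add: yw Sw_Cons mult.assoc)
  moreover have "(Sw' u * (genS' x * genS x * genS y) * Sw w :: ('x generator, 'k) ncpoly) =
      Sw' (x # u) * Sw ((x # u) @ v)"
    by (simp add: yw Sw_Cons Sw'_Cons mult.assoc)
  moreover have "Sw' u * Sw (u @ v) \<approx>\<^sub>N Sw v"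
    using Cons.IH \<open>admissible T (u @ v)\<close> Cons.prems(2) by blast
  ultimately show ?case using eq_mod_trans by metis
qed simp

lemma Sw'_Sw_orthogonal:
  "\<lbrakk>length u \<le> length w; take (length u) w \<noteq> u\<rbrakk> \<Longrightarrow> Sw' u * Sw w \<approx>\<^sub>N 0"
proof (induction u arbitrary: w)
  case (Cons x u)
  obtain y w' where w: "w = y # w'" using Cons.prems(1) by (cases w) auto
  show ?case
  proof (cases "x = y")
    case False
    have "Sw' u * (genS' x * genS y) * Sw w' \<approx>\<^sub>N 0"
      by (intro eq_mod_zero_mult genS'_genS_neq[OF False])
    then show ?thesis by (simp add: w Sw_Cons Sw'_Cons mult.assoc)
  next
    case True
    then have u: "take (length u) w' \<noteq> u" "length u \<le> length w'" using Cons.prems w by auto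
    \<comment> \<open>The mismatch forces \<open>u\<close> to be nonempty, so \<open>w'\<close> has
      a first letter, which absorbs or is annihilated by the projection left by
      \<open>x\<close>.\<close>
    then obtain z w'' where w': "w' = z # w''" by (cases w') auto
    have "Sw' u * (genS' x * genS x * genS z) * Sw w'' \<approx>\<^sub>N 0"
    proof (cases "(x, z) \<in> T")
      case True
      have "Sw' u * (genS' x * genS x * genS z) * Sw w'' \<approx>\<^sub>N Sw' u * genS z * Sw w''"
        using genS'_genS_genS[of x z] True by (intro eq_mod_mult_right eq_mod_mult_left) simp
      moreover have "Sw' u * genS z * Sw w'' \<approx>\<^sub>N 0"
        using Cons.IH[OF u(2,1)] by (simp add: w' Sw_Cons mult.assoc)
      ultimately show ?thesis by (rule eq_mod_trans)
    next
      case False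
      then have "genS' x * genS x * genS z \<approx>\<^sub>N 0" using genS'_genS_genS[of x z] by simp
      then show ?thesis by (rule eq_mod_zero_mult(2)[OF eq_mod_zero_mult(1)])
    qed
    then show ?thesis by (simp add: w w' True Sw_Cons Sw'_Cons mult.assoc)
  qed
qed simp

lemma sum_Sw_Sw': "(\<Sum>v | length v = n. Sw v * Sw' v) \<approx>\<^sub>N 1"
proof (induction n)
  case (Suc n)
  have "(\<Sum>v | length v = Suc n. Sw v * Sw' v :: ('x generator, 'k) ncpoly) =
      (\<Sum>x\<in>UNIV. genS x * (\<Sum>v | length v = n. Sw v * Sw' v) * genS' x)"
    by (simp add: sum_words_Suc Sw_Cons Sw'_Cons sum_distrib_left sum_distrib_right mult.assoc)
  also have "\<dots> \<approx>\<^sub>N (\<Sum>x\<in>UNIV. genS x * 1 * genS' x)"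
    by (intro eq_mod_sum eq_mod_mult_left eq_mod_mult_right Suc)
  also have "\<dots> \<approx>\<^sub>N 1" using sum_genS_genS' by simp
  finally show ?case .
qed simp

lemma S_homeo_forbidden: "(x, y) \<notin> T \<Longrightarrow> S_homeo T x O S_homeo T y = {}"
  by (auto simp: mem_S_homeo markov_seqs_Cons simp del: conc_conc)

lemma S_word_homeo_inadmissible: "\<not> admissible T u \<Longrightarrow> S_word_homeo T u = {}"
  by (auto simp: mem_S_word_homeo markov_seqs_conc)

text \<open>After expanding \<open>F\<close> by one letter the projection meets
  \<open>S_y^-1\<close>. It disappears if \<open>y\<close> may follow \<open>x\<close>; otherwise
  \<open>F\<close> restricted to sequences starting with \<open>y\<close> is empty, and the
  generator of the empty bisection is zero on both sides.\<close>

lemma nuc_absorb_domain: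
  assumes F: "F \<in> N" and dom: "F O (S_homeo T x)\<inverse> O S_homeo T x = F"
  shows "nuc F * (genS' x * genS x) \<approx>\<^sub>N nuc F"
proof -
  let ?F = "\<lambda>z y. (S_homeo T z)\<inverse> O F O S_homeo T y"
  have "nuc F * (genS' x * genS x) \<approx>\<^sub>N
      (\<Sum>y\<in>UNIV. \<Sum>z\<in>UNIV. genS z * nuc (?F z y) * genS' y) * (genS' x * genS x)"
    by (intro eq_mod_mult_right nuc_expand F)
  also have "\<dots> = (\<Sum>y\<in>UNIV. \<Sum>z\<in>UNIV. genS z * nuc (?F z y) * (genS' y * (genS' x * genS x)))"
    by (simp add: sum_distrib_right mult.assoc)
  also have "\<dots> \<approx>\<^sub>N (\<Sum>y\<in>UNIV. \<Sum>z\<in>UNIV. genS z * nuc (?F z y) * genS' y)"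
  proof (intro eq_mod_sum)
    fix y z
    show "genS z * nuc (?F z y) * (genS' y * (genS' x * genS x)) \<approx>\<^sub>N genS z * nuc (?F z y) * genS' y"
    proof (cases "(x, y) \<in> T")
      case True
      then show ?thesis using genS'_genS'_genS[of y x] by (intro eq_mod_mult_left) simp
    next
      case False
      have "F O S_homeo T y = {}"
        using dom S_homeo_forbidden[OF False] by (metis O_assoc relcomp_empty2)
      then have "nuc (?F z y) \<approx>\<^sub>N 0" using nuc_empty by simp
      then have "genS z * nuc (?F z y) * q \<approx>\<^sub>N 0" for q by (intro eq_mod_zero_mult)
      then show ?thesis using eq_mod_trans eq_mod_sym by blast
    qed
  qed
  also have "\<dots> \<approx>\<^sub>N nuc F" by (intro eq_mod_sym[OF nuc_expand] F)
  finally show ?thesis .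
qed

text \<open>Orthogonality leaves the summands ending in \<open>S_x^-1 S_x\<close>. The section
  before it is defined only where \<open>S_x\<close> is, so it absorbs this projection. This is the
  self-similarity rule that moves a letter through the nucleus.\<close>

lemma nuc_genS:
  assumes F: "F \<in> N"
  shows "nuc F * genS x \<approx>\<^sub>N (\<Sum>y\<in>UNIV. genS y * nuc ((S_homeo T y)\<inverse> O F O S_homeo T x))"
proof -
  let ?F = "\<lambda>z y. (S_homeo T z)\<inverse> O F O S_homeo T y"
  have "nuc F * genS x \<approx>\<^sub>N (\<Sum>y\<in>UNIV. \<Sum>z\<in>UNIV. genS z * nuc (?F z y) * genS' y) * genS x"
    by (intro eq_mod_mult_right nuc_expand F)
  also have "\<dots> = (\<Sum>y\<in>UNIV. \<Sum>z\<in>UNIV. genS z * nuc (?F z y) * (genS' y * genS x))"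
    by (simp add: sum_distrib_right mult.assoc)
  also have "\<dots> \<approx>\<^sub>N (\<Sum>z\<in>UNIV. genS z * nuc (?F z x) * (genS' x * genS x))"
    by (rule eq_mod_sum_single) (auto intro!: eq_mod_sum_zero eq_mod_zero_mult(1) genS'_genS_neq)
  also have "\<dots> = (\<Sum>z\<in>UNIV. genS z * (nuc (?F z x) * (genS' x * genS x)))"
    by (simp add: mult.assoc)
  also have "\<dots> \<approx>\<^sub>N (\<Sum>z\<in>UNIV. genS z * nuc (?F z x))"
  proof (intro eq_mod_sum eq_mod_mult_left nuc_absorb_domain N_step F)
    fix z
    have "S_homeo T x O (S_homeo T x)\<inverse> O S_homeo T x = S_homeo T x"
      by (auto simp: mem_S_homeo relcomp_unfold)
    then show "?F z x O (S_homeo T x)\<inverse> O S_homeo T x = ?F z x"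
      by (simp add: O_assoc)
  qed
  finally show ?thesis .
qed

lemma S_word_homeo_Cons: "S_word_homeo T (x # u) = S_homeo T x O S_word_homeo T u"
  by (simp add: S_word_homeo_def)

lemma N_word:
  "\<lbrakk>length t = length u; F \<in> N\<rbrakk> \<Longrightarrow> (S_word_homeo T t)\<inverse> O F O S_word_homeo T u \<in> N"
proof (induction t u arbitrary: F rule: list_induct2)
  case Nil
  have "(S_word_homeo T [])\<inverse> O F O S_word_homeo T [] = F"
    using N_subset[OF Nil] by (auto simp: S_word_homeo_def)
  then show ?case using Nil by simp
next
  case (Cons y t x u)
  have "(S_word_homeo T (y # t))\<inverse> O F O S_word_homeo T (x # u) =
      (S_word_homeo T t)\<inverse> O ((S_homeo T y)\<inverse> O F O S_homeo T x) O S_word_homeo T u"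
    by (simp add: S_word_homeo_Cons converse_relcomp O_assoc)
  then show ?case using Cons.IH[OF N_step[OF Cons.prems]] by simp
qed

text \<open>Iterating \<open>nuc_genS\<close>, one letter at a time; the successive one-letter
  sections compose to the section along whole words.\<close>

lemma nuc_Sw:
  "F \<in> N \<Longrightarrow> nuc F * Sw u \<approx>\<^sub>N
    (\<Sum>t | length t = length u. Sw t * nuc ((S_word_homeo T t)\<inverse> O F O S_word_homeo T u))"
proof (induction u arbitrary: F)
  case Nil
  have "(S_word_homeo T [])\<inverse> O F O S_word_homeo T [] = F"
    using N_subset[OF Nil] by (auto simp: S_word_homeo_def)
  then show ?case by simp
next
  case (Cons x u)
  let ?F = "\<lambda>y. (S_homeo T y)\<inverse> O F O S_homeo T x"
  have eq: "(S_word_homeo T (y # t))\<inverse> O F O S_word_homeo T (x # u) =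
      (S_word_homeo T t)\<inverse> O ?F y O S_word_homeo T u" for y t
    by (simp add: S_word_homeo_Cons converse_relcomp O_assoc)
  have "(nuc F * Sw (x # u) :: ('x generator, 'k) ncpoly) = nuc F * genS x * Sw u" by (simp add: Sw_Cons mult.assoc)
  also have "\<dots> \<approx>\<^sub>N (\<Sum>y\<in>UNIV. genS y * nuc (?F y)) * Sw u"
    by (intro eq_mod_mult_right nuc_genS Cons.prems)
  also have "\<dots> = (\<Sum>y\<in>UNIV. genS y * (nuc (?F y) * Sw u))"
    by (simp add: sum_distrib_right mult.assoc)
  also have "\<dots> \<approx>\<^sub>N (\<Sum>y\<in>UNIV. genS y * (\<Sum>t | length t = length u.
      Sw t * nuc ((S_word_homeo T t)\<inverse> O ?F y O S_word_homeo T u)))"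
    by (intro eq_mod_sum eq_mod_mult_left Cons.IH N_step Cons.prems)
  also have "\<dots> = (\<Sum>t | length t = length (x # u).
      Sw t * nuc ((S_word_homeo T t)\<inverse> O F O S_word_homeo T (x # u)))"
    unfolding length_Cons sum_words_Suc eq by (simp add: sum_distrib_left Sw_Cons mult.assoc)
  finally show ?case .
qed

subsection \<open>Normal forms\<close>

abbreviation monomial :: "'x list \<Rightarrow> (nat \<Rightarrow> 'x) rel \<Rightarrow> 'x list \<Rightarrow> ('x generator, 'k) ncpoly" where
  "monomial u F v \<equiv> Sw u * nuc F * Sw' v"

abbreviation monomial_homeo :: "'x list \<Rightarrow> (nat \<Rightarrow> 'x) rel \<Rightarrow> 'x list \<Rightarrow> (nat \<Rightarrow> 'x) rel" where
  "monomial_homeo u F v \<equiv> S_word_homeo T u O F O (S_word_homeo T v)\<inverse>"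

text \<open>Closure under congruence is built in, so that the set describes a subspace of the
  presented algebra while its elements remain polynomials.\<close>

inductive_set normal_span :: "('x generator, 'k) ncpoly set" where
  zero: "0 \<in> normal_span"
| monomial: "F \<in> N \<Longrightarrow> const c * monomial u F v \<in> normal_span"
| add: "\<lbrakk>p \<in> normal_span; q \<in> normal_span\<rbrakk> \<Longrightarrow> p + q \<in> normal_span"
| eqv: "\<lbrakk>q \<in> normal_span; p \<approx>\<^sub>N q\<rbrakk> \<Longrightarrow> p \<in> normal_span"

lemma normal_span_sum: "(\<And>i. i \<in> A \<Longrightarrow> f i \<in> normal_span) \<Longrightarrow> (\<Sum>i\<in>A. f i) \<in> normal_span"
  by (induction A rule: infinite_finite_induct) (auto intro: normal_span.zero normal_span.add)

lemma monomial_expand: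
  assumes "F \<in> N"
  shows "monomial u F v \<approx>\<^sub>N
    (\<Sum>x\<in>UNIV. \<Sum>y\<in>UNIV. monomial (u @ [y]) ((S_homeo T y)\<inverse> O F O S_homeo T x) (v @ [x]))"
proof -
  have "monomial u F v \<approx>\<^sub>N Sw u * (\<Sum>x\<in>UNIV. \<Sum>y\<in>UNIV. genS y * nuc ((S_homeo T y)\<inverse> O F O S_homeo T x) * genS' x) * Sw' v"
    by (intro eq_mod_mult_right eq_mod_mult_left nuc_expand assms)
  also have "\<dots> = (\<Sum>x\<in>UNIV. \<Sum>y\<in>UNIV. monomial (u @ [y]) ((S_homeo T y)\<inverse> O F O S_homeo T x) (v @ [x]))"
    by (simp add: sum_distrib_left sum_distrib_right Sw_append Sw'_append Sw_Cons Sw'_Cons mult.assoc)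
  finally show ?thesis .
qed

lemma normal_span_mult_left:
  assumes q: "\<And>F c u v. F \<in> N \<Longrightarrow> q * (const c * monomial u F v) \<in> normal_span"
    and p: "p \<in> normal_span"
  shows "q * p \<in> normal_span"
  using p
proof (induction rule: normal_span.induct)
  case (add p p')
  then show ?case by (simp add: distrib_left normal_span.add)
next
  case (eqv p p')
  then show ?case using normal_span.eqv eq_mod_mult_left by blast
qed (auto intro: normal_span.zero q)

lemma normal_span_const: "p \<in> normal_span \<Longrightarrow> const c * p \<in> normal_span"
proof (rule normal_span_mult_left)
  fix F c' u v assume "F \<in> N"
  have "const c * (const c' * monomial u F v) = const (c * c') * monomial u F v"
    by (simp add: mult_single flip: mult.assoc)
  then show "const c * (const c' * monomial u F v) \<in> normal_span"
    using normal_span.monomial[OF \<open>F \<in> N\<close>] by metis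
qed

lemma normal_span_mult_leftI:
  assumes q: "\<And>F u v. F \<in> N \<Longrightarrow> q * monomial u F v \<in> normal_span"
    and p: "p \<in> normal_span"
  shows "q * p \<in> normal_span"
proof (rule normal_span_mult_left[OF _ p])
  fix F c u v assume F: "F \<in> N"
  have "q * (const c * monomial u F v) = const c * (q * monomial u F v)"
    by (simp only: const_commute[of c q] mult.assoc[symmetric])
  then show "q * (const c * monomial u F v) \<in> normal_span" using normal_span_const[OF q[OF F]] by simp
qed

lemma normal_span_monomial: "F \<in> N \<Longrightarrow> monomial u F v \<in> normal_span"
  using normal_span.monomial[of F 1 u v] by simp

lemma normal_span_genS: "p \<in> normal_span \<Longrightarrow> genS x * p \<in> normal_span"
proof (rule normal_span_mult_leftI)
  fix F u v assume "F \<in> N"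
  then show "genS x * monomial u F v \<in> normal_span"
    using normal_span_monomial[of F "x # u" v] by (simp add: Sw_Cons mult.assoc)
qed

lemma normal_span_expand:
  assumes F: "F \<in> N"
    and e: "\<And>F' y z. F' \<in> N \<Longrightarrow> q * monomial (u @ [y]) F' (v @ [z]) \<in> normal_span"
  shows "q * monomial u F v \<in> normal_span"
proof (rule normal_span.eqv)
  show "q * monomial u F v \<approx>\<^sub>N q * (\<Sum>x\<in>UNIV. \<Sum>y\<in>UNIV. monomial (u @ [y]) ((S_homeo T y)\<inverse> O F O S_homeo T x) (v @ [x]))"
    by (intro eq_mod_mult_left monomial_expand F)
  show "q * (\<Sum>x\<in>UNIV. \<Sum>y\<in>UNIV. monomial (u @ [y]) ((S_homeo T y)\<inverse> O F O S_homeo T x) (v @ [x])) \<in> normal_span"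
    unfolding sum_distrib_left by (intro normal_span_sum e N_step F)
qed

text \<open>Cancelling \<open>S_x^-1\<close> against the left word leaves a projection unless a
  second letter follows, so the left word must have length at least two. Shorter words are prolonged
  by the nucleus relation.\<close>

lemma normal_span_genS': "p \<in> normal_span \<Longrightarrow> genS' x * p \<in> normal_span"
proof (rule normal_span_mult_leftI)
  have two: "genS' x * monomial (y # z # u) F v \<in> normal_span" if F: "F \<in> N" for y z u F v
  proof (cases "x = y \<and> (x, z) \<in> T")
    case True
    then have xz: "(x, z) \<in> T" by blast
    from genS'_genS_genS[of x z] have "genS' x * genS x * genS z \<approx>\<^sub>N genS z" by (simp only: xz if_True)
    then have "genS' x * genS x * genS z * (Sw u * nuc F * Sw' v) \<approx>\<^sub>N genS z * (Sw u * nuc F * Sw' v)"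
      by (rule eq_mod_mult_right)
    then have "genS' x * monomial (y # z # u) F v \<approx>\<^sub>N monomial (z # u) F v"
      using True by (simp add: Sw_Cons mult.assoc)
    then show ?thesis using normal_span_monomial[OF F] normal_span.eqv by blast
  next
    case False
    have "genS' x * genS y * genS z \<approx>\<^sub>N 0"
      using False genS'_genS_genS[of x z] eq_mod_zero_mult(2)[OF genS'_genS_neq[of x y]] by (cases "x = y") auto
    then have "genS' x * genS y * genS z * (Sw u * nuc F * Sw' v) \<approx>\<^sub>N 0"
      by (rule eq_mod_zero_mult(2))
    then have "genS' x * monomial (y # z # u) F v \<approx>\<^sub>N 0"
      by (simp add: Sw_Cons mult.assoc)
    then show ?thesis using normal_span.zero normal_span.eqv by blast
  qed
  fix F u v assume F: "F \<in> N"
  show "genS' x * monomial u F v \<in> normal_span"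
  \<comment> \<open>Two expansions guarantee two letters in the left word, whatever \<open>u\<close>
    is.\<close>
  proof (rule normal_span_expand[OF F], rule normal_span_expand)
    fix F' F'' y z y' z' assume "F'' \<in> N"
    moreover obtain a b w where "(u @ [y]) @ [y'] = a # b # w"
      by (cases u; cases "tl u") auto
    ultimately show "genS' x * monomial ((u @ [y]) @ [y']) F'' ((v @ [z]) @ [z']) \<in> normal_span"
      using two by metis
  qed
qed

text \<open>\<open>F'\<close> is moved through the left word by \<open>nuc_Sw\<close>; what remains
  is a product of two nucleus elements next to each other, which the product relation converts into
  monomials with words longer by \<open>n0\<close>.\<close>

lemma normal_span_nuc: "\<lbrakk>F' \<in> N; p \<in> normal_span\<rbrakk> \<Longrightarrow> nuc F' * p \<in> normal_span"
proof (rule normal_span_mult_leftI)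
  fix F u v assume F': "F' \<in> N" and F: "F \<in> N"
  let ?F = "\<lambda>t. (S_word_homeo T t)\<inverse> O F' O S_word_homeo T u"
  let ?F2 = "\<lambda>t a b. (S_word_homeo T a)\<inverse> O ?F t O F O S_word_homeo T b"
  have "(nuc F' * monomial u F v :: ('x generator, 'k) ncpoly) = nuc F' * Sw u * (nuc F * Sw' v)" by (simp add: mult.assoc)
  also have "\<dots> \<approx>\<^sub>N (\<Sum>t | length t = length u. Sw t * nuc (?F t)) * (nuc F * Sw' v)"
    by (intro eq_mod_mult_right nuc_Sw F')
  also have "\<dots> = (\<Sum>t | length t = length u. Sw t * (nuc (?F t) * nuc F) * Sw' v)"
    by (simp add: sum_distrib_right mult.assoc)
  also have "\<dots> \<approx>\<^sub>N (\<Sum>t | length t = length u. Sw t *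
      (\<Sum>b | length b = n0. \<Sum>a | length a = n0. Sw a * nuc (?F2 t a b) * Sw' b) * Sw' v)"
    by (intro eq_mod_sum eq_mod_mult_right eq_mod_mult_left nuc_product N_word F' F) simp
  also have "\<dots> = (\<Sum>t | length t = length u. \<Sum>b | length b = n0. \<Sum>a | length a = n0.
      monomial (t @ a) (?F2 t a b) (v @ b))"
    by (simp add: sum_distrib_left sum_distrib_right Sw_append Sw'_append mult.assoc)
  finally have *: "nuc F' * monomial u F v \<approx>\<^sub>N \<dots>" .
  moreover have "\<dots> \<in> normal_span"
  proof (intro normal_span_sum normal_span_monomial)
    fix t b a :: "'x list"
    assume "t \<in> {t. length t = length u}" "b \<in> {b. length b = n0}" "a \<in> {a. length a = n0}"
    then show "?F2 t a b \<in> N" using N_prod[OF N_word[of t u F'] F, of a b] F' by simp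
  qed
  ultimately show "nuc F' * monomial u F v \<in> normal_span" using normal_span.eqv by blast
qed

lemma S_word_homeo_last:
  assumes "admissible T v" "v \<noteq> []"
  shows "(S_word_homeo T v)\<inverse> O S_word_homeo T v = (S_homeo T (last v))\<inverse> O S_homeo T (last v)"
  unfolding S_word_homeo_singleton[symmetric] S_word_homeo_domain using assms by (simp add: markov_seqs_conc)

text \<open>Each summand \<open>S_v S_v^-1\<close> of 1 has no nucleus element between its words.
  For a nonempty admissible word the projection of its last letter can be inserted, and for
  \<open>v\<close> of suitable length this projection is an element of the nucleus. Here the
  identification of that element with \<open>S_x^-1 S_x\<close> is indispensable.\<close>

lemma normal_span_one: "1 \<in> normal_span"
proof -
  obtain n where n: "\<And>v. length v = Suc n \<Longrightarrow> (S_word_homeo T v)\<inverse> O S_word_homeo T v \<in> N"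
    using N_unit by blast
  have "(\<Sum>v | length v = Suc n. Sw v * Sw' v) \<in> normal_span"
  proof (rule normal_span_sum)
    fix v :: "'x list" assume "v \<in> {v. length v = Suc n}"
    then have v: "length v = Suc n" "v \<noteq> []" by auto
    show "Sw v * Sw' v \<in> normal_span"
    proof (cases "admissible T v")
      case True
      let ?x = "last v" and ?E = "(S_homeo T (last v))\<inverse> O S_homeo T (last v)"
      have E: "?E \<in> N" using n[OF v(1)] S_word_homeo_last[OF True v(2)] by simp
      have "Sw v * Sw' v \<approx>\<^sub>N Sw v * (genS' ?x * genS ?x) * Sw' v"
        by (intro eq_mod_mult_right eq_mod_sym[OF genS_last] v)
      also have "\<dots> \<approx>\<^sub>N Sw v * nuc ?E * Sw' v"
        by (intro eq_mod_mult_right eq_mod_mult_left eq_mod_sym[OF nuc_domain] E)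
      finally show ?thesis using normal_span_monomial[OF E] normal_span.eqv by blast
    next
      case False
      have "Sw v * Sw' v \<approx>\<^sub>N 0" by (rule eq_mod_zero_mult(2)[OF Sw_inadmissible[OF False]])
      then show ?thesis using normal_span.zero normal_span.eqv by blast
    qed
  qed
  then show ?thesis using eq_mod_sym[OF sum_Sw_Sw'] normal_span.eqv by blast
qed

text \<open>A word is built from the right, beginning with a constant, so stability under left
  multiplication by the generators is all that is needed.\<close>

lemma free_algebra_subset_normal_span:
  assumes p: "p \<in> carrier (free_algebra (generators N))" shows "p \<in> normal_span"
proof -
  have "Poly_Mapping.single (Word ls) c \<in> normal_span" if "set ls \<subseteq> generators N" for ls c
    using that
  proof (induction ls)
    case Nil
    show ?case using normal_span_const[OF normal_span_one, of c] by (simp add: single_Word_Nil)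
  next
    case (Cons a ls)
    then have "Poly_Mapping.single (Word ls) c \<in> normal_span" "a \<in> generators N" by auto
    then show ?case unfolding single_Word_Cons generators_def
      using normal_span_genS normal_span_genS' normal_span_nuc by auto
  qed
  then have "Poly_Mapping.single w c \<in> normal_span" if "set (letters w) \<subseteq> generators N" for w c
    using that by (cases w) auto
  then have "(\<Sum>w\<in>Poly_Mapping.keys p. Poly_Mapping.single w (Poly_Mapping.lookup p w)) \<in> normal_span"
    using p by (intro normal_span_sum) (auto simp: free_algebra_def)
  then show ?thesis using sum_monomials[of p] by simp
qed

text \<open>The pieces \<open>S_t^-1 Q\<close> determine \<open>Q\<close>; summing them formally
  gives an element depending on nothing but \<open>L\<close> and \<open>Q\<close>. The expression is
  used only where these pieces belong to the nucleus.\<close>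

definition collected :: "nat \<Rightarrow> (nat \<Rightarrow> 'x) rel \<Rightarrow> ('x generator, 'k) ncpoly" where
  "collected L Q = (\<Sum>t | length t = L. Sw t * nuc ((S_word_homeo T t)\<inverse> O Q))"

lemma collected_empty: "collected L {} \<approx>\<^sub>N 0"
  unfolding collected_def by (intro eq_mod_sum_zero eq_mod_zero_mult(1)) (simp add: nuc_empty)

text \<open>
  The right-hand side depends on the monomial only through its partial homeomorphism and its
  degree \<open>length u - length v0\<close>. Without isolated points the degree is determined by any germ of
  the homeomorphism, so it can be recovered from the values of the monomial.
\<close>

lemma monomial_Sw:
  assumes F: "F \<in> N" and len: "length v0 < length v"
  shows "monomial u F v0 * Sw v \<approx>\<^sub>N
    collected (length v + length u - length v0) (monomial_homeo u F v0 O S_word_homeo T v)"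
proof (cases "admissible T v \<and> take (length v0) v = v0")
  \<comment> \<open>Both sides vanish: the product in the algebra by orthogonality or
    inadmissibility, and the composed relation because it is empty.\<close>
  case False
  have "Sw' v0 * Sw v \<approx>\<^sub>N 0"
    using False Sw'_Sw_orthogonal[of v0 v] len eq_mod_zero_mult(1)[OF Sw_inadmissible[of v]] by auto
  then have "monomial u F v0 * Sw v \<approx>\<^sub>N 0"
    using eq_mod_zero_mult(1)[of _ "Sw' v0 * Sw v" "Sw u * nuc F"] by (simp add: mult.assoc)
  moreover have "(S_word_homeo T v0)\<inverse> O S_word_homeo T v = {}"
  proof (cases "admissible T v")
    case True
    then have "take (length v0) v \<noteq> v0" using False by simp
    then have "(S_word_homeo T v0)\<inverse> O S_word_homeo T (take (length v0) v) = {}"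
      using len by (intro S_word_homeo_orthogonal) auto
    then have "(S_word_homeo T v0)\<inverse> O S_word_homeo T (take (length v0) v @ drop (length v0) v) = {}"
      unfolding S_word_homeo_append by (metis O_assoc relcomp_empty1)
    then show ?thesis by simp
  qed (simp add: S_word_homeo_inadmissible)
  then have "monomial_homeo u F v0 O S_word_homeo T v = {}" by (simp add: O_assoc)
  ultimately show ?thesis using eq_mod_trans[OF _ eq_mod_sym[OF collected_empty]] by simp
next
  case True
  define v1 where "v1 = drop (length v0) v"
  have v: "v = v0 @ v1" and v1: "v1 \<noteq> []" and adm: "admissible T (v0 @ v1)"
    using True len append_take_drop_id[of "length v0" v] by (auto simp: v1_def)
  have L: "length v + length u - length v0 = length u + length v1" by (simp add: v)
  have Q: "monomial_homeo u F v0 O S_word_homeo T v = S_word_homeo T u O F O S_word_homeo T v1"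
    using S_word_homeo_cancel[OF adm v1] by (simp add: O_assoc v)
  let ?F = "\<lambda>b. (S_word_homeo T b)\<inverse> O F O S_word_homeo T v1"
  let ?G = "\<lambda>a b. (S_word_homeo T (a @ b))\<inverse> O S_word_homeo T u O F O S_word_homeo T v1"
  have "(monomial u F v0 * Sw v :: ('x generator, 'k) ncpoly) = Sw u * nuc F * (Sw' v0 * Sw (v0 @ v1))" by (simp add: v mult.assoc)
  also have "\<dots> \<approx>\<^sub>N Sw u * nuc F * Sw v1"
    by (intro eq_mod_mult_left Sw'_Sw_cancel adm v1)
  also have "\<dots> = Sw u * (nuc F * Sw v1)" by (simp add: mult.assoc)
  also have "\<dots> \<approx>\<^sub>N Sw u * (\<Sum>b | length b = length v1. Sw b * nuc (?F b))"
    by (intro eq_mod_mult_left nuc_Sw F)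
  also have "\<dots> = (\<Sum>b | length b = length v1. Sw (u @ b) * nuc (?F b))"
    by (simp add: sum_distrib_left Sw_append mult.assoc)
  \<comment> \<open>For admissible \<open>u @ b\<close> the two relations coincide by cancelling
    \<open>S_u\<close>; otherwise \<open>Sw (u @ b)\<close> annihilates both terms.\<close>
  also have "\<dots> \<approx>\<^sub>N (\<Sum>b | length b = length v1. Sw (u @ b) * nuc (?G u b))"
  proof (rule eq_mod_sum)
    fix b :: "'x list" assume "b \<in> {b. length b = length v1}"
    then have b: "b \<noteq> []" using v1 by auto
    show "Sw (u @ b) * nuc (?F b) \<approx>\<^sub>N Sw (u @ b) * nuc (?G u b)"
    proof (cases "admissible T (u @ b)")
      case True
      have "(S_word_homeo T (u @ b))\<inverse> O S_word_homeo T u = (S_word_homeo T b)\<inverse>"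
        using S_word_homeo_cancel[OF True b] by (metis converse_relcomp converse_converse)
      then have "?G u b = ?F b" by (metis O_assoc)
      then show ?thesis by simp
    next
      case False
      then show ?thesis
        using eq_mod_trans[OF eq_mod_zero_mult(2) eq_mod_sym[OF eq_mod_zero_mult(2)]] Sw_inadmissible
        by blast
    qed
  qed
  \<comment> \<open>Words beginning with some \<open>a\<close> other than \<open>u\<close>
    contribute sections of the empty map. Admitting them removes the last explicit trace of
    \<open>u\<close> from the expression.\<close>
  also have "\<dots> \<approx>\<^sub>N (\<Sum>a | length a = length u. \<Sum>b | length b = length v1. Sw (a @ b) * nuc (?G a b))"
  proof (rule eq_mod_sym, rule eq_mod_sum_single)
    fix a :: "'x list" assume a: "a \<in> {a. length a = length u}" "a \<noteq> u"
    have "(S_word_homeo T a)\<inverse> O S_word_homeo T u = {}"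
      using a by (intro S_word_homeo_orthogonal) auto
    moreover have "?G a b = (S_word_homeo T b)\<inverse> O ((S_word_homeo T a)\<inverse> O S_word_homeo T u) O F O S_word_homeo T v1" for b
      by (simp add: S_word_homeo_append converse_relcomp O_assoc)
    ultimately have "?G a b = {}" for b by simp
    then have "nuc (?G a b) \<approx>\<^sub>N 0" for b using nuc_empty by simp
    then show "(\<Sum>b | length b = length v1. Sw (a @ b) * nuc (?G a b)) \<approx>\<^sub>N 0"
      by (intro eq_mod_sum_zero eq_mod_zero_mult(1))
  qed (simp_all add: finite_words)
  also have "\<dots> = collected (length u + length v1) (S_word_homeo T u O F O S_word_homeo T v1)"
    unfolding collected_def sum_words_append ..
  finally show ?thesis unfolding L Q .
qed

end

section \<open>The nucleus\<close>

locale nucleus_groupoid =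
  fixes T :: "'x::finite rel" and G :: "(nat \<Rightarrow> 'x, 'g) groupoid"
    and N :: "(nat \<Rightarrow> 'x) rel set" and n0 :: nat and K :: "'k::field itself"
  assumes etale: "etale_groupoid G"
    and Obj_G: "Obj G = markov_space T"
    and nucleus: "is_nucleus T G N"
    and nucleus_prod: "\<lbrakk>F1 \<in> N; F2 \<in> N; length u = n0; length v = n0\<rbrakk>
           \<Longrightarrow> (S_word_homeo T u)\<inverse> O F1 O F2 O S_word_homeo T v \<in> N"
    and no_isolated_points: "w \<in> markov_seqs T \<Longrightarrow> \<not> openin (markov_space T) {w}"
begin

lemma attracting_N: "attracting T G N"
  using nucleus by (simp add: is_nucleus_def)

lemma finite_N: "finite N"
  using attracting_N by (simp add: attracting_def)

lemma N_cob: "F \<in> N \<Longrightarrow> F \<in> cob_homeos G"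
  using attracting_N by (auto simp: attracting_def)

lemma N_attracts:
  assumes "F \<in> cob_homeos G"
  shows "\<forall>\<^sub>F m in sequentially. \<forall>v1 v2. length v1 = m \<and> length v2 = m \<longrightarrow>
       (S_word_homeo T v1)\<inverse> O F O S_word_homeo T v2 \<in> N"
  using attracting_N assms unfolding attracting_def eventually_sequentially by blast

text \<open>Minimality of \<open>N\<close> enters here. An element of \<open>N\<close> is a section
  of one fixed bisection at arbitrarily deep levels, not just at some level; this is what puts the
  sections of an element of \<open>N\<close> into \<open>N\<close> again.\<close>

lemma N_recurrent:
  assumes "F \<in> N"
  obtains F0 where "F0 \<in> cob_homeos G"
    "\<exists>\<^sub>F m in sequentially. \<exists>v1 v2. length v1 = m \<and> length v2 = m \<and>
       F = (S_word_homeo T v1)\<inverse> O F0 O S_word_homeo T v2"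
proof -
  let ?P = "\<lambda>F F0 m. \<exists>v1 v2. length v1 = m \<and> length v2 = m \<and>
       F = (S_word_homeo T v1)\<inverse> O F0 O S_word_homeo T v2"
  \<comment> \<open>The recurring elements form an attracting set, to which the minimality of \<open>N\<close> applies.\<close>
  define M where "M = {F \<in> N. \<exists>F0\<in>cob_homeos G. \<exists>\<^sub>F m in sequentially. ?P F F0 m}"
  have "attracting T G M"
    unfolding attracting_def
  proof (intro conjI ballI)
    show "finite M" "M \<subseteq> cob_homeos G" using finite_N N_cob by (auto simp: M_def)
    fix F0 assume F0: "F0 \<in> cob_homeos G"
    have "\<forall>F\<in>N - M. \<forall>\<^sub>F m in sequentially. \<not> ?P F F0 m"
      using F0 unfolding M_def frequently_def by blast
    then have "\<forall>\<^sub>F m in sequentially. \<forall>F\<in>N - M. \<not> ?P F F0 m"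
      using finite_N by (intro eventually_ball_finite) auto
    with N_attracts[OF F0]
    have "\<forall>\<^sub>F m in sequentially. \<forall>v1 v2. length v1 = m \<and> length v2 = m \<longrightarrow>
       (S_word_homeo T v1)\<inverse> O F0 O S_word_homeo T v2 \<in> M"
    proof eventually_elim
      case (elim m)
      then show ?case by (intro allI impI) (metis (no_types, lifting) DiffI)
    qed
    then show "\<exists>n. \<forall>m\<ge>n. \<forall>v1 v2. length v1 = m \<and> length v2 = m \<longrightarrow>
       (S_word_homeo T v1)\<inverse> O F0 O S_word_homeo T v2 \<in> M"
      unfolding eventually_sequentially .
  qed
  then have "F \<in> M" using nucleus assms by (auto simp: is_nucleus_def)
  then show ?thesis using that unfolding M_def by blast
qed

sublocale nucleus_relations T N n0 K
proof
  show "F \<subseteq> markov_seqs T \<times> markov_seqs T" if "F \<in> N" for F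
    using partial_homeo_subset[OF etale_groupoid.cob_homeos_properties(1)[OF etale N_cob[OF that]]]
    by (simp add: Obj_G)
  show "{} \<in> N"
  proof -
    have "{} \<in> cob_homeos G" by (rule etale_groupoid.empty_in_cob_homeos[OF etale])
    from N_attracts[OF this] obtain m where m: "\<And>v1 v2. length v1 = m \<Longrightarrow> length v2 = m \<Longrightarrow>
       (S_word_homeo T v1)\<inverse> O {} O S_word_homeo T v2 \<in> N"
      unfolding eventually_sequentially by blast
    show ?thesis using m[of "replicate m undefined" "replicate m undefined"] by simp
  qed
  show "(S_homeo T y)\<inverse> O F O S_homeo T x \<in> N" if F: "F \<in> N" for F x y
  proof -
    obtain F0 where F0: "F0 \<in> cob_homeos G"
      and fr: "\<exists>\<^sub>F m in sequentially. \<exists>v1 v2. length v1 = m \<and> length v2 = m \<and>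
       F = (S_word_homeo T v1)\<inverse> O F0 O S_word_homeo T v2" by (rule N_recurrent[OF F])
    obtain n where n: "\<And>m v1 v2. \<lbrakk>m \<ge> n; length v1 = m; length v2 = m\<rbrakk> \<Longrightarrow>
       (S_word_homeo T v1)\<inverse> O F0 O S_word_homeo T v2 \<in> N"
      using N_attracts[OF F0] unfolding eventually_sequentially by blast
    \<comment> \<open>\<open>F\<close> is a section of \<open>F0\<close> at a level where all
      sections already lie in \<open>N\<close>; its own sections are sections of \<open>F0\<close>
      one level deeper.\<close>
    obtain m v1 v2 where m: "m \<ge> n" "length v1 = m" "length v2 = m"
       "F = (S_word_homeo T v1)\<inverse> O F0 O S_word_homeo T v2"
      using fr[unfolded frequently_sequentially, rule_format, of n] by (elim exE conjE) (rule that)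
    have "(S_homeo T y)\<inverse> O F O S_homeo T x =
        (S_word_homeo T (v1 @ [y]))\<inverse> O F0 O S_word_homeo T (v2 @ [x])"
      unfolding S_word_homeo_append S_word_homeo_singleton m(4) by (simp add: converse_relcomp O_assoc)
    then show ?thesis using n[of "Suc m" "v1 @ [y]" "v2 @ [x]"] m by simp
  qed
  show "(S_word_homeo T u)\<inverse> O F1 O F2 O S_word_homeo T v \<in> N"
    if "F1 \<in> N" "F2 \<in> N" "length u = n0" "length v = n0" for F1 F2 u v
    using nucleus_prod that .
  show "\<exists>n. \<forall>v. length v = Suc n \<longrightarrow> (S_word_homeo T v)\<inverse> O S_word_homeo T v \<in> N"
  proof -
    have "Id_on (markov_seqs T) \<in> cob_homeos G"
      using etale_groupoid.Id_in_cob_homeos[OF etale] compact_space_markov[of T] by (simp add: Obj_G)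
    from N_attracts[OF this] obtain n where n: "\<And>m v1 v2. \<lbrakk>m \<ge> n; length v1 = m; length v2 = m\<rbrakk> \<Longrightarrow>
       (S_word_homeo T v1)\<inverse> O Id_on (markov_seqs T) O S_word_homeo T v2 \<in> N"
      unfolding eventually_sequentially by blast
    have "Id_on (markov_seqs T) O S_word_homeo T v = S_word_homeo T v" for v
      by (auto simp: relcomp_unfold Id_on_iff mem_S_word_homeo)
    then show ?thesis using n[of "Suc n"] by (intro exI[of _ n]) auto
  qed
qed

abbreviation Y where "Y \<equiv> markov_space T"

abbreviation G_germs :: "(nat \<Rightarrow> 'x) germ set" where
  "G_germs \<equiv> arrow_germ G ` arrows G"

lemma clopen_homeo_N: "F \<in> N \<Longrightarrow> clopen_homeo T F"
  using clopen_homeo_cob[OF etale Obj_G N_cob] .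

lemma partial_homeo_N: "F \<in> N \<Longrightarrow> partial_homeo Y F"
  using clopen_homeo_N by (simp add: clopen_homeo_def)

lemma partial_homeo_S_word: "partial_homeo Y (S_word_homeo T u)"
  using clopen_homeo_S_word[of T u] by (simp add: clopen_homeo_def)

lemma partial_homeo_S: "partial_homeo Y (S_homeo T x)"
  using partial_homeo_S_word[of "[x]"] by (simp add: S_word_homeo_singleton)

lemma germs_of_N: "F \<in> N \<Longrightarrow> germs_of Y F \<subseteq> G_germs"
  using etale_groupoid.cob_homeos_properties(4)[OF etale N_cob] by (simp add: Obj_G)

text \<open>Source and target of an arrow can be read off its germ, so composable germs come from
  composable arrows.\<close>

lemma G_germs_relcomp:
  assumes R: "partial_homeo Y R" "(z, y) \<in> R" "germ Y R y \<in> G_germs"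
    and Q: "partial_homeo Y Q" "(y, x) \<in> Q" "germ Y Q x \<in> G_germs"
  shows "germ Y (R O Q) x \<in> G_germs"
proof -
  obtain g where g: "g \<in> arrows G" "germ Y R y = arrow_germ G g" using R(3) by blast
  obtain h where h: "h \<in> arrows G" "germ Y Q x = arrow_germ G h" using Q(3) by blast
  obtain V where V: "open_bisection G V" "h \<in> V"
    using etale_groupoid.open_bisection_ex[OF etale h(1)] .
  have *: "(tgt G h, src G h) \<in> bis_homeo G V" using V(2) by (simp add: bis_homeo_def)
  have "fst (arrow_germ G g) = y" "tgt (germ_groupoid Y) (arrow_germ G h) = y"
    using g(2) h(2) tgt_germ[OF Q(1,2)] by (metis fst_germ)+
  then have "src G g = tgt G h"
    using tgt_germ[OF etale_groupoid.partial_homeo_bis_homeo[OF etale V(1)] *]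
      etale_groupoid.arrow_germ_eq[OF etale V]
    by (simp add: arrow_germ_def Obj_G)
  then have "gmult (germ_groupoid Y) (germ Y R y) (germ Y Q x) = arrow_germ G (gmult G g h)"
    using etale_groupoid.gmult_arrow_germ[OF etale g(1) h(1)] g(2) h(2) by (simp add: Obj_G)
  moreover have "gmult G g h \<in> arrows G"
    using etale g(1) h(1) \<open>src G g = tgt G h\<close> groupoid.gmult_closed[of G]
    by (simp add: etale_groupoid_def topological_groupoid_def)
  ultimately show ?thesis using gmult_germ[OF R(1,2) Q(1,2)] by simp
qed

lemma G_germs_converse:
  assumes R: "partial_homeo Y R" "(y, x) \<in> R" "germ Y R x \<in> G_germs"
  shows "germ Y (R\<inverse>) y \<in> G_germs"
proof -
  obtain g where g: "g \<in> arrows G" "germ Y R x = arrow_germ G g" using R(3) by blast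
  then have "germ Y (R\<inverse>) y = arrow_germ G (ginv G g)"
    using ginv_germ[OF R(1,2)] etale_groupoid.ginv_arrow_germ[OF etale g(1)] by (simp add: Obj_G)
  moreover have "ginv G g \<in> arrows G"
    using etale g(1) groupoid.ginv_closed[of G]
    by (simp add: etale_groupoid_def topological_groupoid_def)
  ultimately show ?thesis by simp
qed

lemma G_germs_Id:
  assumes "x \<in> markov_seqs T" shows "germ Y (Id_on (markov_seqs T)) x \<in> G_germs"
  using etale_groupoid.germ_Id_eq_arrow_germ[OF etale, of x] assms etale groupoid.unt_closed[of G x]
  by (simp add: Obj_G etale_groupoid_def topological_groupoid_def)

lemma G_germ_cob:
  assumes "\<gamma> \<in> G_germs"
  obtains F y where "F \<in> cob_homeos G" "(y, fst \<gamma>) \<in> F" "\<gamma> = germ Y F (fst \<gamma>)"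
proof -
  obtain g where g: "g \<in> arrows G" "\<gamma> = arrow_germ G g" using assms by blast
  have zd: "\<exists>C. openin (Obj G) C \<and> compactin (Obj G) C \<and> x \<in> C \<and> C \<subseteq> V"
    if "openin (Obj G) V" "x \<in> V" for V x
    using markov_zero_dim that unfolding Obj_G by blast
  obtain F where F: "F \<in> cob_homeos G" "(tgt G g, src G g) \<in> F" "arrow_germ G g = germ Y F (src G g)"
    by (rule etale_groupoid.cob_homeo_of_arrow[OF etale zd g(1)]) (simp_all add: Obj_G)
  moreover have "fst \<gamma> = src G g" using F(3) g(2) by simp
  ultimately show ?thesis using that g(2) by simp
qed

subsection \<open>Germs of the shift do not belong to the groupoid\<close>

text \<open>The image of \<open>S_q\<close> is contained in the cylinder of \<open>q\<close>, so a
  composition with \<open>S_q\<close> on the right sees a relation only on that cylinder. This is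
  how agreement near a point becomes an equality of relations.\<close>

lemma relcomp_S_word_cong:
  assumes "\<And>z y. z \<in> V \<Longrightarrow> (y, z) \<in> R \<longleftrightarrow> (y, z) \<in> R'" "cylinder T q \<subseteq> V"
  shows "R O S_word_homeo T q = R' O S_word_homeo T q"
proof -
  have "z \<in> V" if "(z, w) \<in> S_word_homeo T q" for z w
    using that assms(2) by (auto simp: mem_S_word_homeo cylinder_def)
  then show ?thesis using assms(1) by blast
qed

text \<open>A bisection with the germ of \<open>S_e\<close> at \<open>x\<close> acts as
  \<open>S_e\<close> on a cylinder around \<open>x\<close>. Its sections along \<open>x\<close> are
  therefore maps \<open>S_e'\<close> with \<open>e'\<close> of the same length as \<open>e\<close>,
  and deep sections belong to the nucleus.\<close>

lemma germ_S_word_in_nucleus: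
  assumes e: "e \<noteq> []" "e \<frown> x \<in> markov_seqs T" and germ: "germ Y (S_word_homeo T e) x \<in> G_germs"
  shows "\<forall>\<^sub>F m in sequentially. S_word_homeo T (drop m (e @ prefix m x)) \<in> N"
proof -
  have ex: "(e \<frown> x, x) \<in> S_word_homeo T e" using e(2) by (simp add: mem_S_word_homeo)
  obtain F y where F: "F \<in> cob_homeos G" "(y, x) \<in> F" "germ Y (S_word_homeo T e) x = germ Y F x"
    using G_germ_cob[OF germ] by (metis fst_germ)
  have pF: "partial_homeo Y F" using clopen_homeo_cob[OF etale Obj_G F(1)] by (simp add: clopen_homeo_def)
  have "agree Y x F (S_word_homeo T e)"
    using germ_eq_iff[OF partial_homeo_S_word _ pF, of x e x] F ex by (metis RangeI agree_sym)
  then obtain V where V: "openin Y V" "x \<in> V" "\<And>z y. z \<in> V \<Longrightarrow> (y, z) \<in> F \<longleftrightarrow> (y, z) \<in> S_word_homeo T e"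
    unfolding agree_def by metis
  obtain m0 where m0: "\<And>m. m \<ge> m0 \<Longrightarrow> cylinder T (prefix m x) \<subseteq> V"
    using openin_markovE[OF V(1,2)] by blast
  have "\<forall>\<^sub>F m in sequentially. m \<ge> m0" by (rule eventually_ge_at_top)
  with N_attracts[OF F(1)] show ?thesis
  proof eventually_elim
    case (elim m)
    \<comment> \<open>Both words of a section must have length \<open>m\<close>, so the word
      \<open>e @ q\<close> is cut after \<open>m\<close> letters rather than after
      \<open>e\<close>.\<close>
    define q p e' where "q = prefix m x" and "p = take m (e @ q)" and "e' = drop m (e @ q)"
    have pe': "e @ q = p @ e'" unfolding p_def e'_def by (rule append_take_drop_id[symmetric])
    have len: "length p = m" "length q = m" by (simp_all add: p_def q_def)
    have "length e' = length e" by (simp add: e'_def q_def)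
    then have e': "e' \<noteq> []" using e(1) by auto
    have "(e @ q) \<frown> suffix m x = e \<frown> (q \<frown> suffix m x)" by (rule conc_conc[symmetric])
    also have "q \<frown> suffix m x = x" unfolding q_def by (rule prefix_suffix[symmetric])
    finally have "(e @ q) \<frown> suffix m x \<in> markov_seqs T" using e(2) by metis
    then have adm: "admissible T (p @ e')" unfolding pe' by (simp only: markov_seqs_conc)
    have "(S_word_homeo T p)\<inverse> O F O S_word_homeo T q \<in> N" using elim(1) len by blast
    moreover have "F O S_word_homeo T q = S_word_homeo T e O S_word_homeo T q"
      by (rule relcomp_S_word_cong[OF V(3)]) (use m0 elim(2) in \<open>auto simp: q_def\<close>)
    ultimately have "(S_word_homeo T p)\<inverse> O S_word_homeo T (p @ e') \<in> N"
      by (simp only: pe'[symmetric] S_word_homeo_append)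
    then show ?case using S_word_homeo_cancel[OF adm e'] by (simp add: e'_def q_def)
  qed
qed

text \<open>A sequence \<open>y\<close> in the domain satisfies
  \<open>e \<frown> y = e' \<frown> y\<close>. Comparing entries at position
  \<open>length e + n\<close> expresses entry \<open>n\<close> of \<open>y\<close> by a letter of
  \<open>e'\<close> or by an earlier entry, so \<open>y\<close> is unique. The domain being open,
  this point would be isolated.\<close>

lemma S_word_homeo_eq_imp_empty:
  assumes eq: "S_word_homeo T e = S_word_homeo T e'" and len: "length e < length e'"
  shows "S_word_homeo T e = {}"
proof (rule ccontr)
  assume "S_word_homeo T e \<noteq> {}"
  then obtain w where w: "w \<in> Range (S_word_homeo T e)" by fast
  have fix_eq: "e \<frown> y = e' \<frown> y" if "y \<in> Range (S_word_homeo T e)" for y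
  proof -
    have "(e \<frown> y, y) \<in> S_word_homeo T e" using that by (auto simp: mem_S_word_homeo)
    then show ?thesis unfolding eq by (simp add: mem_S_word_homeo)
  qed
  have "y n = w n" if "y \<in> Range (S_word_homeo T e)" for y n
  proof (induction n rule: less_induct)
    case (less n)
    have rec: "z n = (if length e + n < length e' then e' ! (length e + n) else z (length e + n - length e'))"
      if "z \<in> Range (S_word_homeo T e)" for z
      using fun_cong[OF fix_eq[OF that], of "length e + n"] by (simp add: conc_def split: if_splits)
    show ?case
    proof (cases "length e + n < length e'")
      case True
      then show ?thesis using rec[OF that] rec[OF w] by simp
    next
      case False
      then have "length e + n - length e' < n" using len by simp
      then show ?thesis using rec[OF that] rec[OF w] less False by simp
    qed
  qed
  then have "Range (S_word_homeo T e) = {w}" using w by auto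
  then have "openin Y {w}" using partial_homeo_open_Range(1)[OF partial_homeo_S_word[of e]] by simp
  moreover have "w \<in> markov_seqs T" using w by (auto simp: mem_S_word_homeo markov_seqs_conc)
  ultimately show False using no_isolated_points by blast
qed

text \<open>
  If the germ of a nonempty word belonged to the groupoid, then so would the germs of words
  of unboundedly many lengths, and all of them would be absorbed by the finite nucleus.
\<close>

lemma germ_S_word_notin_G_germs:
  assumes e: "e \<noteq> []" "e \<frown> x \<in> markov_seqs T"
  shows "germ Y (S_word_homeo T e) x \<notin> G_germs"
proof
  assume germ: "germ Y (S_word_homeo T e) x \<in> G_germs"
  define k where "k = length e"
  have k: "k > 0" using e(1) by (simp add: k_def)
  have x: "x \<in> markov_seqs T" using e(2) by (simp add: markov_seqs_conc)
  obtain s where s: "\<And>m. m \<ge> s \<Longrightarrow> S_word_homeo T (drop m (e @ prefix m x)) \<in> N"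
    using germ_S_word_in_nucleus[OF e germ] unfolding eventually_sequentially by blast
  define s' where "s' = s + k"
  \<comment> \<open>Cutting \<open>m + k\<close> letters off \<open>e @ prefix (m + k) x\<close>
    removes \<open>e\<close> and leaves the window of length \<open>k\<close> of \<open>x\<close>
    that begins at \<open>m\<close>.\<close>
  have block: "S_word_homeo T (x [m \<rightarrow> m + k]) \<in> N" if "m \<ge> s'" for m
  proof -
    have "drop (m + k) (e @ prefix (m + k) x) = x [m \<rightarrow> m + k]" by (simp add: k_def)
    then show ?thesis using s[of "m + k"] that by (simp add: s'_def)
  qed
  have mem: "x [a \<rightarrow> b] \<frown> suffix b x = suffix a x" if "a \<le> b" for a b
    using that prefix_suffix[of "suffix a x" "b - a"] by (simp add: subsequence_prefix_suffix)
  have ph_mem: "(suffix a x, suffix b x) \<in> S_word_homeo T (x [a \<rightarrow> b])" if "a \<le> b" for a b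
    using mem[OF that] markov_seqs_suffix[OF x] by (simp add: mem_S_word_homeo)
  \<comment> \<open>Consecutive windows of \<open>x\<close> are composable, and each has its germ in
    the groupoid; composing \<open>j\<close> of them produces a word of length
    \<open>j * k\<close>.\<close>
  have germs: "germ Y (S_word_homeo T (x [s' \<rightarrow> s' + j * k])) (suffix (s' + j * k) x) \<in> G_germs" for j
  proof (induction j)
    case 0
    have "S_word_homeo T (x [s' \<rightarrow> s' + 0 * k]) = Id_on (markov_seqs T)" by (simp add: S_word_homeo_def)
    then show ?case using G_germs_Id[OF markov_seqs_suffix[OF x, of s']]
      by (simp only: mult_0 add_0_right)
  next
    case (Suc j)
    let ?a = "s' + j * k" and ?b = "s' + Suc j * k"
    have b: "?b = ?a + k" by simp
    have "germ Y (S_word_homeo T (x [?a \<rightarrow> ?b])) (suffix ?b x) \<in> G_germs"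
      using subsetD[OF germs_of_N[OF block[of ?a]] germs_ofI[OF ph_mem[of ?a "?a + k"]]] unfolding b by simp
    then have "germ Y (S_word_homeo T (x [s' \<rightarrow> ?a]) O S_word_homeo T (x [?a \<rightarrow> ?b])) (suffix ?b x) \<in> G_germs"
      by (intro G_germs_relcomp[OF partial_homeo_S_word ph_mem Suc partial_homeo_S_word ph_mem]) auto
    moreover have "x [s' \<rightarrow> ?a] @ x [?a \<rightarrow> ?b] = x [s' \<rightarrow> ?b]"
      unfolding subsequence_def b map_append[symmetric]
      by (rule arg_cong[where f = "map x"], rule upt_add_eq_append[symmetric]) simp
    ultimately show ?case by (simp only: S_word_homeo_append[symmetric])
  qed
  have "\<exists>e. length e = j * k \<and> S_word_homeo T e \<in> N \<and> S_word_homeo T e \<noteq> {}" if "j > 0" for j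
  proof -
    let ?e = "x [s' \<rightarrow> s' + j * k]" and ?x = "suffix (s' + j * k) x"
    have e': "?e \<noteq> []" "?e \<frown> ?x \<in> markov_seqs T"
      using that k mem[of s' "s' + j * k"] markov_seqs_suffix[OF x] by simp_all
    obtain m where m: "S_word_homeo T (drop m (?e @ prefix m ?x)) \<in> N"
      using germ_S_word_in_nucleus[OF e' germs] unfolding eventually_sequentially by blast
    have "drop m (?e @ prefix m ?x) \<frown> suffix m ?x = suffix m (?e \<frown> ?x)"
    proof -
      have "(?e @ prefix m ?x) \<frown> suffix m ?x = ?e \<frown> (prefix m ?x \<frown> suffix m ?x)" by (rule conc_conc[symmetric])
      also have "prefix m ?x \<frown> suffix m ?x = ?x" by (rule prefix_suffix[symmetric])
      finally have "(?e @ prefix m ?x) \<frown> suffix m ?x = ?e \<frown> ?x" .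
      then have "take m (?e @ prefix m ?x) \<frown> (drop m (?e @ prefix m ?x) \<frown> suffix m ?x) = ?e \<frown> ?x"
        by (simp only: conc_conc append_take_drop_id)
      moreover have "length (take m (?e @ prefix m ?x)) = m" by simp
      ultimately show ?thesis by (metis suffix_conc_length)
    qed
    then have "(suffix m (?e \<frown> ?x), suffix m ?x) \<in> S_word_homeo T (drop m (?e @ prefix m ?x))"
      using markov_seqs_suffix[OF e'(2), of m] by (simp only: mem_S_word_homeo)
    moreover have "length (drop m (?e @ prefix m ?x)) = j * k" by simp
    ultimately show ?thesis using m by blast
  qed
  then obtain f where f: "\<And>j. j > 0 \<Longrightarrow> length (f j) = j * k \<and> S_word_homeo T (f j) \<in> N \<and> S_word_homeo T (f j) \<noteq> {}"
    by metis
  \<comment> \<open>The words \<open>f j\<close> have pairwise different lengths while their maps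
    lie in a finite set, so two of these maps must coincide.\<close>
  have "(\<lambda>j. S_word_homeo T (f j)) ` {0<..} \<subseteq> N" using f by auto
  then have "finite ((\<lambda>j. S_word_homeo T (f j)) ` {0<..})" using finite_N finite_subset by blast
  then have "\<not> inj_on (\<lambda>j. S_word_homeo T (f j)) {0<..}"
    using finite_imageD infinite_Ioi by blast
  then obtain i j where ij: "i > 0" "j > 0" "i \<noteq> j" "S_word_homeo T (f i) = S_word_homeo T (f j)"
    unfolding inj_on_def by auto
  then have "length (f i) \<noteq> length (f j)" using f k by simp
  then have "S_word_homeo T (f i) = {}"
    using S_word_homeo_eq_imp_empty[OF ij(4)] S_word_homeo_eq_imp_empty[OF ij(4)[symmetric]] ij(4)
    by (metis linorder_neqE_nat)
  then show False using f ij by blast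
qed

section \<open>The degree of a monomial\<close>

lemma partial_homeo_monomial: "F \<in> N \<Longrightarrow> partial_homeo Y (monomial_homeo u F v)"
  by (intro partial_homeo_relcomp partial_homeo_converse partial_homeo_S_word partial_homeo_N)

lemma clopen_homeo_monomial: "F \<in> N \<Longrightarrow> clopen_homeo T (monomial_homeo u F v)"
  by (intro clopen_homeo_relcomp clopen_homeo_converse clopen_homeo_S_word clopen_homeo_N)

lemma mem_monomial_homeo:
  "(z, w) \<in> monomial_homeo u F v \<longleftrightarrow>
    (\<exists>t s. (t, s) \<in> F \<and> z = u \<frown> t \<and> w = v \<frown> s \<and> z \<in> markov_seqs T \<and> w \<in> markov_seqs T)"
  by (auto simp: relcomp_unfold mem_S_word_homeo)

text \<open>If \<open>u'\<close> were longer, then \<open>u' = u @ a\<close>. Multiplying by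
  \<open>S_u^-1\<close> on the left and \<open>S_v F'^-1\<close> on the right reduces the first
  monomial to a part of \<open>F O F'\<inverse>\<close> and the second to a part of
  \<open>S_a\<close>. These would share a germ, so the germ of the nonempty word \<open>a\<close>
  would lie in the groupoid.\<close>

lemma agree_monomials_length_le:
  assumes F: "F \<in> N" "F' \<in> N" and ag: "agree Y w (monomial_homeo u F v) (monomial_homeo u' F' v)"
    and zw: "(z, w) \<in> monomial_homeo u F v"
  shows "length u' \<le> length u"
proof (rule ccontr)
  assume "\<not> length u' \<le> length u"
  then have len: "length u < length u'" by simp
  obtain t s where ts: "(t, s) \<in> F" "z = u \<frown> t" "w = v \<frown> s" "z \<in> markov_seqs T" "w \<in> markov_seqs T"
    using zw unfolding mem_monomial_homeo by blast
  have "(z, w) \<in> monomial_homeo u' F' v" using agreeD[OF ag] zw by blast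
  then obtain t' where t': "(t', s) \<in> F'" "z = u' \<frown> t'"
    unfolding mem_monomial_homeo using ts(3) by auto
  define a where "a = drop (length u) u'"
  have "take (length u) u' = u"
  proof -
    have "prefix (length u) z = u" using ts(2) by simp
    moreover have "prefix (length u) z = take (length u) u'" using t'(2) len by simp
    ultimately show ?thesis by simp
  qed
  then have u': "u' = u @ a" by (metis a_def append_take_drop_id)
  have a: "a \<noteq> []" using len by (simp add: a_def)
  have ta: "t = a \<frown> t'"
  proof -
    have "u \<frown> t = u \<frown> (a \<frown> t')" using ts(2) t'(2) u' by simp
    then show ?thesis by (simp only: same_concat_eq)
  qed
  have tM: "t \<in> markov_seqs T" using ts(2,4) by (simp add: markov_seqs_conc)
  have at': "(t, t') \<in> S_word_homeo T a" using tM ta by (simp add: mem_S_word_homeo)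
  let ?L = "\<lambda>R. (S_word_homeo T u)\<inverse> O R O S_word_homeo T v O F'\<inverse>"
  have mu: "(t, z) \<in> (S_word_homeo T u)\<inverse>" and mv: "(w, s) \<in> S_word_homeo T v" and ms: "(s, t') \<in> F'\<inverse>"
    using ts t' by (simp_all add: mem_S_word_homeo)
  have ph: "partial_homeo Y (S_word_homeo T v O F'\<inverse>)"
    by (intro partial_homeo_relcomp partial_homeo_converse partial_homeo_S_word partial_homeo_N F)
  have phL: "partial_homeo Y (?L (monomial_homeo u F v))" "partial_homeo Y (?L (monomial_homeo u' F' v))"
    by (intro partial_homeo_relcomp partial_homeo_converse partial_homeo_S_word partial_homeo_N F)+
  have t'M: "t' \<in> topspace Y" using tM ta by (simp add: markov_seqs_conc)
  have zM: "z \<in> topspace Y" using ts by simp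
  have w_t': "(w, t') \<in> S_word_homeo T v O F'\<inverse>" using mv ms by blast
  have "agree Y t' (monomial_homeo u F v O (S_word_homeo T v O F'\<inverse>)) (monomial_homeo u' F' v O (S_word_homeo T v O F'\<inverse>))"
    by (rule agree_relcomp[OF agree_refl[OF t'M] ag w_t' ph])
  moreover have "(z, t') \<in> monomial_homeo u F v O (S_word_homeo T v O F'\<inverse>)" using zw w_t' by blast
  ultimately have ag': "agree Y t' (?L (monomial_homeo u F v)) (?L (monomial_homeo u' F' v))"
    using agree_relcomp[OF _ agree_refl[OF zM]] partial_homeo_relcomp[OF partial_homeo_monomial[OF F(1)] ph] by blast
  have tL: "(t, t') \<in> ?L (monomial_homeo u F v)" using mu zw w_t' by blast
  then have tL': "(t, t') \<in> ?L (monomial_homeo u' F' v)" using agreeD[OF ag'] by blast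
  have sub: "?L (monomial_homeo u F v) \<subseteq> F O F'\<inverse>"
    by (auto simp: relcomp_unfold mem_S_word_homeo)
  have sub': "?L (monomial_homeo u' F' v) \<subseteq> S_word_homeo T a"
  proof
    fix p assume "p \<in> ?L (monomial_homeo u' F' v)"
    then obtain y y' s1 r1 r2 where p: "p = (y, y')" "(r1, s1) \<in> F'" "(y', s1) \<in> F'"
      "u \<frown> y = u' \<frown> r1" "u \<frown> y \<in> markov_seqs T"
      by (auto simp: relcomp_unfold mem_S_word_homeo)
    have "r1 = y'" using partial_homeo_value_unique[OF partial_homeo_N[OF F(2)] p(2,3)] .
    moreover have "u \<frown> y = u \<frown> (a \<frown> r1)" using p(4) u' by simp
    then have "y = a \<frown> r1" by (simp only: same_concat_eq)
    moreover have "y \<in> markov_seqs T" using p(5) by (simp add: markov_seqs_conc)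
    ultimately show "p \<in> S_word_homeo T a" using p(1) by (simp add: mem_S_word_homeo)
  qed
  have phFF: "partial_homeo Y (F O F'\<inverse>)"
    by (intro partial_homeo_relcomp partial_homeo_converse partial_homeo_N F)
  note agree_trans [trans]
  have "agree Y t' (S_word_homeo T a) (?L (monomial_homeo u' F' v))"
    by (rule agree_sym[OF agree_if_subset[OF phL(2) partial_homeo_S_word sub']]) (use tL' in blast)
  also note agree_sym[OF ag']
  also have "agree Y t' (?L (monomial_homeo u F v)) (F O F'\<inverse>)"
    by (rule agree_if_subset[OF phL(1) phFF sub]) (use tL in blast)
  finally have "germ Y (S_word_homeo T a) t' = germ Y (F O F'\<inverse>) t'"
    using germ_eq_iff[OF partial_homeo_S_word _ phFF, of t' a t'] at' sub tL by (meson RangeI subsetD)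
  moreover have "germ Y (F O F'\<inverse>) t' \<in> G_germs"
  proof (rule G_germs_relcomp[OF partial_homeo_N[OF F(1)] ts(1) _ partial_homeo_converse[OF partial_homeo_N[OF F(2)]] ms])
    show "germ Y F s \<in> G_germs" by (rule subsetD[OF germs_of_N[OF F(1)] germs_ofI[OF ts(1)]])
    show "germ Y (F'\<inverse>) t' \<in> G_germs"
      by (rule G_germs_converse[OF partial_homeo_N[OF F(2)] t'(1) subsetD[OF germs_of_N[OF F(2)] germs_ofI[OF t'(1)]]])
  qed
  ultimately show False using germ_S_word_notin_G_germs[OF a, of t'] tM ta by simp
qed

text \<open>The case of different right words is reduced to that of equal ones: the shorter right
  word is prolonged to the longer, the left word is prolonged by equally many letters, and the
  nucleus element is replaced by a section, which does not change the germ at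
  \<open>w\<close>.\<close>

lemma agree_monomials_degree:
  assumes F: "F \<in> N" "F' \<in> N" and ag: "agree Y w (monomial_homeo u F v) (monomial_homeo u' F' v')"
    and zw: "(z, w) \<in> monomial_homeo u F v"
  shows "length u + length v' = length u' + length v"
proof -
  have *: "length u + length v' = length u' + length v"
    if F: "F \<in> N" "F' \<in> N" and ag: "agree Y w (monomial_homeo u F v) (monomial_homeo u' F' v')"
      and zw: "(z, w) \<in> monomial_homeo u F v" and le: "length v \<le> length v'" for F F' u u' v v'
  proof -
    obtain t s where ts: "(t, s) \<in> F" "z = u \<frown> t" "w = v \<frown> s" "z \<in> markov_seqs T" "w \<in> markov_seqs T"
      using zw unfolding mem_monomial_homeo by blast
    have zw': "(z, w) \<in> monomial_homeo u' F' v'" using agreeD[OF ag] zw by blast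
    then obtain s' where s': "w = v' \<frown> s'" unfolding mem_monomial_homeo by blast
    define b where "b = drop (length v) v'"
    have "take (length v) v' = v"
    proof -
      have "prefix (length v) w = v" using ts(3) by simp
      moreover have "prefix (length v) w = take (length v) v'" using s' le by simp
      ultimately show ?thesis by simp
    qed
    then have v': "v' = v @ b" by (metis b_def append_take_drop_id)
    \<comment> \<open>The section has to be taken at the point under consideration: \<open>b\<close>
      begins the sequence \<open>s\<close>, so \<open>c\<close> must begin the value
      \<open>t\<close> of \<open>F\<close> at \<open>s\<close>.\<close>
    define c where "c = prefix (length b) t"
    define F1 where "F1 = (S_word_homeo T c)\<inverse> O F O S_word_homeo T b"
    have len: "length c = length b" by (simp add: c_def)
    have F1: "F1 \<in> N" unfolding F1_def by (rule N_word[OF len F(1)])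
    have sb: "s = b \<frown> s'"
    proof -
      have "v \<frown> s = v \<frown> (b \<frown> s')" using ts(3) s' v' by simp
      then show ?thesis by (simp only: same_concat_eq)
    qed
    have tc: "t = c \<frown> suffix (length b) t" unfolding c_def by (rule prefix_suffix)
    have "t \<in> markov_seqs T" "s \<in> markov_seqs T"
      using ts(2,3,4,5) by (simp_all add: markov_seqs_conc)
    then have "(suffix (length b) t, s') \<in> F1"
      unfolding F1_def
    proof (intro relcompI)
      show "(suffix (length b) t, t) \<in> (S_word_homeo T c)\<inverse>"
        using tc \<open>t \<in> markov_seqs T\<close> unfolding converse_iff mem_S_word_homeo by blast
      show "(s, s') \<in> S_word_homeo T b" using sb \<open>s \<in> markov_seqs T\<close> unfolding mem_S_word_homeo by blast
    qed (rule ts(1))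
    moreover have "z = (u @ c) \<frown> suffix (length b) t" using ts(2) tc conc_conc by metis
    ultimately have zw1: "(z, w) \<in> monomial_homeo (u @ c) F1 v'"
      unfolding mem_monomial_homeo using s' ts(4,5) by blast
    have sub: "monomial_homeo (u @ c) F1 v' \<subseteq> monomial_homeo u F v"
    proof
      fix p assume p: "p \<in> monomial_homeo (u @ c) F1 v'"
      obtain z1 w1 where zw1: "p = (z1, w1)" by (cases p)
      obtain t1 s1 where *: "(t1, s1) \<in> F1" "z1 = (u @ c) \<frown> t1" "w1 = v' \<frown> s1" "z1 \<in> markov_seqs T" "w1 \<in> markov_seqs T"
        using p unfolding zw1 mem_monomial_homeo by blast
      have "(c \<frown> t1, b \<frown> s1) \<in> F" using *(1) unfolding F1_def by (auto simp: mem_S_word_homeo)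
      then show "p \<in> monomial_homeo u F v"
        unfolding zw1 mem_monomial_homeo using * v' by (intro exI[of _ "c \<frown> t1"] exI[of _ "b \<frown> s1"]) simp
    qed
    have "agree Y w (monomial_homeo (u @ c) F1 v') (monomial_homeo u F v)"
      by (rule agree_if_subset[OF partial_homeo_monomial[OF F1] partial_homeo_monomial[OF F(1)] sub])
        (use zw1 in blast)
    from agree_trans[OF this ag] have ag1: "agree Y w (monomial_homeo (u @ c) F1 v') (monomial_homeo u' F' v')" .
    have "length u' = length (u @ c)"
      using agree_monomials_length_le[OF F1 F(2) ag1 zw1] agree_monomials_length_le[OF F(2) F1 agree_sym[OF ag1] zw']
      by simp
    then show ?thesis using v' len by simp
  qed
  show ?thesis
  proof (cases "length v \<le> length v'")
    case True
    then show ?thesis using *[OF F ag zw] by simp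
  next
    case False
    have "(z, w) \<in> monomial_homeo u' F' v'" using agreeD[OF ag] zw by blast
    then show ?thesis using *[OF F(2,1) agree_sym[OF ag]] False by simp
  qed
qed

section \<open>The evaluation of noncommutative polynomials\<close>

text \<open>Letters that are not generators of the presentation are sent to the empty map. Every
  word then evaluates to a partial homeomorphism, and the evaluation is multiplicative on all
  polynomials without side conditions.\<close>

primrec gen_homeo :: "'x generator \<Rightarrow> (nat \<Rightarrow> 'x) rel" where
  "gen_homeo (GenS x) = S_homeo T x"
| "gen_homeo (GenSinv x) = (S_homeo T x)\<inverse>"
| "gen_homeo (GenN F) = (if F \<in> N then F else {})"

definition word_homeo :: "'x generator free_monoid \<Rightarrow> (nat \<Rightarrow> 'x) rel" where
  "word_homeo w = foldr (\<lambda>a R. gen_homeo a O R) (letters w) (Id_on (markov_seqs T))"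

lemma clopen_homeo_S: "clopen_homeo T (S_homeo T x)"
  using clopen_homeo_S_word[of T "[x]"] by (simp add: S_word_homeo_singleton)

lemma clopen_homeo_gen: "clopen_homeo T (gen_homeo a)"
  by (cases a) (simp_all add: clopen_homeo_S clopen_homeo_converse clopen_homeo_N clopen_homeo_empty)

lemma word_homeo_0: "word_homeo 0 = Id_on (markov_seqs T)"
  by (simp add: word_homeo_def zero_free_monoid_def)

lemma clopen_homeo_word: "clopen_homeo T (word_homeo w)"
proof -
  have "clopen_homeo T (foldr (\<lambda>a R. gen_homeo a O R) ls (Id_on (markov_seqs T)))" for ls
    by (induction ls) (simp_all add: clopen_homeo_Id clopen_homeo_relcomp clopen_homeo_gen)
  then show ?thesis by (simp add: word_homeo_def)
qed

lemma partial_homeo_word: "partial_homeo Y (word_homeo w)"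
  using clopen_homeo_word by (simp add: clopen_homeo_def)

lemma Id_on_markov_relcomp: "R \<subseteq> markov_seqs T \<times> A \<Longrightarrow> Id_on (markov_seqs T) O R = R"
  by (auto simp: relcomp_unfold Id_on_iff)

lemma relcomp_Id_on_markov: "R \<subseteq> A \<times> markov_seqs T \<Longrightarrow> R O Id_on (markov_seqs T) = R"
  by (auto simp: relcomp_unfold Id_on_iff)

lemma word_homeo_plus: "word_homeo (w + w') = word_homeo w O word_homeo w'"
proof -
  have "word_homeo w' \<subseteq> markov_seqs T \<times> markov_seqs T"
    using partial_homeo_subset[OF partial_homeo_word[of w']] by simp
  then have "foldr (\<lambda>a R. gen_homeo a O R) ls (word_homeo w') =
      foldr (\<lambda>a R. gen_homeo a O R) ls (Id_on (markov_seqs T)) O word_homeo w'" for ls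
    by (induction ls) (simp_all add: Id_on_markov_relcomp O_assoc)
  then show ?thesis by (simp add: word_homeo_def plus_free_monoid_def)
qed

section \<open>The germs generated by the groupoid and the shift\<close>

definition O_germs :: "(nat \<Rightarrow> 'x) germ set" where
  "O_germs = generated_subgroupoid (germ_groupoid Y) (G_germs \<union> shift_germs T)"

lemma O_groupoid_eq: "O_groupoid T G = germ_subgroupoid Y O_germs"
  by (simp add: O_groupoid_def germ_subgroupoid_def O_germs_def Let_def)

lemma mem_S_homeo': "(z, w) \<in> S_homeo T x \<longleftrightarrow> z \<in> markov_seqs T \<and> z 0 = x \<and> w = shift z"
proof -
  have "z = [x] \<frown> w \<longleftrightarrow> z 0 = x \<and> w = shift z"
  proof
    assume "z 0 = x \<and> w = shift z"
    then show "z = [x] \<frown> w" by (auto simp: fun_eq_iff conc_def shift_def)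
  qed (auto simp: shift_def conc_def)
  then show ?thesis by (auto simp: mem_S_homeo)
qed

lemma germ_S_inv_shift_germs: "germs_of Y ((S_homeo T x)\<inverse>) \<subseteq> shift_germs T"
proof -
  have "(S_homeo T x)\<inverse> \<subseteq> {(shift w, w) | w. w \<in> markov_seqs T}"
    by (auto simp: mem_S_homeo')
  then show ?thesis
    using partial_homeo_converse[OF partial_homeo_S] unfolding shift_germs_def by blast
qed

text \<open>On the cylinder of the first letter of \<open>z\<close> the shift is the inverse of
  \<open>S_homeo T (z 0)\<close>. The germs of the shift are thus exactly accounted for by the
  generators \<open>S_x^-1\<close>.\<close>

lemma shift_germs_S_inv:
  assumes "\<gamma> \<in> shift_germs T"
  obtains z where "z \<in> markov_seqs T" "\<gamma> = germ Y ((S_homeo T (z 0))\<inverse>) z"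
proof -
  obtain R where R: "partial_homeo Y R" "R \<subseteq> {(shift w, w) | w. w \<in> markov_seqs T}" "\<gamma> \<in> germs_of Y R"
    using assms unfolding shift_germs_def by blast
  obtain z y where z: "\<gamma> = germ Y R z" "(y, z) \<in> R" using R(3) by (rule germs_ofE)
  have zM: "z \<in> markov_seqs T" using R(2) z(2) by auto
  let ?S = "(S_homeo T (z 0))\<inverse>"
  have pS: "partial_homeo Y ?S" by (rule partial_homeo_converse[OF partial_homeo_S])
  have sub: "R O Id_on (cylinder T [z 0]) \<subseteq> ?S"
    using R(2) by (auto simp: mem_S_homeo' cylinder_def subsequence_def)
  have zc: "z \<in> cylinder T [z 0]" using zM by (simp add: cylinder_def subsequence_def)
  have "agree Y z R (R O Id_on (cylinder T [z 0]))"
    by (rule agree_sym[OF agree_restrict[OF cylinder_clopen(1) zc]])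
  moreover have "agree Y z (R O Id_on (cylinder T [z 0])) ?S"
    by (rule agree_if_subset[OF partial_homeo_relcomp[OF R(1) partial_homeo_Id_on[OF cylinder_clopen(1)]] pS sub])
      (use z(2) zc in blast)
  ultimately have "agree Y z R ?S" by (rule agree_trans)
  moreover have "z \<in> Range ?S" using zM mem_S_homeo'[of z "shift z" "z 0"] by blast
  ultimately have "germ Y R z = germ Y ?S z"
    using germ_eq_iff[OF R(1) _ pS, of z z] z(2) by blast
  then show ?thesis using that zM z(1) by simp
qed

lemma all_germs_gmult:
  assumes "\<gamma> \<in> all_germs Y" "\<delta> \<in> all_germs Y" "fst \<gamma> = tgt (germ_groupoid Y) \<delta>"
  shows "gmult (germ_groupoid Y) \<gamma> \<delta> \<in> all_germs Y"
proof -
  obtain R z y where R: "partial_homeo Y R" "(z, y) \<in> R" "\<gamma> = germ Y R y" using assms(1) by (rule all_germsE)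
  obtain Q y' x where Q: "partial_homeo Y Q" "(y', x) \<in> Q" "\<delta> = germ Y Q x" using assms(2) by (rule all_germsE)
  have y': "y' = y" using assms(3) R(3) Q(3) tgt_germ[OF Q(1,2)] by simp
  have "gmult (germ_groupoid Y) \<gamma> \<delta> = germ Y (R O Q) x"
    using gmult_germ[OF R(1,2) Q(1)] Q(2,3) R(3) y' by simp
  moreover have "(z, x) \<in> R O Q" using R(2) Q(2) y' by blast
  ultimately show ?thesis using all_germsI[OF partial_homeo_relcomp[OF R(1) Q(1)]] by simp
qed

lemma O_germs_subset: "O_germs \<subseteq> all_germs Y"
proof
  fix \<gamma> assume "\<gamma> \<in> O_germs"
  then show "\<gamma> \<in> all_germs Y" unfolding O_germs_def
  proof (induction rule: generated_subgroupoid.induct)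
    case (base \<gamma>)
    then show ?case
    proof
      assume "\<gamma> \<in> G_germs"
      then show ?thesis using etale_groupoid.arrow_germ_all_germs[OF etale] by (auto simp: Obj_G)
    next
      assume "\<gamma> \<in> shift_germs T"
      then show ?thesis unfolding shift_germs_def all_germs_def by blast
    qed
  next
    case (unit x)
    then have "(x, x) \<in> Id_on (markov_seqs T)" by auto
    then show ?case
      using all_germsI[OF partial_homeo_Id_on[OF openin_topspace], of x x Y] by simp
  next
    case (inv \<gamma>)
    obtain R y x where R: "partial_homeo Y R" "(y, x) \<in> R" "\<gamma> = germ Y R x" using inv.IH by (rule all_germsE)
    have "(x, y) \<in> R\<inverse>" using R(2) by simp
    then show ?case using ginv_germ[OF R(1,2)] all_germsI[OF partial_homeo_converse[OF R(1)]] R(3) by simp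
  next
    case (mult \<gamma> \<delta>)
    then show ?case using all_germs_gmult by simp
  qed
qed

lemma closed_under_gmult_O_germs: "closed_under_gmult Y O_germs"
  unfolding closed_under_gmult_def
proof (intro conjI ballI impI O_germs_subset)
  fix \<gamma> \<delta> assume "\<gamma> \<in> O_germs" "\<delta> \<in> O_germs" "fst \<gamma> = tgt (germ_groupoid Y) \<delta>"
  then show "gmult (germ_groupoid Y) \<gamma> \<delta> \<in> O_germs"
    unfolding O_germs_def by (intro generated_subgroupoid.mult) auto
qed

text \<open>The germs of \<open>S_x\<close> are inverses of germs of the shift; those of the other
  generators belong to the generating set or do not occur at all.\<close>

lemma germs_of_gen: "germs_of Y (gen_homeo a) \<subseteq> O_germs"
proof (cases a)
  case (GenS x)
  show ?thesis
  proof
    fix \<gamma> assume "\<gamma> \<in> germs_of Y (gen_homeo a)"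
    then have "\<gamma> \<in> germs_of Y (S_homeo T x)" using GenS by simp
    then obtain w z where z: "\<gamma> = germ Y (S_homeo T x) w" "(z, w) \<in> S_homeo T x" by (rule germs_ofE)
    have wz: "(w, z) \<in> (S_homeo T x)\<inverse>" using z(2) by simp
    have "germ Y ((S_homeo T x)\<inverse>) z \<in> O_germs"
      unfolding O_germs_def using subsetD[OF germ_S_inv_shift_germs germs_ofI[OF wz]]
      by (intro generated_subgroupoid.base) simp
    then have "ginv (germ_groupoid Y) (germ Y ((S_homeo T x)\<inverse>) z) \<in> O_germs"
      unfolding O_germs_def by (rule generated_subgroupoid.inv)
    then show "\<gamma> \<in> O_germs"
      using ginv_germ[OF partial_homeo_converse[OF partial_homeo_S] wz] z(1) by simp
  qed
next
  case (GenSinv x)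
  then show ?thesis
    using germ_S_inv_shift_germs unfolding O_germs_def by (auto intro: generated_subgroupoid.base)
next
  case (GenN F)
  have "G_germs \<subseteq> O_germs" unfolding O_germs_def by (auto intro: generated_subgroupoid.base)
  then show ?thesis using GenN germs_of_N[of F] by (cases "F \<in> N") auto
qed

lemma germs_of_Id: "germs_of Y (Id_on (markov_seqs T)) \<subseteq> O_germs"
proof
  fix \<gamma> assume "\<gamma> \<in> germs_of Y (Id_on (markov_seqs T))"
  then obtain x y where x: "\<gamma> = germ Y (Id_on (markov_seqs T)) x" "(y, x) \<in> Id_on (markov_seqs T)"
    by (rule germs_ofE)
  then show "\<gamma> \<in> O_germs"
    using generated_subgroupoid.unit[of x "germ_groupoid Y"] unfolding O_germs_def by auto
qed

lemma germs_of_word: "germs_of Y (word_homeo w) \<subseteq> O_germs"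
proof -
  have "partial_homeo Y (foldr (\<lambda>a R. gen_homeo a O R) ls (Id_on (markov_seqs T))) \<and>
    germs_of Y (foldr (\<lambda>a R. gen_homeo a O R) ls (Id_on (markov_seqs T))) \<subseteq> O_germs" for ls
  proof (induction ls)
    case Nil
    show ?case using germs_of_Id partial_homeo_Id_on[OF openin_topspace, of Y] by simp
  next
    case (Cons a ls)
    have "partial_homeo Y (gen_homeo a)" using clopen_homeo_gen by (simp add: clopen_homeo_def)
    then show ?case
      using Cons germs_of_relcomp_subset[OF closed_under_gmult_O_germs _ germs_of_gen]
        partial_homeo_relcomp[of Y "gen_homeo a"]
      by simp
  qed
  then show ?thesis by (simp add: word_homeo_def)
qed

text \<open>The function lives on all germs, but words have their germs in \<open>O_germs\<close>,
  so it vanishes elsewhere and is a function on the arrows of \<open>O_groupoid T G\<close>.\<close>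

definition ev :: "('x generator, 'k) ncpoly \<Rightarrow> (nat \<Rightarrow> 'x) germ \<Rightarrow> 'k" where
  "ev p = (\<lambda>\<gamma>. \<Sum>w\<in>Poly_Mapping.keys p. Poly_Mapping.lookup p w * indicator (germs_of Y (word_homeo w)) \<gamma>)"

section \<open>Linearity and multiplicativity of the evaluation\<close>

lemma ev_superset:
  assumes "finite A" "Poly_Mapping.keys p \<subseteq> A"
  shows "ev p \<gamma> = (\<Sum>w\<in>A. Poly_Mapping.lookup p w * indicator (germs_of Y (word_homeo w)) \<gamma>)"
  unfolding ev_def by (rule sum.mono_neutral_left) (use assms in \<open>auto simp: in_keys_iff\<close>)

lemma ev_add: "ev (p + q) \<gamma> = ev p \<gamma> + ev q \<gamma>"
proof -
  let ?A = "Poly_Mapping.keys p \<union> Poly_Mapping.keys q"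
  have "finite ?A" "Poly_Mapping.keys (p + q) \<subseteq> ?A" using Poly_Mapping.keys_add[of p q] by auto
  then show ?thesis
    using ev_superset[of ?A p] ev_superset[of ?A q] ev_superset[of ?A "p + q"]
    by (simp add: lookup_add distrib_right sum.distrib)
qed

lemma ev_zero [simp]: "ev 0 \<gamma> = 0"
  by (simp add: ev_def)

lemma ev_sum: "ev (\<Sum>i\<in>A. f i) \<gamma> = (\<Sum>i\<in>A. ev (f i) \<gamma>)"
  by (induction A rule: infinite_finite_induct) (simp_all add: ev_add)

lemma ev_uminus: "ev (- p) \<gamma> = - ev p \<gamma>"
  using ev_add[of p "- p" \<gamma>] by (simp add: add_eq_0_iff)

lemma ev_diff: "ev (p - q) \<gamma> = ev p \<gamma> - ev q \<gamma>"
  using ev_add[of p "- q" \<gamma>] ev_uminus[of q] by simp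

lemma ev_single: "ev (Poly_Mapping.single w c) \<gamma> = c * indicator (germs_of Y (word_homeo w)) \<gamma>"
  by (cases "c = 0") (simp_all add: ev_def del: sum_mult_indicator)

lemma ev_mult: "steinberg_mult (O_groupoid T G) (ev p) (ev q) = ev (p * q)"
proof
  fix \<gamma>
  have *: "partial_homeo Y (word_homeo w) \<and> germs_of Y (word_homeo w) \<subseteq> O_germs" for w
    using partial_homeo_word germs_of_word by blast
  let ?s = "\<lambda>p w. Poly_Mapping.single w (Poly_Mapping.lookup p w)"
  have "p * q = (\<Sum>w\<in>Poly_Mapping.keys p. ?s p w) * (\<Sum>w\<in>Poly_Mapping.keys q. ?s q w)"
    using sum_monomials[of p] sum_monomials[of q] by simp
  also have "\<dots> = (\<Sum>w\<in>Poly_Mapping.keys p. \<Sum>w'\<in>Poly_Mapping.keys q.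
      Poly_Mapping.single (w + w') (Poly_Mapping.lookup p w * Poly_Mapping.lookup q w'))"
    by (simp add: sum_product mult_single)
  finally have "ev (p * q) \<gamma> = (\<Sum>w\<in>Poly_Mapping.keys p. \<Sum>w'\<in>Poly_Mapping.keys q.
      Poly_Mapping.lookup p w * Poly_Mapping.lookup q w' * indicator (germs_of Y (word_homeo w O word_homeo w')) \<gamma>)"
    by (simp add: ev_sum ev_single word_homeo_plus)
  then show "steinberg_mult (O_groupoid T G) (ev p) (ev q) \<gamma> = ev (p * q) \<gamma>"
    unfolding O_groupoid_eq ev_def[of p] ev_def[of q]
    by (subst steinberg_mult_sum_indicators[OF closed_under_gmult_O_germs]) (simp_all add: *)
qed

text \<open>The products of generators that occur in the relations are single words with coefficient
  1. The predicate lets their evaluation be computed by composing relations, without ever writing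
  the words down.\<close>

definition represents :: "('x generator, 'k) ncpoly \<Rightarrow> (nat \<Rightarrow> 'x) rel \<Rightarrow> bool" where
  "represents p R \<longleftrightarrow> (\<exists>w. p = Poly_Mapping.single w 1 \<and> word_homeo w = R)"

lemma ev_represents: "represents p R \<Longrightarrow> ev p \<gamma> = indicator (germs_of Y R) \<gamma>"
  unfolding represents_def by (auto simp: ev_single)

lemma represents_mult: "\<lbrakk>represents p R; represents q Q\<rbrakk> \<Longrightarrow> represents (p * q) (R O Q)"
  unfolding represents_def using mult_single[of _ "1 :: 'k" _ 1] word_homeo_plus by (metis mult_1)

lemma represents_one: "represents 1 (Id_on (markov_seqs T))"
  unfolding represents_def using word_homeo_0 single_one[symmetric] by blast

lemma represents_gen: "represents (gen a) (gen_homeo a)"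
proof -
  have "gen_homeo a \<subseteq> markov_seqs T \<times> markov_seqs T"
    using clopen_homeo_gen[of a] partial_homeo_subset[of Y "gen_homeo a"] by (simp add: clopen_homeo_def)
  then have "word_homeo (Word [a]) = gen_homeo a"
    by (simp add: word_homeo_def relcomp_Id_on_markov)
  then show ?thesis unfolding represents_def gen_def by blast
qed

lemma represents_nuc: "F \<in> N \<Longrightarrow> represents (nuc F) F"
  using represents_gen[of "GenN F"] by simp

lemma represents_Sw: "represents (Sw u) (S_word_homeo T u)"
proof (induction u)
  case Nil
  show ?case using represents_one by (simp add: S_word_homeo_def)
next
  case (Cons x u)
  then show ?case using represents_mult[OF represents_gen[of "GenS x"]]
    by (simp add: Sw_Cons S_word_homeo_Cons)
qed

lemma represents_Sw': "represents (Sw' u) ((S_word_homeo T u)\<inverse>)"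
proof (induction u)
  case Nil
  show ?case using represents_one by (simp add: S_word_homeo_def)
next
  case (Cons x u)
  then show ?case using represents_mult[OF _ represents_gen[of "GenSinv x"]]
    by (simp add: Sw'_Cons S_word_homeo_Cons converse_relcomp)
qed

lemma represents_monomial: "F \<in> N \<Longrightarrow> represents (monomial u F v) (monomial_homeo u F v)"
  using represents_mult[OF represents_mult[OF represents_Sw represents_nuc] represents_Sw', of F u v]
  by (simp add: O_assoc)

lemma ev_const_represents:
  "represents p R \<Longrightarrow> ev (const c * p) \<gamma> = c * indicator (germs_of Y R) \<gamma>"
  unfolding represents_def by (auto simp: mult_single ev_single)

text \<open>Cylinders of words of length \<open>n\<close> partition the space at the source and at
  the target. The part of \<open>R\<close> between two of them is \<open>S_u\<close> composed with a
  section and \<open>S_v^-1\<close>. Level one gives the nucleus relations and level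
  \<open>n0\<close> the product relations.\<close>

lemma indicator_germs_sections:
  assumes R: "partial_homeo Y R"
  shows "(indicator (germs_of Y R) \<gamma> :: 'k) = (\<Sum>v | length v = n. \<Sum>u | length u = n.
    indicator (germs_of Y (monomial_homeo u ((S_word_homeo T u)\<inverse> O R O S_word_homeo T v) v)) \<gamma>)"
proof -
  let ?Q = "\<lambda>(v, u). monomial_homeo u ((S_word_homeo T u)\<inverse> O R O S_word_homeo T v) v"
  let ?J = "{v :: 'x list. length v = n} \<times> {u :: 'x list. length u = n}"
  have Q: "monomial_homeo u ((S_word_homeo T u)\<inverse> O R O S_word_homeo T v) v =
      Id_on (cylinder T u) O R O Id_on (cylinder T v)" for u v
    by (simp only: S_word_homeo_range[symmetric] O_assoc)
  have "(indicator (germs_of Y R) \<gamma> :: 'k) = (\<Sum>j\<in>?J. indicator (germs_of Y (?Q j)) \<gamma>)"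
  proof (rule indicator_germs_of_partition[OF R])
    show "partial_homeo Y (?Q j)" for j
      unfolding case_prod_beta Q
      by (intro partial_homeo_relcomp R partial_homeo_Id_on cylinder_clopen(1))
    show "finite ?J" using finite_words by blast
    show "?Q j \<subseteq> R" for j unfolding case_prod_beta Q by auto
    fix z w assume zw: "(z, w) \<in> R"
    then have "z \<in> markov_seqs T" "w \<in> markov_seqs T" using partial_homeo_subset[OF R] by auto
    then have *: "j \<in> ?J \<and> (z, w) \<in> ?Q j \<longleftrightarrow> j = (prefix n w, prefix n z)" for j
      unfolding case_prod_beta Q using zw by (cases j) (auto simp: cylinder_def relcomp_unfold Id_on_iff)
    show "\<exists>!j. j \<in> ?J \<and> (z, w) \<in> ?Q j" unfolding * by simp
  qed
  then show ?thesis by (simp add: sum.cartesian_product case_prod_beta)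
qed

section \<open>Validity of the defining relations for germs\<close>

lemma mem_range_S: "(z, w) \<in> S_homeo T y O (S_homeo T y)\<inverse> \<longleftrightarrow> z = w \<and> w \<in> markov_seqs T \<and> w 0 = y"
  unfolding S_word_homeo_singleton[symmetric] S_word_homeo_range
  by (auto simp: Id_on_iff cylinder_def subsequence_def)

lemma ev_defining_rels:
  assumes "r \<in> defining_rels T N n0" shows "ev r \<gamma> = 0"
proof -
  have S: "represents (genS x) (S_homeo T x)" and S': "represents (genS' x) ((S_homeo T x)\<inverse>)" for x
    using represents_gen[of "GenS x"] represents_gen[of "GenSinv x"] by auto
  have ck: "ev r \<gamma> = 0" if r: "r \<in> cuntz_krieger_rels T"
  proof -
    consider x where "r = genS' x * genS x - (\<Sum>y | (x, y) \<in> T. genS y * genS' y)"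
      | "r = (\<Sum>y\<in>UNIV. genS y * genS' y) - 1"
      | a b where "r = genS' a * genS b" "a \<noteq> b"
      using r unfolding cuntz_krieger_rels_def by blast
    then show ?thesis
    proof cases
      case 1
      \<comment> \<open>The domain of \<open>S_x\<close> is the disjoint union of the cylinders of
        the letters that may follow \<open>x\<close>.\<close>
      have "(indicator (germs_of Y ((S_homeo T x)\<inverse> O S_homeo T x)) \<gamma> :: 'k) =
          (\<Sum>y\<in>{y. (x, y) \<in> T}. indicator (germs_of Y (S_homeo T y O (S_homeo T y)\<inverse>)) \<gamma>)"
      proof (rule indicator_germs_of_partition)
        show "partial_homeo Y ((S_homeo T x)\<inverse> O S_homeo T x)"
          "partial_homeo Y (S_homeo T y O (S_homeo T y)\<inverse>)" for y
          by (intro partial_homeo_relcomp partial_homeo_converse partial_homeo_S)+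
        have m: "(z, w) \<in> (S_homeo T x)\<inverse> O S_homeo T x \<longleftrightarrow> z = w \<and> w \<in> markov_seqs T \<and> (x, w 0) \<in> T" for z w
          unfolding S_word_homeo_singleton[symmetric] S_word_homeo_domain
          by (auto simp: Id_on_iff markov_seqs_Cons)
        show "S_homeo T y O (S_homeo T y)\<inverse> \<subseteq> (S_homeo T x)\<inverse> O S_homeo T x" if "y \<in> {y. (x, y) \<in> T}" for y
        proof (rule subrelI)
          fix z w assume "(z, w) \<in> S_homeo T y O (S_homeo T y)\<inverse>"
          then show "(z, w) \<in> (S_homeo T x)\<inverse> O S_homeo T x"
            unfolding m mem_range_S using that by auto
        qed
        show "\<exists>!y. y \<in> {y. (x, y) \<in> T} \<and> (z, w) \<in> S_homeo T y O (S_homeo T y)\<inverse>"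
          if "(z, w) \<in> (S_homeo T x)\<inverse> O S_homeo T x" for z w
          using that unfolding m mem_range_S by auto
      qed simp
      then show ?thesis unfolding 1
        by (simp add: ev_diff ev_sum ev_represents[OF represents_mult[OF S' S]] ev_represents[OF represents_mult[OF S S']])
    next
      case 2
      have "(indicator (germs_of Y (Id_on (markov_seqs T))) \<gamma> :: 'k) =
          (\<Sum>y\<in>UNIV. indicator (germs_of Y (S_homeo T y O (S_homeo T y)\<inverse>)) \<gamma>)"
      proof (rule indicator_germs_of_partition)
        show "partial_homeo Y (S_homeo T y O (S_homeo T y)\<inverse>)" for y
          by (intro partial_homeo_relcomp partial_homeo_converse partial_homeo_S)+
        show "partial_homeo Y (Id_on (markov_seqs T))"
          using partial_homeo_Id_on[OF openin_topspace, of Y] by simp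
        show "S_homeo T y O (S_homeo T y)\<inverse> \<subseteq> Id_on (markov_seqs T)" for y
        proof (rule subrelI)
          fix z w assume "(z, w) \<in> S_homeo T y O (S_homeo T y)\<inverse>"
          then show "(z, w) \<in> Id_on (markov_seqs T)" unfolding mem_range_S by auto
        qed
        show "\<exists>!y. y \<in> UNIV \<and> (z, w) \<in> S_homeo T y O (S_homeo T y)\<inverse>"
          if "(z, w) \<in> Id_on (markov_seqs T)" for z w
          using that unfolding mem_range_S by auto
      qed simp
      then show ?thesis unfolding 2
        by (simp add: ev_diff ev_sum ev_represents[OF represents_one] ev_represents[OF represents_mult[OF S S']])
    next
      case 3
      have "(S_homeo T a)\<inverse> O S_homeo T b = {}"
        using S_word_homeo_orthogonal[of "[a]" "[b]" T] 3(2) by (simp add: S_word_homeo_singleton)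
      then show ?thesis unfolding 3(1) by (simp add: ev_represents[OF represents_mult[OF S' S]])
    qed
  qed
  have nu: "ev r \<gamma> = 0" if r: "r \<in> nucleus_rels T N"
  proof -
    obtain F where F: "F \<in> N" and r: "r = nuc F - (\<Sum>x\<in>UNIV. \<Sum>y\<in>UNIV. genS y * nuc ((S_homeo T y)\<inverse> O F O S_homeo T x) * genS' x)"
      using r unfolding nucleus_rels_def by blast
    have w1: "(\<Sum>v | length v = Suc 0. f v) = (\<Sum>x\<in>UNIV. f [x])" for f :: "'x list \<Rightarrow> 'k"
      using sum_words_Suc[of f 0] by simp
    have m: "ev (genS y * nuc ((S_homeo T y)\<inverse> O F O S_homeo T x) * genS' x) \<gamma> =
        indicator (germs_of Y (monomial_homeo [y] ((S_homeo T y)\<inverse> O F O S_homeo T x) [x])) \<gamma>" for x y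
      using ev_represents[OF represents_monomial[OF N_step[OF F]], of "[y]" y x "[x]" \<gamma>]
      by (simp add: Sw_Cons Sw'_Cons)
    show ?thesis
      using indicator_germs_sections[OF partial_homeo_N[OF F], of \<gamma> "Suc 0"]
      by (simp add: r ev_diff ev_sum ev_represents[OF represents_nuc[OF F]] m w1 S_word_homeo_singleton)
  qed
  have pr: "ev r \<gamma> = 0" if r: "r \<in> product_rels T N n0"
  proof -
    obtain F1 F2 where F: "F1 \<in> N" "F2 \<in> N" and r: "r = nuc F1 * nuc F2 -
       (\<Sum>v | length v = n0. \<Sum>u | length u = n0.
          Sw u * nuc ((S_word_homeo T u)\<inverse> O F1 O F2 O S_word_homeo T v) * Sw' v)"
      using r unfolding product_rels_def by blast
    have m: "ev (monomial u ((S_word_homeo T u)\<inverse> O F1 O F2 O S_word_homeo T v) v) \<gamma> =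
        indicator (germs_of Y (monomial_homeo u ((S_word_homeo T u)\<inverse> O (F1 O F2) O S_word_homeo T v) v)) \<gamma>"
      if "length u = n0" "length v = n0" for u v
      using ev_represents[OF represents_monomial[OF N_prod[OF F that]], of u v \<gamma>] by (simp add: O_assoc)
    show ?thesis
      using indicator_germs_sections[OF partial_homeo_relcomp[OF partial_homeo_N[OF F(1)] partial_homeo_N[OF F(2)]], of \<gamma> n0]
      by (simp add: r ev_diff ev_sum ev_represents[OF represents_mult[OF represents_nuc[OF F(1)] represents_nuc[OF F(2)]]] m)
  qed
  have id: "ev r \<gamma> = 0" if r: "r \<in> identification_rels T N"
  proof -
    consider "r = nuc {}" | F x where "F \<in> N" "F = (S_homeo T x)\<inverse> O S_homeo T x" "r = nuc F - genS' x * genS x"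
      using r unfolding identification_rels_def by blast
    then show ?thesis
    proof cases
      case 1
      then show ?thesis by (simp add: ev_represents[OF represents_nuc[OF N_empty]])
    next
      case 2
      then show ?thesis
        by (simp add: ev_diff ev_represents[OF represents_nuc] ev_represents[OF represents_mult[OF S' S]])
    qed
  qed
  show ?thesis using assms ck nu pr id unfolding defining_rels_def by blast
qed

lemma steinberg_mult_zero: "steinberg_mult H (\<lambda>_. 0) f = (\<lambda>_. 0)" "steinberg_mult H f (\<lambda>_. 0) = (\<lambda>_. 0)"
  by (simp_all add: fun_eq_iff steinberg_mult_def)

lemma ev_two_sided_ideal: "p \<in> two_sided_ideal (defining_rels T N n0) \<Longrightarrow> ev p = (\<lambda>_. 0)"
proof (induction rule: two_sided_ideal.induct)
  case (base r a b)
  have "ev r = (\<lambda>_. 0)" using ev_defining_rels[OF base] by auto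
  then show ?case by (simp flip: ev_mult add: steinberg_mult_zero)
qed (auto simp: ev_add)

lemma ev_eqv: "p \<approx>\<^sub>N q \<Longrightarrow> ev p = ev q"
  using ev_two_sided_ideal[of "p - q"] by (simp add: eq_mod_def fun_eq_iff ev_diff)

section \<open>Injectivity\<close>

text \<open>The inductive description is turned into an explicit finite sum, which regrouping by
  germs requires. Terms are indexed by numbers, since the same monomial may occur several
  times.\<close>

lemma normal_span_sum_form:
  assumes "p \<in> normal_span"
  obtains n :: nat and c u F v where "\<And>i. i < n \<Longrightarrow> F i \<in> N" "p \<approx>\<^sub>N (\<Sum>i<n. const (c i) * monomial (u i) (F i) (v i))"
proof -
  let ?m = "\<lambda>(c, u, F, v). const c * monomial u F v"
  have "\<exists>xs. (\<forall>(c, u, F, v)\<in>set xs. F \<in> N) \<and> p \<approx>\<^sub>N (\<Sum>t\<leftarrow>xs. ?m t)"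
    using assms
  proof (induction rule: normal_span.induct)
    case zero
    show ?case by (rule exI[of _ "[]"]) simp
  next
    case (monomial F c u v)
    then show ?case by (intro exI[of _ "[(c, u, F, v)]"]) simp
  next
    case (add p q)
    then obtain xs ys where "\<forall>(c, u, F, v)\<in>set xs. F \<in> N" "p \<approx>\<^sub>N (\<Sum>t\<leftarrow>xs. ?m t)"
      "\<forall>(c, u, F, v)\<in>set ys. F \<in> N" "q \<approx>\<^sub>N (\<Sum>t\<leftarrow>ys. ?m t)" by blast
    then show ?case by (intro exI[of _ "xs @ ys"]) (auto simp: eq_mod_add)
  next
    case (eqv q p)
    then show ?case using eq_mod_trans by blast
  qed
  then obtain xs where xs: "\<And>c u F v. (c, u, F, v) \<in> set xs \<Longrightarrow> F \<in> N" "p \<approx>\<^sub>N (\<Sum>t\<leftarrow>xs. ?m t)" by blast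
  have "(\<Sum>t\<leftarrow>xs. ?m t) = (\<Sum>i<length xs. ?m (xs ! i))"
    by (simp add: sum_list_sum_nth atLeast0LessThan)
  then have "p \<approx>\<^sub>N (\<Sum>i<length xs. const (fst (xs ! i)) *
      monomial (fst (snd (xs ! i))) (fst (snd (snd (xs ! i)))) (snd (snd (snd (xs ! i)))))"
    using xs(2) by (simp add: case_prod_beta)
  moreover have "fst (snd (snd (xs ! i))) \<in> N" if "i < length xs" for i
    using xs(1)[of "fst (xs ! i)" "fst (snd (xs ! i))" "fst (snd (snd (xs ! i)))" "snd (snd (snd (xs ! i)))"] that
    by simp
  ultimately show ?thesis
    using that[of "length xs" "\<lambda>i. fst (snd (snd (xs ! i)))" "\<lambda>i. fst (xs ! i)" "\<lambda>i. fst (snd (xs ! i))" "\<lambda>i. snd (snd (snd (xs ! i)))"]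
    by blast
qed

lemma const_sum: "const (\<Sum>i\<in>A. f i) = (\<Sum>i\<in>A. const (f i))"
  by (induction A rule: infinite_finite_induct) (simp_all add: single_add)

lemma eventually_cylinder:
  assumes "openin Y V" "w \<in> V" shows "\<forall>\<^sub>F m in sequentially. cylinder T (prefix m w) \<subseteq> V"
  using openin_markovE[OF assms] unfolding eventually_sequentially by blast

text \<open>Three conditions on a prefix length hold eventually for all monomials together: it
  exceeds the lengths of the right words, monomials undefined at \<open>w\<close> vanish on the
  cylinder, and monomials with a common germ at \<open>w\<close> coincide there. A single length
  satisfying all three is then used.\<close>

lemma eqv_zero_on_prefix:
  fixes n :: nat
  assumes F: "\<And>i. i < n \<Longrightarrow> F i \<in> N"
    and p: "p \<approx>\<^sub>N (\<Sum>i<n. const (c i) * monomial (u i) (F i) (v i))"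
    and ev0: "ev p = (\<lambda>_. 0)" and w: "w \<in> markov_seqs T"
  shows "\<exists>m. p * Sw (prefix m w) \<approx>\<^sub>N 0"
proof -
  define R where "R i = monomial_homeo (u i) (F i) (v i)" for i
  have pR: "partial_homeo Y (R i)" and cR: "clopen_homeo T (R i)" if "i < n" for i
    unfolding R_def using F[OF that] by (simp_all add: partial_homeo_monomial clopen_homeo_monomial)
  have ev_p: "ev p \<gamma> = (\<Sum>i<n. c i * indicator (germs_of Y (R i)) \<gamma>)" for \<gamma>
    unfolding ev_eqv[OF p] ev_sum R_def
    by (intro sum.cong refl ev_const_represents represents_monomial F) simp
  have "\<forall>\<^sub>F m in sequentially. \<forall>i\<in>{..<n}. length (v i) < m"
    by (intro eventually_ball_finite ballI eventually_gt_at_top) simp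
  moreover have "\<forall>\<^sub>F m in sequentially. \<forall>i\<in>{..<n}. w \<notin> Range (R i) \<longrightarrow> R i O S_word_homeo T (prefix m w) = {}"
  proof (intro eventually_ball_finite ballI)
    fix i assume i: "i \<in> {..<n}"
    show "\<forall>\<^sub>F m in sequentially. w \<notin> Range (R i) \<longrightarrow> R i O S_word_homeo T (prefix m w) = {}"
    proof (cases "w \<in> Range (R i)")
      case False
      \<comment> \<open>The domain of a monomial is closed, so a monomial undefined at
        \<open>w\<close> is undefined on a whole cylinder around \<open>w\<close>.\<close>
      have "openin Y (markov_seqs T - Range (R i))"
        using cR[of i] i by (simp add: clopen_homeo_def closedin_def)
      then have "\<forall>\<^sub>F m in sequentially. cylinder T (prefix m w) \<subseteq> markov_seqs T - Range (R i)"
        using False w by (intro eventually_cylinder) auto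
      then show ?thesis
      proof eventually_elim
        case (elim m)
        have "R i O S_word_homeo T (prefix m w) = {} O S_word_homeo T (prefix m w)"
          by (rule relcomp_S_word_cong[OF _ elim]) auto
        then show ?case by simp
      qed
    qed simp
  qed simp
  moreover have "\<forall>\<^sub>F m in sequentially. \<forall>ij\<in>{..<n} \<times> {..<n}. agree Y w (R (fst ij)) (R (snd ij)) \<longrightarrow>
      R (fst ij) O S_word_homeo T (prefix m w) = R (snd ij) O S_word_homeo T (prefix m w)"
  proof (intro eventually_ball_finite ballI)
    fix ij
    show "\<forall>\<^sub>F m in sequentially. agree Y w (R (fst ij)) (R (snd ij)) \<longrightarrow>
      R (fst ij) O S_word_homeo T (prefix m w) = R (snd ij) O S_word_homeo T (prefix m w)"
    proof (cases "agree Y w (R (fst ij)) (R (snd ij))")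
      case True
      then obtain V where V: "openin Y V" "w \<in> V" "\<And>z y. z \<in> V \<Longrightarrow> (y, z) \<in> R (fst ij) \<longleftrightarrow> (y, z) \<in> R (snd ij)"
        unfolding agree_def by metis
      from eventually_cylinder[OF V(1,2)] show ?thesis
      proof eventually_elim
        case (elim m)
        show ?case using relcomp_S_word_cong[OF V(3) elim] by simp
      qed
    qed simp
  qed simp
  ultimately have "\<forall>\<^sub>F m in sequentially. (\<forall>i\<in>{..<n}. length (v i) < m) \<and>
      (\<forall>i\<in>{..<n}. w \<notin> Range (R i) \<longrightarrow> R i O S_word_homeo T (prefix m w) = {}) \<and>
      (\<forall>ij\<in>{..<n} \<times> {..<n}. agree Y w (R (fst ij)) (R (snd ij)) \<longrightarrow>
        R (fst ij) O S_word_homeo T (prefix m w) = R (snd ij) O S_word_homeo T (prefix m w))"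
    by (intro eventually_conj)
  then obtain m where m: "(\<forall>i\<in>{..<n}. length (v i) < m) \<and>
      (\<forall>i\<in>{..<n}. w \<notin> Range (R i) \<longrightarrow> R i O S_word_homeo T (prefix m w) = {}) \<and>
      (\<forall>ij\<in>{..<n} \<times> {..<n}. agree Y w (R (fst ij)) (R (snd ij)) \<longrightarrow>
        R (fst ij) O S_word_homeo T (prefix m w) = R (snd ij) O S_word_homeo T (prefix m w))"
    using eventually_happens' trivial_limit_sequentially by blast
  then have m1: "\<And>i. i < n \<Longrightarrow> length (v i) < m"
    and m2: "\<And>i. \<lbrakk>i < n; w \<notin> Range (R i)\<rbrakk> \<Longrightarrow> R i O S_word_homeo T (prefix m w) = {}"
    and m3: "\<And>i j. \<lbrakk>i < n; j < n; agree Y w (R i) (R j)\<rbrakk> \<Longrightarrow>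
      R i O S_word_homeo T (prefix m w) = R j O S_word_homeo T (prefix m w)"
    by auto
  define q where "q = prefix m w"
  define X where "X i = collected (length q + length (u i) - length (v i)) (R i O S_word_homeo T q)" for i
  define J where "J = {i. i < n \<and> w \<in> Range (R i)}"
  define gm where "gm i = germ Y (R i) w" for i
  have finJ: "finite J" by (simp add: J_def)
  \<comment> \<open>Monomials with the same germ at \<open>w\<close> agree on a long prefix, and their coefficients add up to
    the value of \<open>ev p\<close> at this germ.\<close>
  have X_eq: "X i = X j" if ij: "i \<in> J" "j \<in> J" "gm i = gm j" for i j
  proof -
    have i: "i < n" "w \<in> Range (R i)" and j: "j < n" "w \<in> Range (R j)"
      using ij(1,2) by (auto simp: J_def)
    have ag: "agree Y w (R i) (R j)"
      using ij(3) germ_eq_iff[OF pR[OF i(1)] i(2) pR[OF j(1)] j(2)] by (simp add: gm_def)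
    obtain z where z: "(z, w) \<in> R i" using i(2) by blast
    have "length (u i) + length (v j) = length (u j) + length (v i)"
      by (rule agree_monomials_degree[OF F[OF i(1)] F[OF j(1)] ag[unfolded R_def] z[unfolded R_def]])
    \<comment> \<open>The truncated subtractions are harmless, because \<open>q\<close> is longer
      than every \<open>v i\<close>.\<close>
    then have "length q + length (u i) - length (v i) = length q + length (u j) - length (v j)"
      using m1[OF i(1)] m1[OF j(1)] by (simp add: q_def)
    moreover have "R i O S_word_homeo T q = R j O S_word_homeo T q"
      unfolding q_def by (rule m3[OF i(1) j(1) ag])
    ultimately show ?thesis unfolding X_def by (simp only:)
  qed
  have coeff: "(\<Sum>i\<in>{i \<in> J. gm i = \<gamma>}. c i) = 0" if \<gamma>: "\<gamma> \<in> gm ` J" for \<gamma>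
  proof -
    have fst\<gamma>: "fst \<gamma> = w" using \<gamma> by (auto simp: gm_def)
    have iff: "\<gamma> \<in> germs_of Y (R i) \<longleftrightarrow> i \<in> J \<and> gm i = \<gamma>" if "i < n" for i
    proof
      assume "\<gamma> \<in> germs_of Y (R i)"
      then obtain x z where "\<gamma> = germ Y (R i) x" "(z, x) \<in> R i" by (rule germs_ofE)
      moreover have "x = w" using calculation(1) fst\<gamma> by simp
      ultimately show "i \<in> J \<and> gm i = \<gamma>" using that by (auto simp: J_def gm_def)
    next
      assume "i \<in> J \<and> gm i = \<gamma>"
      then obtain z where "(z, w) \<in> R i" "\<gamma> = germ Y (R i) w" by (auto simp: J_def gm_def)
      then show "\<gamma> \<in> germs_of Y (R i)" using germs_ofI by simp
    qed
    have "0 = (\<Sum>i<n. c i * indicator (germs_of Y (R i)) \<gamma>)" using ev_p[of \<gamma>] ev0 by simp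
    also have "\<dots> = (\<Sum>i<n. if i \<in> {i \<in> J. gm i = \<gamma>} then c i else 0)"
      by (intro sum.cong) (auto simp: indicator_def iff)
    also have "\<dots> = (\<Sum>i\<in>{i \<in> J. gm i = \<gamma>}. c i)"
      by (simp add: sum.If_cases) (rule sum.cong, auto simp: J_def)
    finally show ?thesis by simp
  qed
  have "p * Sw q \<approx>\<^sub>N (\<Sum>i<n. const (c i) * monomial (u i) (F i) (v i)) * Sw q"
    by (intro eq_mod_mult_right p)
  also have "\<dots> = (\<Sum>i<n. const (c i) * (monomial (u i) (F i) (v i) * Sw q))"
    by (simp add: sum_distrib_right mult.assoc)
  also have "\<dots> \<approx>\<^sub>N (\<Sum>i<n. const (c i) * X i)"
    unfolding X_def R_def using F m1 by (intro eq_mod_sum eq_mod_mult_left monomial_Sw) (auto simp: q_def)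
  also have "\<dots> = (\<Sum>i\<in>J. const (c i) * X i) + (\<Sum>i\<in>{..<n} - J. const (c i) * X i)"
    by (rule sum.subset_diff[THEN trans[OF _ add.commute]]) (auto simp: J_def)
  also have "\<dots> \<approx>\<^sub>N (\<Sum>i\<in>J. const (c i) * X i) + 0"
  proof (intro eq_mod_add eq_mod_refl eq_mod_sum_zero eq_mod_zero_mult(1))
    fix i assume "i \<in> {..<n} - J"
    then show "X i \<approx>\<^sub>N 0" using m2[of i] collected_empty by (simp add: X_def J_def q_def)
  qed
  also have "(\<Sum>i\<in>J. const (c i) * X i) + 0 = (\<Sum>\<gamma>\<in>gm ` J. \<Sum>i\<in>{i \<in> J. gm i = \<gamma>}. const (c i) * X i)"
    using sum.image_gen[OF finJ, of "\<lambda>i. const (c i) * X i" gm] by simp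
  also have "\<dots> = 0"
  proof (rule sum.neutral, rule ballI)
    fix \<gamma> assume \<gamma>: "\<gamma> \<in> gm ` J"
    then obtain j where j: "j \<in> J" "gm j = \<gamma>" by blast
    have "(\<Sum>i\<in>{i \<in> J. gm i = \<gamma>}. const (c i) * X i) = (\<Sum>i\<in>{i \<in> J. gm i = \<gamma>}. const (c i)) * X j"
      unfolding sum_distrib_right
    proof (intro sum.cong refl)
      fix i assume "i \<in> {i \<in> J. gm i = \<gamma>}"
      then have "X i = X j" using j by (intro X_eq) auto
      then show "const (c i) * X i = const (c i) * X j" by simp
    qed
    also have "(\<Sum>i\<in>{i \<in> J. gm i = \<gamma>}. const (c i)) = (const (\<Sum>i\<in>{i \<in> J. gm i = \<gamma>}. c i) :: ('x generator, 'k) ncpoly)"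
      by (simp add: const_sum)
    finally show "(\<Sum>i\<in>{i \<in> J. gm i = \<gamma>}. const (c i) * X i) = 0" using coeff[OF \<gamma>] by simp
  qed
  finally show ?thesis unfolding q_def by blast
qed

lemma ev_zero_imp_eqv_zero:
  assumes p: "p \<in> normal_span" and ev0: "ev p = (\<lambda>_. 0)"
  shows "p \<approx>\<^sub>N 0"
proof (rule ccontr)
  assume not: "\<not> p \<approx>\<^sub>N 0"
  obtain n :: nat and F c u v where F: "\<And>i. i < n \<Longrightarrow> F i \<in> N"
    and pF: "p \<approx>\<^sub>N (\<Sum>i<n. const (c i) * monomial (u i) (F i) (v i))"
    by (rule normal_span_sum_form[OF p]) (blast intro: that)
  \<comment> \<open>The decomposition of 1 recovers \<open>p * Sw v\<close> from its products with
    the letters, so it cannot vanish after every letter without vanishing itself.\<close>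
  have step: "\<exists>x. \<not> p * Sw (v @ [x]) \<approx>\<^sub>N 0" if bad: "\<not> p * Sw v \<approx>\<^sub>N 0" for v
  proof (rule ccontr)
    assume "\<not> ?thesis"
    then have good: "p * Sw (v @ [x]) \<approx>\<^sub>N 0" for x by blast
    have "p * Sw v * 1 \<approx>\<^sub>N p * Sw v * (\<Sum>x\<in>UNIV. genS x * genS' x)"
      by (intro eq_mod_mult_left eq_mod_sym[OF sum_genS_genS'])
    also have "\<dots> = (\<Sum>x\<in>UNIV. p * Sw (v @ [x]) * genS' x)"
      by (simp add: sum_distrib_left Sw_append Sw_Cons mult.assoc)
    also have "\<dots> \<approx>\<^sub>N 0" by (intro eq_mod_sum_zero eq_mod_zero_mult(2) good)
    finally show False using bad by simp
  qed
  \<comment> \<open>As \<open>p\<close> is nonzero, it stays nonzero along some infinite path, which is then admissible.\<close>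
  define nxt where "nxt v = (SOME x. \<not> p * Sw (v @ [x]) \<approx>\<^sub>N 0)" for v
  define f where "f = rec_nat [] (\<lambda>_ v. v @ [nxt v])"
  have f0: "f 0 = []" and fS: "f (Suc k) = f k @ [nxt (f k)]" for k by (simp_all add: f_def)
  have bad: "\<not> p * Sw (f k) \<approx>\<^sub>N 0" for k
  proof (induction k)
    case 0
    then show ?case using not f0 by simp
  next
    case (Suc k)
    from someI_ex[OF step[OF Suc]] show ?case unfolding fS nxt_def .
  qed
  define w where "w k = nxt (f k)" for k
  have fw: "f k = prefix k w" for k
    by (induction k) (simp_all add: f0 fS w_def)
  have "w \<in> markov_seqs T"
    unfolding markov_seqs_def
  proof (intro CollectI allI)
    fix k
    have "f (Suc (Suc k)) = f k @ [w k, w (Suc k)]" by (simp add: fS w_def)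
    moreover have "admissible T (f (Suc (Suc k)))"
      using bad[of "Suc (Suc k)"] eq_mod_zero_mult(1)[OF Sw_inadmissible] by blast
    ultimately show "(w k, w (Suc k)) \<in> T" by (simp add: successively_append_iff)
  qed
  from eqv_zero_on_prefix[OF F pF ev0 this] obtain m where "p * Sw (prefix m w) \<approx>\<^sub>N 0" by blast
  then show False using bad[of m] fw by simp
qed

end

section \<open>The ideal of relations in the free algebra\<close>

lemma free_algebra_simps [simp]:
  "mult (free_algebra A) = (*)" "one (free_algebra A) = 1" "zero (free_algebra A) = 0"
  "add (free_algebra A) = (+)" "c \<odot>\<^bsub>free_algebra A\<^esub> p = const c * p"
  by (simp_all add: free_algebra_def)

lemma mem_free_algebra:
  "p \<in> carrier (free_algebra A) \<longleftrightarrow> (\<forall>w\<in>Poly_Mapping.keys p. set (letters w) \<subseteq> A)"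
  by (simp add: free_algebra_def)

lemma free_algebra_single: "set (letters w) \<subseteq> A \<Longrightarrow> Poly_Mapping.single w c \<in> carrier (free_algebra A)"
  by (simp add: mem_free_algebra)

lemma free_algebra_zero: "0 \<in> carrier (free_algebra A)"
  by (simp add: mem_free_algebra)

lemma free_algebra_const: "const c \<in> carrier (free_algebra A)"
  by (rule free_algebra_single) (simp add: zero_free_monoid_def)

lemma free_algebra_one: "1 \<in> carrier (free_algebra A)"
  using free_algebra_const[of 1 A] by simp

lemma free_algebra_gen: "a \<in> A \<Longrightarrow> gen a \<in> carrier (free_algebra A)"
  unfolding gen_def by (rule free_algebra_single) simp

lemma free_algebra_add:
  assumes "p \<in> carrier (free_algebra A)" "q \<in> carrier (free_algebra A)"
  shows "p + q \<in> carrier (free_algebra A)"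
  using assms Poly_Mapping.keys_add[of p q] unfolding mem_free_algebra by blast

lemma free_algebra_uminus: "p \<in> carrier (free_algebra A) \<Longrightarrow> - p \<in> carrier (free_algebra A)"
  by (simp add: mem_free_algebra)

lemma free_algebra_diff:
  "\<lbrakk>p \<in> carrier (free_algebra A); q \<in> carrier (free_algebra A)\<rbrakk> \<Longrightarrow> p - q \<in> carrier (free_algebra A)"
  using free_algebra_add[of p A "- q"] free_algebra_uminus[of q A] by simp

lemma free_algebra_mult:
  assumes "p \<in> carrier (free_algebra A)" "q \<in> carrier (free_algebra A)"
  shows "p * q \<in> carrier (free_algebra A)"
  unfolding mem_free_algebra
proof
  fix w assume "w \<in> Poly_Mapping.keys (p * q)"
  then obtain a b where "w = a + b" "a \<in> Poly_Mapping.keys p" "b \<in> Poly_Mapping.keys q"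
    using keys_mult[of p q] by blast
  then show "set (letters w) \<subseteq> A" using assms unfolding mem_free_algebra
    by (auto simp: plus_free_monoid_def)
qed

lemma free_algebra_sum:
  "(\<And>i. i \<in> J \<Longrightarrow> f i \<in> carrier (free_algebra A)) \<Longrightarrow> (\<Sum>i\<in>J. f i) \<in> carrier (free_algebra A)"
  by (induction J rule: infinite_finite_induct) (simp_all add: free_algebra_zero free_algebra_add)

lemma ring_free_algebra: "ring (free_algebra A :: ('k::field, ('a, 'k) ncpoly) module)"
proof (rule ringI)
  show "abelian_group (free_algebra A :: ('k, ('a, 'k) ncpoly) module)"
  proof (rule abelian_groupI)
    fix p :: "('a, 'k) ncpoly" assume p: "p \<in> carrier (free_algebra A)"
    show "\<exists>q\<in>carrier (free_algebra A). q \<oplus>\<^bsub>free_algebra A\<^esub> p = \<zero>\<^bsub>free_algebra A\<^esub>"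
      by (rule bexI[of _ "- p"]) (simp_all add: free_algebra_uminus p)
  qed (simp_all add: free_algebra_add free_algebra_zero algebra_simps)
  show "monoid (free_algebra A :: ('k, ('a, 'k) ncpoly) module)"
    by (rule monoidI) (simp_all add: free_algebra_mult free_algebra_one mult.assoc)
qed (simp_all add: algebra_simps)

text \<open>
  Killing the generators outside \<open>A\<close> is a retraction of the algebra of all polynomials onto
  the free algebra on \<open>A\<close>; hence nothing is lost by allowing multipliers with arbitrary letters
  in \<open>two_sided_ideal\<close>.
\<close>

definition restrict_poly :: "'a set \<Rightarrow> ('a, 'k::field) ncpoly \<Rightarrow> ('a, 'k) ncpoly" where
  "restrict_poly A p = (\<Sum>w | w \<in> Poly_Mapping.keys p \<and> set (letters w) \<subseteq> A.
     Poly_Mapping.single w (Poly_Mapping.lookup p w))"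

lemma lookup_restrict_poly:
  "Poly_Mapping.lookup (restrict_poly A p) w = (if set (letters w) \<subseteq> A then Poly_Mapping.lookup p w else 0)"
proof -
  have "finite {w. w \<in> Poly_Mapping.keys p \<and> set (letters w) \<subseteq> A}" by simp
  then show ?thesis
    by (auto simp: restrict_poly_def lookup_sum lookup_single when_def in_keys_iff)
qed

lemma restrict_poly_add: "restrict_poly A (p + q) = restrict_poly A p + restrict_poly A q"
  by (rule poly_mapping_eqI) (simp add: lookup_restrict_poly lookup_add)

lemma restrict_poly_zero: "restrict_poly A 0 = 0"
  by (simp add: restrict_poly_def)

lemma restrict_poly_sum: "restrict_poly A (\<Sum>i\<in>J. f i) = (\<Sum>i\<in>J. restrict_poly A (f i))"
  by (induction J rule: infinite_finite_induct) (simp_all add: restrict_poly_zero restrict_poly_add)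

lemma restrict_poly_single:
  "restrict_poly A (Poly_Mapping.single w c) = (if set (letters w) \<subseteq> A then Poly_Mapping.single w c else 0)"
  by (rule poly_mapping_eqI) (auto simp: lookup_restrict_poly lookup_single when_def)

text \<open>The letters of a concatenation all lie in \<open>A\<close> iff those of both factors
  do.\<close>

lemma restrict_poly_mult: "restrict_poly A (p * q) = restrict_poly A p * restrict_poly A q"
proof -
  let ?s = "\<lambda>p w. Poly_Mapping.single w (Poly_Mapping.lookup p w)"
  have single: "restrict_poly A (Poly_Mapping.single w c * Poly_Mapping.single w' c') =
      restrict_poly A (Poly_Mapping.single w c) * restrict_poly A (Poly_Mapping.single w' c')" for w w' and c c' :: 'b
    by (auto simp: mult_single restrict_poly_single plus_free_monoid_def)
  have "restrict_poly A ((\<Sum>w\<in>Poly_Mapping.keys p. ?s p w) * (\<Sum>w\<in>Poly_Mapping.keys q. ?s q w)) =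
      restrict_poly A (\<Sum>w\<in>Poly_Mapping.keys p. ?s p w) * restrict_poly A (\<Sum>w\<in>Poly_Mapping.keys q. ?s q w)"
    by (simp only: sum_product restrict_poly_sum single)
  then show ?thesis using sum_monomials[of p] sum_monomials[of q] by simp
qed

lemma restrict_poly_closed: "restrict_poly A p \<in> carrier (free_algebra A)"
  unfolding restrict_poly_def by (intro free_algebra_sum free_algebra_single) auto

lemma restrict_poly_id: "p \<in> carrier (free_algebra A) \<Longrightarrow> restrict_poly A p = p"
  by (rule poly_mapping_eqI) (auto simp: lookup_restrict_poly mem_free_algebra in_keys_iff)

text \<open>One inclusion is minimality of the generated ideal. For the other, an expression of
  \<open>p\<close> with arbitrary multipliers is mapped by \<open>restrict_poly A\<close>, which
  fixes \<open>p\<close> and the relators and moves the multipliers into the free algebra.\<close>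

lemma relation_ideal_eq:
  assumes Rel: "Rel \<subseteq> carrier (free_algebra A)"
  shows "relation_ideal A Rel = two_sided_ideal Rel \<inter> carrier (free_algebra A)"
proof
  let ?F = "free_algebra A"
  interpret ring ?F by (rule ring_free_algebra)
  have "ideal (two_sided_ideal Rel \<inter> carrier ?F) ?F"
  proof (rule idealI[OF ring_axioms])
    show "subgroup (two_sided_ideal Rel \<inter> carrier ?F) (add_monoid ?F)"
    proof (rule add.subgroupI)
      show "two_sided_ideal Rel \<inter> carrier ?F \<noteq> {}"
        using two_sided_ideal.zero free_algebra_zero by blast
      fix p assume p: "p \<in> two_sided_ideal Rel \<inter> carrier ?F"
      have "- p \<in> two_sided_ideal Rel \<inter> carrier ?F"
        using p two_sided_ideal_uminus free_algebra_uminus by blast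
      moreover have "\<ominus>\<^bsub>?F\<^esub> p = - p"
        by (rule minus_equality) (use p free_algebra_uminus in auto)
      ultimately show "\<ominus>\<^bsub>?F\<^esub> p \<in> two_sided_ideal Rel \<inter> carrier ?F" by simp
    qed (auto simp: two_sided_ideal.add free_algebra_add)
  qed (auto simp: two_sided_ideal_mult_left two_sided_ideal_mult_right free_algebra_mult)
  moreover have "Rel \<subseteq> two_sided_ideal Rel \<inter> carrier ?F"
  proof
    fix r assume r: "r \<in> Rel"
    then have "1 * r * 1 \<in> two_sided_ideal Rel" by (rule two_sided_ideal.base)
    then show "r \<in> two_sided_ideal Rel \<inter> carrier ?F" using r Rel by auto
  qed
  ultimately show "relation_ideal A Rel \<subseteq> two_sided_ideal Rel \<inter> carrier ?F"
    unfolding relation_ideal_def by (rule genideal_minimal)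
  interpret I: ideal "relation_ideal A Rel" ?F
    unfolding relation_ideal_def by (rule genideal_ideal[OF Rel])
  have "restrict_poly A p \<in> relation_ideal A Rel" if "p \<in> two_sided_ideal Rel" for p
    using that
  proof (induction rule: two_sided_ideal.induct)
    case zero
    then show ?case using I.zero_closed by (simp add: restrict_poly_zero)
  next
    case (base r a b)
    have "r \<in> relation_ideal A Rel"
      unfolding relation_ideal_def using genideal_self[OF Rel] base by blast
    then have "restrict_poly A a * r * restrict_poly A b \<in> relation_ideal A Rel"
      using I.I_l_closed[of r "restrict_poly A a"] I.I_r_closed[of "restrict_poly A a * r" "restrict_poly A b"]
        restrict_poly_closed[of A a] restrict_poly_closed[of A b] by simp
    moreover have "restrict_poly A r = r" using Rel base by (intro restrict_poly_id) blast
    ultimately show ?case by (simp add: restrict_poly_mult)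
  next
    case (add p q)
    then show ?case using I.a_closed by (simp add: restrict_poly_add)
  qed
  then show "two_sided_ideal Rel \<inter> carrier ?F \<subseteq> relation_ideal A Rel"
    using restrict_poly_id by force
qed

section \<open>The presented algebra as a quotient\<close>

lemma presented_class_eq:
  "presented_class A Rel p = (\<lambda>i. i + p) ` relation_ideal A Rel"
  by (auto simp: presented_class_def a_r_coset_def')

lemma presented_algebra_simps:
  "carrier (presented_algebra A Rel) = presented_class A Rel ` carrier (free_algebra A)"
  "mult (presented_algebra A Rel) = rcoset_mult (free_algebra A) (relation_ideal A Rel)"
  "one (presented_algebra A Rel) = presented_class A Rel 1"
  "add (presented_algebra A Rel) = set_add (free_algebra A)"
  "c \<odot>\<^bsub>presented_algebra A Rel\<^esub> P = (\<Union>p\<in>P. presented_class A Rel (const c * p))"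
  by (auto simp: presented_algebra_def FactRing_def ring.defs module.defs A_RCOSETS_def' presented_class_def)

text \<open>The isomorphism evaluates \<open>f\<close> at a chosen representative; the kernel
  condition makes \<open>f\<close> constant on classes and different on different classes. The
  condition is only asked on the carrier, where the relation ideal and
  \<open>two_sided_ideal\<close> agree.\<close>

lemma presented_algebra_isoI:
  fixes f :: "('a, 'k::field) ncpoly \<Rightarrow> 'b" and B :: "('k, 'b, 'm) module_scheme"
  assumes Rel: "Rel \<subseteq> carrier (free_algebra A)"
    and img: "f ` carrier (free_algebra A) = carrier B"
    and mult: "\<And>p q. f (p * q) = f p \<otimes>\<^bsub>B\<^esub> f q" and add: "\<And>p q. f (p + q) = f p \<oplus>\<^bsub>B\<^esub> f q"
    and one: "f 1 = \<one>\<^bsub>B\<^esub>" and smult: "\<And>c p. f (const c * p) = c \<odot>\<^bsub>B\<^esub> f p"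
    and ker: "\<And>p q. \<lbrakk>p \<in> carrier (free_algebra A); q \<in> carrier (free_algebra A)\<rbrakk> \<Longrightarrow>
      f p = f q \<longleftrightarrow> eq_mod Rel p q"
  shows "\<exists>\<Phi>\<in>algebra_iso (presented_algebra A Rel) B.
    \<forall>p\<in>carrier (free_algebra A). \<Phi> (presented_class A Rel p) = f p"
proof -
  let ?F = "free_algebra A"
  let ?I = "relation_ideal A Rel"
  interpret ring ?F by (rule ring_free_algebra)
  interpret I: ideal ?I ?F
    unfolding relation_ideal_def by (rule genideal_ideal[OF Rel])
  note I_eq = relation_ideal_eq[OF Rel]
  define \<Phi> where "\<Phi> P = f (SOME p. p \<in> P)" for P
  have self: "p \<in> presented_class A Rel p" for p
    unfolding presented_class_eq by (rule image_eqI[of _ _ 0]) (use I.zero_closed in auto)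
  have mem: "q \<in> carrier ?F \<and> f q = f p" if p: "p \<in> carrier ?F" and q: "q \<in> presented_class A Rel p" for p q
  proof -
    obtain i where i: "i \<in> ?I" "q = i + p" using q unfolding presented_class_eq by blast
    then have "q \<in> carrier ?F" using p by (simp add: I_eq free_algebra_add)
    moreover have "eq_mod Rel q p" using i by (simp add: eq_mod_def I_eq)
    ultimately show ?thesis using ker[of q p] p by blast
  qed
  have \<Phi>I: "\<Phi> P = y" if "P \<noteq> {}" "\<And>q. q \<in> P \<Longrightarrow> f q = y" for P y
    unfolding \<Phi>_def using that some_in_eq[of P] by blast
  have \<Phi>: "\<Phi> (presented_class A Rel p) = f p" if "p \<in> carrier ?F" for p
  proof (rule \<Phi>I)
    show "presented_class A Rel p \<noteq> {}" using self[of p] by blast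
    fix q assume "q \<in> presented_class A Rel p"
    then show "f q = f p" using mem[OF that] by blast
  qed
  have eqI: "presented_class A Rel p = presented_class A Rel q"
    if "p \<in> carrier ?F" "q \<in> carrier ?F" "f p = f q" for p q
  proof -
    have sub: "presented_class A Rel p \<subseteq> presented_class A Rel q" if "p - q \<in> ?I" for p q
    proof
      fix r assume "r \<in> presented_class A Rel p"
      then obtain i where i: "i \<in> ?I" "r = i + p" unfolding presented_class_eq by blast
      then have "r = (i + (p - q)) + q" "i + (p - q) \<in> ?I" using I.a_closed[OF i(1) that] by simp_all
      then show "r \<in> presented_class A Rel q" unfolding presented_class_eq by blast
    qed
    have "p - q \<in> ?I" "q - p \<in> ?I"
      using that ker[of p q] ker[of q p] free_algebra_diff by (auto simp: I_eq eq_mod_def)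
    then show ?thesis using sub by blast
  qed
  have "\<Phi> \<in> ring_hom (presented_algebra A Rel) B"
  proof (rule ring_hom_memI)
    fix P Q assume "P \<in> carrier (presented_algebra A Rel)" "Q \<in> carrier (presented_algebra A Rel)"
    then obtain p q where p: "p \<in> carrier ?F" "P = presented_class A Rel p"
      and q: "q \<in> carrier ?F" "Q = presented_class A Rel q"
      unfolding presented_algebra_simps by blast
    show "\<Phi> P \<in> carrier B" using p \<Phi> img by auto
    have "P \<otimes>\<^bsub>presented_algebra A Rel\<^esub> Q = presented_class A Rel (p * q)"
      using I.rcoset_mult_add[OF p(1) q(1)] p q by (simp add: presented_algebra_simps presented_class_def)
    then show "\<Phi> (P \<otimes>\<^bsub>presented_algebra A Rel\<^esub> Q) = \<Phi> P \<otimes>\<^bsub>B\<^esub> \<Phi> Q"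
      using \<Phi> p q free_algebra_mult mult by metis
    have "P \<oplus>\<^bsub>presented_algebra A Rel\<^esub> Q = presented_class A Rel (p + q)"
      using I.a_rcos_sum[OF p(1) q(1)] p q by (simp add: presented_algebra_simps presented_class_def)
    then show "\<Phi> (P \<oplus>\<^bsub>presented_algebra A Rel\<^esub> Q) = \<Phi> P \<oplus>\<^bsub>B\<^esub> \<Phi> Q"
      using \<Phi> p q free_algebra_add add by metis
  next
    show "\<Phi> \<one>\<^bsub>presented_algebra A Rel\<^esub> = \<one>\<^bsub>B\<^esub>"
      using \<Phi>[OF free_algebra_one] one by (simp add: presented_algebra_simps)
  qed
  moreover have "bij_betw \<Phi> (carrier (presented_algebra A Rel)) (carrier B)"
    unfolding bij_betw_def
  proof
    show "inj_on \<Phi> (carrier (presented_algebra A Rel))"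
    proof (rule inj_onI)
      fix P Q assume "P \<in> carrier (presented_algebra A Rel)" "Q \<in> carrier (presented_algebra A Rel)" "\<Phi> P = \<Phi> Q"
      moreover from this obtain p q where "p \<in> carrier ?F" "P = presented_class A Rel p"
        "q \<in> carrier ?F" "Q = presented_class A Rel q"
        unfolding presented_algebra_simps by blast
      ultimately show "P = Q" using \<Phi>[of p] \<Phi>[of q] eqI[of p q] by simp
    qed
    have "\<Phi> ` carrier (presented_algebra A Rel) = f ` carrier ?F"
      unfolding presented_algebra_simps image_image using \<Phi> by (rule image_cong[OF refl])
    then show "\<Phi> ` carrier (presented_algebra A Rel) = carrier B" using img by simp
  qed
  \<comment> \<open>A scalar multiple of a class is a union over all its representatives, so the
    value of \<open>f\<close> has to be checked on each of them.\<close>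
  moreover have "\<Phi> (c \<odot>\<^bsub>presented_algebra A Rel\<^esub> P) = c \<odot>\<^bsub>B\<^esub> \<Phi> P"
    if P: "P \<in> carrier (presented_algebra A Rel)" for c P
  proof -
    obtain p where p: "p \<in> carrier ?F" "P = presented_class A Rel p"
      using P unfolding presented_algebra_simps by blast
    show ?thesis
    proof (rule \<Phi>I)
      show "c \<odot>\<^bsub>presented_algebra A Rel\<^esub> P \<noteq> {}"
        unfolding presented_algebra_simps p(2) using self by blast
      fix r assume "r \<in> c \<odot>\<^bsub>presented_algebra A Rel\<^esub> P"
      then obtain q where q: "q \<in> presented_class A Rel p" "r \<in> presented_class A Rel (const c * q)"
        unfolding presented_algebra_simps p(2) by blast
      have q': "q \<in> carrier ?F" "f q = f p" using mem[OF p(1) q(1)] by auto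
      have "const c * q \<in> carrier ?F" by (rule free_algebra_mult[OF free_algebra_const q'(1)])
      then have "f r = f (const c * q)" using mem[OF _ q(2)] by blast
      then show "f r = c \<odot>\<^bsub>B\<^esub> \<Phi> P" using smult q'(2) \<Phi>[OF p(1)] p(2) by simp
    qed
  qed
  ultimately have "\<Phi> \<in> algebra_iso (presented_algebra A Rel) B"
    by (simp add: algebra_iso_def ring_iso_def)
  then show ?thesis using \<Phi> by blast
qed

section \<open>Surjectivity\<close>

context nucleus_groupoid
begin

lemma generators_simps [simp]:
  "GenS x \<in> generators N" "GenSinv x \<in> generators N" "GenN F \<in> generators N \<longleftrightarrow> F \<in> N"
  by (auto simp: generators_def)

lemma Sw_closed: "Sw u \<in> carrier (free_algebra (generators N))"
  by (induction u) (simp_all add: free_algebra_one Sw_Cons free_algebra_mult free_algebra_gen)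

lemma Sw'_closed: "Sw' u \<in> carrier (free_algebra (generators N))"
  by (induction u) (simp_all add: free_algebra_one Sw'_Cons free_algebra_mult free_algebra_gen)

lemma defining_rels_closed: "defining_rels T N n0 \<subseteq> carrier (free_algebra (generators N))"
proof -
  have "cuntz_krieger_rels T \<subseteq> carrier (free_algebra (generators N))"
    unfolding cuntz_krieger_rels_def
    by (auto intro!: free_algebra_diff free_algebra_mult free_algebra_sum free_algebra_gen free_algebra_one)
  moreover have "nucleus_rels T N \<subseteq> carrier (free_algebra (generators N))"
    unfolding nucleus_rels_def
    by (auto intro!: free_algebra_diff free_algebra_mult free_algebra_sum free_algebra_gen simp: N_step)
  moreover have "product_rels T N n0 \<subseteq> carrier (free_algebra (generators N))"
    unfolding product_rels_def
    by (auto intro!: free_algebra_diff free_algebra_mult free_algebra_sum free_algebra_gen Sw_closed Sw'_closed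
        simp: N_prod)
  moreover have "identification_rels T N \<subseteq> carrier (free_algebra (generators N))"
    unfolding identification_rels_def
    by (auto intro!: free_algebra_diff free_algebra_mult free_algebra_gen)
  ultimately show ?thesis unfolding defining_rels_def by blast
qed

section \<open>Covering the germs by words in the generators\<close>

definition reached :: "(nat \<Rightarrow> 'x) germ set" where
  "reached = {\<gamma>. \<exists>w. set (letters w) \<subseteq> generators N \<and> \<gamma> \<in> germs_of Y (word_homeo w)}"

lemma reachedI: "\<lbrakk>set (letters w) \<subseteq> generators N; \<gamma> \<in> germs_of Y (word_homeo w)\<rbrakk> \<Longrightarrow> \<gamma> \<in> reached"
  unfolding reached_def by blast

lemma reached_gmult:
  assumes "\<gamma> \<in> reached" "\<delta> \<in> reached" "fst \<gamma> = tgt (germ_groupoid Y) \<delta>"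
  shows "gmult (germ_groupoid Y) \<gamma> \<delta> \<in> reached"
proof -
  obtain w where w: "set (letters w) \<subseteq> generators N" "\<gamma> \<in> germs_of Y (word_homeo w)"
    using assms(1) unfolding reached_def by blast
  obtain w' where w': "set (letters w') \<subseteq> generators N" "\<delta> \<in> germs_of Y (word_homeo w')"
    using assms(2) unfolding reached_def by blast
  obtain y z where y: "\<gamma> = germ Y (word_homeo w) y" "(z, y) \<in> word_homeo w" using w(2) by (rule germs_ofE)
  obtain x y' where x: "\<delta> = germ Y (word_homeo w') x" "(y', x) \<in> word_homeo w'" using w'(2) by (rule germs_ofE)
  have y': "y' = y" using assms(3) x(1) y(1) tgt_germ[OF partial_homeo_word x(2)] by simp
  have "gmult (germ_groupoid Y) \<gamma> \<delta> = germ Y (word_homeo w O word_homeo w') x"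
    using gmult_germ[OF partial_homeo_word y(2) partial_homeo_word] x y(1) y' by simp
  moreover have "(z, x) \<in> word_homeo w O word_homeo w'" using y(2) x(2) y' by blast
  ultimately have "gmult (germ_groupoid Y) \<gamma> \<delta> \<in> germs_of Y (word_homeo (w + w'))"
    using germs_ofI by (simp add: word_homeo_plus)
  then show ?thesis using w(1) w'(1) by (intro reachedI[of "w + w'"]) (auto simp: plus_free_monoid_def)
qed

lemma reached_gen:
  assumes "a \<in> generators N" "\<gamma> \<in> germs_of Y (gen_homeo a)" shows "\<gamma> \<in> reached"
proof (rule reachedI[of "Word [a]"])
  have "gen_homeo a \<subseteq> markov_seqs T \<times> markov_seqs T"
    using clopen_homeo_gen[of a] partial_homeo_subset[of Y "gen_homeo a"] by (simp add: clopen_homeo_def)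
  then show "\<gamma> \<in> germs_of Y (word_homeo (Word [a]))"
    using assms(2) by (simp add: word_homeo_def relcomp_Id_on_markov)
qed (use assms in simp)

lemma letters_normal_word:
  "set (letters (Word (map GenS u @ [GenN F] @ map GenSinv (rev v)))) \<subseteq> generators N" if "F \<in> N"
  using that by auto

lemma word_homeo_normal_word:
  assumes "F \<in> N"
  shows "word_homeo (Word (map GenS u @ [GenN F] @ map GenSinv (rev v))) = monomial_homeo u F v"
proof -
  have 1: "word_homeo (Word (map GenS u)) = S_word_homeo T u" for u
    by (induction u) (simp_all add: word_homeo_def S_word_homeo_def)
  have 2: "word_homeo (Word (map GenSinv (rev v))) = (S_word_homeo T v)\<inverse>" for v
  proof (induction v)
    case Nil
    then show ?case by (simp add: word_homeo_def S_word_homeo_def)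
  next
    case (Cons x v)
    have "word_homeo (Word (map GenSinv (rev (x # v)))) =
        word_homeo (Word (map GenSinv (rev v))) O word_homeo (Word [GenSinv x])"
      using word_homeo_plus[of "Word (map GenSinv (rev v))" "Word [GenSinv x]"] by (simp add: plus_free_monoid_def)
    moreover have "word_homeo (Word [GenSinv x]) = (S_homeo T x)\<inverse>"
      using partial_homeo_subset[OF partial_homeo_converse[OF partial_homeo_S[of x]]]
      by (simp add: word_homeo_def relcomp_Id_on_markov)
    ultimately show ?case using Cons by (simp add: S_word_homeo_Cons converse_relcomp)
  qed
  have 3: "word_homeo (Word [GenN F]) = F"
    using N_subset[OF assms] assms by (simp add: word_homeo_def relcomp_Id_on_markov)
  show ?thesis
    using word_homeo_plus[of "Word (map GenS u)" "Word ([GenN F] @ map GenSinv (rev v))"]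
      word_homeo_plus[of "Word [GenN F]" "Word (map GenSinv (rev v))"]
    by (simp add: plus_free_monoid_def 1 2 3)
qed

text \<open>At a level where all sections of \<open>R\<close> lie in the nucleus, the section along
  the prefixes of the value \<open>y\<close> and of the source gives a monomial which is the
  restriction of \<open>R\<close> to cylinders around these two points.\<close>

lemma G_germs_reached:
  assumes "\<gamma> \<in> G_germs" shows "\<gamma> \<in> reached"
proof -
  obtain R y where R: "R \<in> cob_homeos G" "(y, fst \<gamma>) \<in> R" "\<gamma> = germ Y R (fst \<gamma>)"
    using G_germ_cob[OF assms] .
  define x where "x = fst \<gamma>"
  have pR: "partial_homeo Y R" using clopen_homeo_cob[OF etale Obj_G R(1)] by (simp add: clopen_homeo_def)
  obtain n where n: "\<And>v1 v2. \<lbrakk>length v1 = n; length v2 = n\<rbrakk> \<Longrightarrow>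
       (S_word_homeo T v1)\<inverse> O R O S_word_homeo T v2 \<in> N"
    using N_attracts[OF R(1)] unfolding eventually_sequentially by blast
  define v1 v2 F where "v1 = prefix n y" and "v2 = prefix n x"
    and "F = (S_word_homeo T v1)\<inverse> O R O S_word_homeo T v2"
  have F: "F \<in> N" unfolding F_def by (rule n) (simp_all add: v1_def v2_def)
  have eq: "monomial_homeo v1 F v2 = Id_on (cylinder T v1) O R O Id_on (cylinder T v2)"
    unfolding F_def by (simp only: S_word_homeo_range[symmetric] O_assoc)
  have "y \<in> markov_seqs T" "x \<in> markov_seqs T"
    using partial_homeo_subset[OF pR] R(2) by (auto simp: x_def)
  then have "(y, y) \<in> Id_on (cylinder T v1)" "(x, x) \<in> Id_on (cylinder T v2)"
    unfolding v1_def v2_def using mem_cylinder_prefix by auto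
  then have yx: "(y, x) \<in> monomial_homeo v1 F v2" unfolding eq using R(2) x_def by blast
  have "monomial_homeo v1 F v2 \<subseteq> R" unfolding eq by auto
  then have "agree Y x (monomial_homeo v1 F v2) R"
    using agree_if_subset[OF partial_homeo_monomial[OF F] pR] yx by blast
  then have "germ Y (monomial_homeo v1 F v2) x = \<gamma>"
    using germ_eq_iff[OF partial_homeo_monomial[OF F] _ pR, of x v1 v2 x] yx R(2,3) x_def by (metis RangeI)
  then have "\<gamma> \<in> germs_of Y (monomial_homeo v1 F v2)" using germs_ofI[OF yx] by metis
  then show ?thesis
    using reachedI[OF letters_normal_word[OF F]] word_homeo_normal_word[OF F] by metis
qed

text \<open>Closure of \<open>reached\<close> under inversion is not evident, because inverses of
  nucleus elements are not generators. The induction therefore carries the inverse germ along; in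
  the base case this uses that inverses of germs of the groupoid are again such germs.\<close>

lemma O_germs_reached: "O_germs \<subseteq> reached"
proof -
  have "\<gamma> \<in> reached \<and> ginv (germ_groupoid Y) \<gamma> \<in> reached \<and> \<gamma> \<in> all_germs Y" if "\<gamma> \<in> O_germs" for \<gamma>
    using that unfolding O_germs_def
  proof (induction rule: generated_subgroupoid.induct)
    case (base \<gamma>)
    have all: "\<gamma> \<in> all_germs Y"
      using O_germs_subset generated_subgroupoid.base[OF base] unfolding O_germs_def by blast
    from base show ?case
    proof
      assume \<gamma>: "\<gamma> \<in> G_germs"
      obtain R x y where R: "partial_homeo Y R" "(y, x) \<in> R" "\<gamma> = germ Y R x" using all by (rule all_germsE)
      have "ginv (germ_groupoid Y) \<gamma> \<in> G_germs"
        using G_germs_converse[OF R(1,2)] ginv_germ[OF R(1,2)] \<gamma> R(3) by simp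
      then show ?thesis using \<gamma> G_germs_reached all by blast
    next
      assume "\<gamma> \<in> shift_germs T"
      then obtain z where z: "z \<in> markov_seqs T" "\<gamma> = germ Y ((S_homeo T (z 0))\<inverse>) z" by (rule shift_germs_S_inv)
      have S: "(z, shift z) \<in> S_homeo T (z 0)" using z(1) by (simp add: mem_S_homeo')
      then have S': "(shift z, z) \<in> (S_homeo T (z 0))\<inverse>" by simp
      have "\<gamma> \<in> reached" unfolding z(2) using germs_ofI[OF S', of Y] by (intro reached_gen[of "GenSinv (z 0)"]) simp_all
      moreover have "ginv (germ_groupoid Y) \<gamma> = germ Y (S_homeo T (z 0)) (shift z)"
        unfolding z(2) using ginv_germ[OF partial_homeo_converse[OF partial_homeo_S] S'] by simp
      then have "ginv (germ_groupoid Y) \<gamma> \<in> reached"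
        using germs_ofI[OF S, of Y] by (intro reached_gen[of "GenS (z 0)"]) simp_all
      ultimately show ?thesis using all by blast
    qed
  next
    case (unit x)
    have pI: "partial_homeo Y (Id_on (markov_seqs T))" using partial_homeo_Id_on[OF openin_topspace, of Y] by simp
    have I: "(x, x) \<in> Id_on (markov_seqs T)" using unit by auto
    have "germ Y (Id_on (markov_seqs T)) x \<in> reached"
      by (rule reachedI[of 0]) (use germs_ofI[OF I] in \<open>simp_all add: word_homeo_0, simp add: zero_free_monoid_def\<close>)
    moreover have "ginv (germ_groupoid Y) (germ Y (Id_on (markov_seqs T)) x) = germ Y (Id_on (markov_seqs T)) x"
      using ginv_germ[OF pI I] by simp
    ultimately show ?case using all_germsI[OF pI I] by simp
  next
    case (inv \<gamma>)
    obtain R x y where R: "partial_homeo Y R" "(y, x) \<in> R" "\<gamma> = germ Y R x"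
      using inv.IH by (metis all_germsE)
    have R': "(x, y) \<in> R\<inverse>" using R(2) by simp
    have g: "ginv (germ_groupoid Y) \<gamma> = germ Y (R\<inverse>) y" using ginv_germ[OF R(1,2)] R(3) by simp
    have "ginv (germ_groupoid Y) (ginv (germ_groupoid Y) \<gamma>) = \<gamma>"
      unfolding g using ginv_germ[OF partial_homeo_converse[OF R(1)] R'] R(3) by simp
    then show ?case using inv.IH g all_germsI[OF partial_homeo_converse[OF R(1)] R'] by simp
  next
    case (mult \<gamma> \<delta>)
    obtain R z y where R: "partial_homeo Y R" "(z, y) \<in> R" "\<gamma> = germ Y R y"
      using mult.IH by (metis all_germsE)
    obtain Q y' x where Q: "partial_homeo Y Q" "(y', x) \<in> Q" "\<delta> = germ Y Q x"
      using mult.IH by (metis all_germsE)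
    have y': "y' = y" using mult.hyps R(3) Q(3) tgt_germ[OF Q(1,2)] by simp
    have m: "(y, z) \<in> R\<inverse>" "(x, y) \<in> Q\<inverse>" "(z, x) \<in> R O Q" using R(2) Q(2) y' by auto
    have gm: "gmult (germ_groupoid Y) \<gamma> \<delta> = germ Y (R O Q) x"
      using gmult_germ[OF R(1,2) Q(1)] Q(2,3) R(3) y' by simp
    have gi: "ginv (germ_groupoid Y) \<gamma> = germ Y (R\<inverse>) z" "ginv (germ_groupoid Y) \<delta> = germ Y (Q\<inverse>) y"
      using ginv_germ[OF R(1,2)] ginv_germ[OF Q(1,2)] R(3) Q(3) y' by simp_all
    have "ginv (germ_groupoid Y) (gmult (germ_groupoid Y) \<gamma> \<delta>) = germ Y (Q\<inverse> O R\<inverse>) z"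
      unfolding gm using ginv_germ[OF partial_homeo_relcomp[OF R(1) Q(1)] m(3)] by (simp add: converse_relcomp)
    also have "\<dots> = gmult (germ_groupoid Y) (ginv (germ_groupoid Y) \<delta>) (ginv (germ_groupoid Y) \<gamma>)"
      unfolding gi using gmult_germ[OF partial_homeo_converse[OF Q(1)] m(2) partial_homeo_converse[OF R(1)] m(1)] by simp
    also have "\<dots> \<in> reached"
    proof (rule reached_gmult)
      show "ginv (germ_groupoid Y) \<delta> \<in> reached" "ginv (germ_groupoid Y) \<gamma> \<in> reached" using mult.IH by auto
      show "fst (ginv (germ_groupoid Y) \<delta>) = tgt (germ_groupoid Y) (ginv (germ_groupoid Y) \<gamma>)"
        unfolding gi using tgt_germ[OF partial_homeo_converse[OF R(1)] m(1)] by simp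
    qed
    finally have "ginv (germ_groupoid Y) (gmult (germ_groupoid Y) \<gamma> \<delta>) \<in> reached" .
    moreover have "gmult (germ_groupoid Y) \<gamma> \<delta> \<in> reached"
      using mult by (intro reached_gmult) auto
    moreover have "gmult (germ_groupoid Y) \<gamma> \<delta> \<in> all_germs Y"
      unfolding gm by (rule all_germsI[OF partial_homeo_relcomp[OF R(1) Q(1)] m(3)])
    ultimately show ?case by blast
  qed
  then show ?thesis by blast
qed

section \<open>Indicators of compact open bisections\<close>

lemma ev_restrict:
  "ev (p * (Sw v * Sw' v)) \<gamma> = (if fst \<gamma> \<in> cylinder T v then ev p \<gamma> else 0)"
proof -
  have r: "represents (Sw v * Sw' v) (Id_on (cylinder T v))"
    using represents_mult[OF represents_Sw represents_Sw', of v v] S_word_homeo_range[of T v] by simp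
  let ?s = "\<lambda>w. Poly_Mapping.single w (Poly_Mapping.lookup p w)"
  have 1: "ev (Poly_Mapping.single w c * (Sw v * Sw' v)) \<gamma> =
      (if fst \<gamma> \<in> cylinder T v then ev (Poly_Mapping.single w c) \<gamma> else 0)" for w c
  proof -
    have rw: "represents (Poly_Mapping.single w 1) (word_homeo w)" unfolding represents_def by blast
    have "Poly_Mapping.single w c * (Sw v * Sw' v) = const c * (Poly_Mapping.single w 1 * (Sw v * Sw' v))"
      by (simp add: mult_single flip: mult.assoc)
    then have "ev (Poly_Mapping.single w c * (Sw v * Sw' v)) \<gamma> =
        c * indicator (germs_of Y (word_homeo w O Id_on (cylinder T v))) \<gamma>"
      using ev_const_represents[OF represents_mult[OF rw r]] by simp
    also have "germs_of Y (word_homeo w O Id_on (cylinder T v)) = {\<gamma> \<in> germs_of Y (word_homeo w). fst \<gamma> \<in> cylinder T v}"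
      by (rule germs_of_restrict[OF partial_homeo_word cylinder_clopen(1)])
    finally show ?thesis by (simp add: ev_single indicator_def)
  qed
  have "ev ((\<Sum>w\<in>Poly_Mapping.keys p. ?s w) * (Sw v * Sw' v)) \<gamma> =
      (if fst \<gamma> \<in> cylinder T v then ev (\<Sum>w\<in>Poly_Mapping.keys p. ?s w) \<gamma> else 0)"
    unfolding sum_distrib_right ev_sum 1 by simp
  then show ?thesis using sum_monomials[of p] by simp
qed

abbreviation piece :: "'x generator free_monoid \<times> 'x list \<Rightarrow> (nat \<Rightarrow> 'x) germ set" where
  "piece t \<equiv> {\<gamma> \<in> germs_of Y (word_homeo (fst t)). fst \<gamma> \<in> cylinder T (snd t)}"

text \<open>Inclusion-exclusion without intersecting germ sets. A piece has a germ over every point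
  of its cylinder, and the source is injective on the union, so the overlap of the new piece with
  the old union is the part of the old union lying over that cylinder. Multiplication by
  \<open>S_v S_v^-1\<close> produces this part.\<close>

lemma indicator_pieces:
  assumes "finite C" and "\<And>t. t \<in> C \<Longrightarrow> set (letters (fst t)) \<subseteq> generators N \<and> cylinder T (snd t) \<subseteq> Range (word_homeo (fst t))"
    and "inj_on fst (\<Union>t\<in>C. piece t)"
  shows "\<exists>p\<in>carrier (free_algebra (generators N)). ev p = indicator (\<Union>t\<in>C. piece t)"
  using assms
proof (induction C rule: finite_induct)
  case empty
  show ?case by (rule bexI[of _ 0]) (auto simp: free_algebra_zero)
next
  case (insert t C)
  let ?A = "\<Union>t\<in>C. piece t"
  have inj: "inj_on fst (?A \<union> piece t)" using insert.prems(2) by (simp add: Un_commute)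
  then have "inj_on fst ?A" by (rule inj_on_subset) blast
  then obtain p where p: "p \<in> carrier (free_algebra (generators N))" "ev p = indicator ?A"
    using insert.IH insert.prems(1) by blast
  let ?e = "Sw (snd t) * Sw' (snd t) :: ('x generator, 'k) ncpoly"
  let ?q = "Poly_Mapping.single (fst t) 1 :: ('x generator, 'k) ncpoly"
  let ?r = "p + ?q * ?e - p * ?e"
  have t: "set (letters (fst t)) \<subseteq> generators N" "cylinder T (snd t) \<subseteq> Range (word_homeo (fst t))"
    using insert.prems(1) by auto
  have "?r \<in> carrier (free_algebra (generators N))"
    by (intro free_algebra_diff free_algebra_add free_algebra_mult p free_algebra_single t Sw_closed Sw'_closed)
  moreover have "ev ?r \<gamma> = indicator (\<Union>t\<in>insert t C. piece t) \<gamma>" for \<gamma>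
  proof -
    have "\<gamma> \<in> piece t" if "\<gamma> \<in> ?A" "fst \<gamma> \<in> cylinder T (snd t)"
    proof -
      have "fst \<gamma> \<in> fst ` germs_of Y (word_homeo (fst t))" using that(2) t(2) by (auto simp: fst_germs_of)
      then obtain \<delta> where \<delta>: "\<delta> \<in> germs_of Y (word_homeo (fst t))" "fst \<gamma> = fst \<delta>" by (rule imageE)
      then have "\<delta> \<in> piece t" using that(2) by simp
      then have "\<gamma> = \<delta>" using inj_onD[OF inj \<delta>(2)] that(1) by blast
      then show ?thesis using \<open>\<delta> \<in> piece t\<close> by simp
    qed
    then show ?thesis
      by (auto simp: ev_add ev_diff ev_restrict p(2) ev_single indicator_def)
  qed
  ultimately show ?case by (intro bexI[of _ ?r]) auto
qed

lemma indicator_compact_open_bisection: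
  assumes U: "compact_open_bisection (O_groupoid T G) U"
  shows "\<exists>p\<in>carrier (free_algebra (generators N)). ev p = indicator U"
proof -
  let ?Arr = "Arr (germ_groupoid Y)"
  have op: "openin (subtopology ?Arr O_germs) U" and c: "compactin (subtopology ?Arr O_germs) U"
    and hom: "homeomorphic_map (subtopology (subtopology ?Arr O_germs) U) (subtopology Y (fst ` U)) fst"
    using U unfolding O_groupoid_eq compact_open_bisection_def open_bisection_def bisection_def by auto
  obtain V where V: "openin ?Arr V" "U = V \<inter> O_germs" using op unfolding openin_subtopology by blast
  have cU: "compactin ?Arr U" using c by (simp add: compactin_subtopology)
  have inj: "inj_on fst U"
    using homeomorphic_imp_injective_map[OF hom] compactin_subset_topspace[OF c] by (simp add: Int_absorb1)
  define \<T> where "\<T> = {t. set (letters (fst t)) \<subseteq> generators N \<and> cylinder T (snd t) \<subseteq> Range (word_homeo (fst t)) \<and> piece t \<subseteq> U}"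
  have op_piece: "openin ?Arr (piece t)" for t
    unfolding germs_of_restrict[OF partial_homeo_word cylinder_clopen(1), symmetric]
    by (intro openin_germs_of partial_homeo_relcomp partial_homeo_word partial_homeo_Id_on cylinder_clopen(1))
  have cover: "\<exists>t\<in>\<T>. \<gamma> \<in> piece t" if \<gamma>: "\<gamma> \<in> U" for \<gamma>
  proof -
    obtain w where w: "set (letters w) \<subseteq> generators N" "\<gamma> \<in> germs_of Y (word_homeo w)"
      using \<gamma> V(2) O_germs_reached unfolding reached_def by blast
    obtain R where R: "partial_homeo Y R" "\<gamma> \<in> germs_of Y R" "germs_of Y R \<subseteq> V"
      using V \<gamma> unfolding openin_Arr_germ_groupoid by blast
    \<comment> \<open>The inclusion of \<open>W\<close> in the domain of the word yields the
      cylinder condition in \<open>\<T>\<close>, on which the inclusion-exclusion argument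
      rests.\<close>
    obtain W where W: "openin Y W" "fst \<gamma> \<in> W" "W \<subseteq> Range (word_homeo w)"
      "germs_of Y (word_homeo w O Id_on W) \<subseteq> germs_of Y (word_homeo w) \<inter> germs_of Y R"
      "word_homeo w O Id_on W \<subseteq> R"
      by (rule germs_of_Int[OF partial_homeo_word R(1) w(2) R(2)])
    obtain m where m: "cylinder T (prefix m (fst \<gamma>)) \<subseteq> W"
      using openin_markovE[OF W(1,2)] by (metis order_refl)
    have "fst \<gamma> \<in> markov_seqs T" using W(1,2) openin_subset by fastforce
    then have mem: "\<gamma> \<in> piece (w, prefix m (fst \<gamma>))" using w(2) by (simp add: mem_cylinder_prefix)
    have "piece (w, prefix m (fst \<gamma>)) \<subseteq> germs_of Y (word_homeo w O Id_on W)"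
      unfolding germs_of_restrict[OF partial_homeo_word W(1)] using m by auto
    also have "\<dots> \<subseteq> U" using W(4) R(3) germs_of_word V(2) by blast
    finally have "(w, prefix m (fst \<gamma>)) \<in> \<T>" using w(1) m W(3) unfolding \<T>_def by auto
    then show ?thesis using mem by blast
  qed
  have "U \<subseteq> \<Union> (piece ` \<T>)" using cover by blast
  then obtain \<F> where \<F>: "finite \<F>" "\<F> \<subseteq> piece ` \<T>" "U \<subseteq> \<Union>\<F>"
    using compactinD[OF cU, of "piece ` \<T>"] op_piece by (metis (no_types, lifting) imageE)
  obtain C where C: "finite C" "C \<subseteq> \<T>" "\<F> = piece ` C"
    using finite_subset_image[OF \<F>(1,2)] by blast
  have eq: "(\<Union>t\<in>C. piece t) = U"
    using C \<F>(3) unfolding \<T>_def by blast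
  have "\<exists>p\<in>carrier (free_algebra (generators N)). ev p = indicator (\<Union>t\<in>C. piece t)"
  proof (rule indicator_pieces[OF C(1)])
    show "set (letters (fst t)) \<subseteq> generators N \<and> cylinder T (snd t) \<subseteq> Range (word_homeo (fst t))" if "t \<in> C" for t
      using that C(2) unfolding \<T>_def by blast
    show "inj_on fst (\<Union>t\<in>C. piece t)" unfolding eq by (rule inj)
  qed
  then show ?thesis unfolding eq .
qed

section \<open>The isomorphism with the Steinberg algebra\<close>

lemma ev_const: "ev (const c * p) \<gamma> = c * ev p \<gamma>"
proof -
  let ?s = "\<lambda>w. Poly_Mapping.single w (Poly_Mapping.lookup p w)"
  have "ev (const c * (\<Sum>w\<in>Poly_Mapping.keys p. ?s w)) \<gamma> = c * ev (\<Sum>w\<in>Poly_Mapping.keys p. ?s w) \<gamma>"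
    unfolding sum_distrib_left ev_sum by (simp add: mult_single ev_single mult.assoc)
  then show ?thesis using sum_monomials[of p] by simp
qed

lemma steinberg_algebra_simps:
  "mult (steinberg_algebra H) = steinberg_mult H"
  "one (steinberg_algebra H) = indicator (unt H ` objects H)"
  "add (steinberg_algebra H) f g = (\<lambda>\<gamma>. f \<gamma> + g \<gamma>)"
  "c \<odot>\<^bsub>steinberg_algebra H\<^esub> f = (\<lambda>\<gamma>. c * f \<gamma>)"
  by (simp_all add: steinberg_algebra_def)

lemma ev_in_steinberg_algebra: "ev p \<in> carrier (steinberg_algebra (O_groupoid T G))"
proof -
  let ?U = "\<lambda>w. germs_of Y (word_homeo w)"
  \<comment> \<open>Different words may have the same germs, whereas the carrier is described by
    sums over sets of bisections; the coefficients of such words are added up.\<close>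
  let ?c = "\<lambda>U. \<Sum>w | w \<in> Poly_Mapping.keys p \<and> ?U w = U. Poly_Mapping.lookup p w"
  have "ev p \<gamma> = (\<Sum>U\<in>?U ` Poly_Mapping.keys p. ?c U * indicator U \<gamma>)" for \<gamma>
  proof -
    have "ev p \<gamma> = (\<Sum>U\<in>?U ` Poly_Mapping.keys p. \<Sum>w\<in>{w \<in> Poly_Mapping.keys p. ?U w = U}.
        Poly_Mapping.lookup p w * indicator (?U w) \<gamma>)"
      unfolding ev_def by (rule sum.image_gen) simp
    also have "\<dots> = (\<Sum>U\<in>?U ` Poly_Mapping.keys p. ?c U * indicator U \<gamma>)"
      unfolding sum_distrib_right by (intro sum.cong refl) simp
    finally show ?thesis .
  qed
  moreover have "compact_open_bisection (O_groupoid T G) (?U w)" for w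
    unfolding O_groupoid_eq
    by (rule compact_open_bisection_germs_of[OF partial_homeo_word clopen_homeo_compact[OF clopen_homeo_word] germs_of_word])
  ultimately show ?thesis
    unfolding steinberg_algebra_def
    by (simp, intro exI[of _ "?U ` Poly_Mapping.keys p"] conjI exI[of _ ?c]) auto
qed

lemma ev_image: "ev ` carrier (free_algebra (generators N)) = carrier (steinberg_algebra (O_groupoid T G))"
proof
  show "ev ` carrier (free_algebra (generators N)) \<subseteq> carrier (steinberg_algebra (O_groupoid T G))"
    using ev_in_steinberg_algebra by blast
  show "carrier (steinberg_algebra (O_groupoid T G)) \<subseteq> ev ` carrier (free_algebra (generators N))"
  proof
    fix f :: "(nat \<Rightarrow> 'x) germ \<Rightarrow> 'k"
    assume "f \<in> carrier (steinberg_algebra (O_groupoid T G))"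
    then obtain \<F> c where \<F>: "finite \<F>" "\<F> \<subseteq> {U. compact_open_bisection (O_groupoid T G) U}"
      and f: "f = (\<lambda>\<gamma>. \<Sum>U\<in>\<F>. c U * indicator U \<gamma>)"
      unfolding steinberg_algebra_def by auto
    have "\<forall>U\<in>\<F>. \<exists>p\<in>carrier (free_algebra (generators N)). ev p = indicator U"
      using \<F>(2) indicator_compact_open_bisection by blast
    then obtain p where p: "\<And>U. U \<in> \<F> \<Longrightarrow> p U \<in> carrier (free_algebra (generators N)) \<and> ev (p U) = indicator U"
      by metis
    have "f \<gamma> = ev (\<Sum>U\<in>\<F>. const (c U) * p U) \<gamma>" for \<gamma>
      unfolding f ev_sum ev_const using p by (intro sum.cong) auto
    then have "f = ev (\<Sum>U\<in>\<F>. const (c U) * p U)" by blast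
    moreover have "(\<Sum>U\<in>\<F>. const (c U) * p U) \<in> carrier (free_algebra (generators N))"
      using p by (intro free_algebra_sum free_algebra_mult free_algebra_const) auto
    ultimately show "f \<in> ev ` carrier (free_algebra (generators N))" by blast
  qed
qed

lemma ev_eq_iff:
  assumes "p \<in> carrier (free_algebra (generators N))" "q \<in> carrier (free_algebra (generators N))"
  shows "ev p = ev q \<longleftrightarrow> p \<approx>\<^sub>N q"
proof
  assume "ev p = ev q"
  then have "ev (p - q) = (\<lambda>_. 0)" by (auto simp: ev_diff)
  moreover have "p - q \<in> normal_span"
    using assms by (intro free_algebra_subset_normal_span free_algebra_diff)
  ultimately show "p \<approx>\<^sub>N q" using ev_zero_imp_eqv_zero[of "p - q"] by (simp add: eq_mod_def)
qed (rule ev_eqv)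

lemma ev_one: "ev 1 = \<one>\<^bsub>steinberg_algebra (O_groupoid T G)\<^esub>"
proof -
  have "ev 1 \<gamma> = indicator (germs_of Y (Id_on (markov_seqs T))) \<gamma>" for \<gamma>
    by (rule ev_represents[OF represents_one])
  moreover have "Range (Id_on (markov_seqs T)) = markov_seqs T" by auto
  ultimately show ?thesis by (auto simp: steinberg_algebra_simps O_groupoid_eq germs_of_def)
qed

theorem presentation:
  "\<exists>\<Phi> \<in> algebra_iso (presented_algebra (generators N) (defining_rels T N n0))
      (steinberg_algebra (O_groupoid T G) :: ('k, (nat \<Rightarrow> 'x) germ \<Rightarrow> 'k) module).
    (\<forall>x. \<Phi> (presented_class (generators N) (defining_rels T N n0) (genS x))
          = indicator (germs_of Y (S_homeo T x))) \<and>
    (\<forall>x. \<Phi> (presented_class (generators N) (defining_rels T N n0) (genS' x))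
          = indicator (germs_of Y ((S_homeo T x)\<inverse>))) \<and>
    (\<forall>F\<in>N. \<Phi> (presented_class (generators N) (defining_rels T N n0) (nuc F))
          = indicator (germs_of Y F))"
proof -
  let ?B = "steinberg_algebra (O_groupoid T G) :: ('k, (nat \<Rightarrow> 'x) germ \<Rightarrow> 'k) module"
  have hom: "ev (p * q) = ev p \<otimes>\<^bsub>?B\<^esub> ev q" "ev (p + q) = ev p \<oplus>\<^bsub>?B\<^esub> ev q"
    "ev (const c * p) = c \<odot>\<^bsub>?B\<^esub> ev p" for p q c
    by (auto simp: steinberg_algebra_simps ev_mult ev_add ev_const)
  obtain \<Phi> where \<Phi>: "\<Phi> \<in> algebra_iso (presented_algebra (generators N) (defining_rels T N n0)) ?B"
    and val: "\<And>p. p \<in> carrier (free_algebra (generators N)) \<Longrightarrow>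
      \<Phi> (presented_class (generators N) (defining_rels T N n0) p) = ev p"
    using presented_algebra_isoI[OF defining_rels_closed ev_image hom(1,2) ev_one hom(3) ev_eq_iff] by blast
  have gen: "\<Phi> (presented_class (generators N) (defining_rels T N n0) (gen a)) = indicator (germs_of Y (gen_homeo a))"
    if "a \<in> generators N" for a
    using val[OF free_algebra_gen[OF that]] ev_represents[OF represents_gen] by (simp add: fun_eq_iff)
  show ?thesis
    by (rule bexI[OF _ \<Phi>]) (use gen[of "GenS _"] gen[of "GenSinv _"] gen[of "GenN _"] in simp)
qed

end

theorem theorem8p9:
  fixes T :: "'x::finite rel"
    and G :: "(nat \<Rightarrow> 'x, 'g) groupoid"
    and N :: "(nat \<Rightarrow> 'x) rel set"
    and n0 :: nat
  assumes "effective_etale_groupoid G"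
    and "Obj G = markov_space T"
    and "completely_shift_invariant T G"
    and "contracting T G"
    and "is_nucleus T G N"
    and "n0 \<ge> 1"
    and "\<And>F1 F2 u v. \<lbrakk>F1 \<in> N; F2 \<in> N; length u = n0; length v = n0\<rbrakk>
           \<Longrightarrow> (S_word_homeo T u)\<inverse> O F1 O F2 O S_word_homeo T v \<in> N"
    and no_isolated_points: "\<And>w. w \<in> markov_seqs T \<Longrightarrow> \<not> openin (markov_space T) {w}"
  shows "\<exists>\<Phi> \<in> algebra_iso
            (presented_algebra (generators N) (defining_rels T N n0))
            (steinberg_algebra (O_groupoid T G) :: ('k::field, (nat \<Rightarrow> 'x) germ \<Rightarrow> 'k) module).
           (\<forall>x. \<Phi> (presented_class (generators N) (defining_rels T N n0) (genS x))
                  = indicator (germs_of (markov_space T) (S_homeo T x))) \<and>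
           (\<forall>x. \<Phi> (presented_class (generators N) (defining_rels T N n0) (genS' x))
                  = indicator (germs_of (markov_space T) ((S_homeo T x)\<inverse>))) \<and>
           (\<forall>F\<in>N. \<Phi> (presented_class (generators N) (defining_rels T N n0) (nuc F))
                  = indicator (germs_of (markov_space T) F))"
proof -
  interpret nucleus_groupoid T G N n0 "TYPE('k)"
    using assms by (intro nucleus_groupoid.intro effective_etale_groupoid.axioms(1))
  show ?thesis by (rule presentation)
qed

end
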